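(* Let $\tilde{\mathbb W}\subset H^1(\Omega)$ and $\mathbb G\subset H^1(\Omega)^d$ be finite-dimensional subspaces, $\tilde{\mathbb W}_\Gamma:=\tilde{\mathbb W}\cap H^1_\Gamma(\Omega)$, $\mathbb G_\Gamma:=\mathbb G\cap\mathbf G_\Gamma(\Omega)$, let $\boldsymbol\Xi_X(\tilde v,\boldsymbol\psi):=\nabla\tilde v-\boldsymbol\psi$ on $\tilde{\mathbb W}_\Gamma\times\mathbb G_\Gamma$, $\mathbb Q_\Gamma:=\operatorname{Im}\boldsymbol\Xi_X$, and $\mathbb W_\Gamma:=\{v\in\tilde{\mathbb W}_\Gamma:\nabla v\in\mathbb G_\Gamma\}$. Then the mixed problem: find $(\tilde w_X,\boldsymbol\gamma_X,\mathbf q_X)\in\tilde{\mathbb W}_\Gamma\times\mathbb G_\Gamma\times\mathbb Q_\Gamma$ such that $$a(\boldsymbol\gamma_X,\boldsymbol\psi)+c(\tilde w_X,\tilde v)+(\boldsymbol\Xi_X(\tilde v,\boldsymbol\psi),\mathbf q_X)_{\mathrm{curl}}=F_1(\boldsymbol\psi)+F_2(\tilde v)\quad\forall(\tilde v,\boldsymbol\psi)\in\tilde{\mathbb W}_\Gamma\times\mathbb G_\Gamma,$$ $$(\boldsymbol\Xi_X(\tilde w_X,\boldsymbol\gamma_X),\boldsymbol\eta)_{\mathrm{curl}}=0\quad\forall\boldsymbol\eta\in\mathbb Q_\Gamma$$ is uniquely solvable for any $F_1\in\mathbb G_\Gamma^*$ and $F_2\in\tilde{\mathbb W}_\Gamma^*$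 if and only if $$\alpha_X:=\inf_{0\ne u\in\mathbb W_\Gamma}\ \sup_{0\ne v\in\mathbb W_\Gamma}\frac{B(u,v)}{\|u\|_2\|v\|_2}>0.$$
   Context: Geometry: $d\in\{2,3\}$ and $\Omega\subset\mathbb{R}^d$ is a connected Lipschitz polyhedral domain whose boundary $\Gamma=\partial\Omega$ is partitioned into disjoint sets $\Gamma_c,\Gamma_s,\Gamma_f$; $\Gamma_{cs}:=\Gamma_c\cup\Gamma_s$; $\mathbf n$ is the unit outward normal. For $d=2$: there are simply connected Lipschitz polygons $\Omega_0,\dots,\Omega_{N_H}$ with $\bar\Omega_j\subsetneq\Omega_0$ for $1\le j\le N_H$, $\bar\Omega_i\cap\bar\Omega_j=\emptyset$ for $1\le i\neq j\le N_H$, and $\Omega=\Omega_0\setminus\bigcup_{j=1}^{N_H}\bar\Omega_j$. For $d=3$: for each connected component $\Gamma_{cs}^{(i)}$, $1\le i\le N$, of $\Gamma_{cs}$ there is an open Lipschitz domain $\Omega_i\subset\mathbb{R}^3$ with $\bar\Omega_i\cap\bar\Omega=\bar\Gamma_{cs}^{(i)}$, $\Omega_i\cap\Omega=\emptyset$, the distance between $\Omega_i$ and $\Omega_j$ is strictly positive for $i\ne j$, and $\bar\Omega\cup\bar\Omega_1\cup\dots\cup\bar\Omega_N$ is a Lipschitz domain. Spaces: $\|\cdot\|_k$ is the $H^k(\Omega)$ norm (for vector fields, $\|\cdot\|_1$ is the sum of the $H^1$-norms of the components). $H^2_\Gamma(\Omega)=\{v\in H^2(\Omega): v|_{\Gamma_{cs}}=0,\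 \partial_n v|_{\Gamma_c}=0\}$; $H^1_\Gamma(\Omega)=\{v\in H^1(\Omega): v|_{\Gamma_{cs}}=0\}$; $\mathbf G_\Gamma(\Omega)=\{\boldsymbol\psi\in H^1(\Omega)^d: \boldsymbol\psi|_{\Gamma_c}=\mathbf 0,\ \boldsymbol\pi_T\boldsymbol\psi|_{\Gamma_s}=\mathbf 0\}$ with $\boldsymbol\pi_T\boldsymbol\psi=\boldsymbol\psi-(\boldsymbol\psi\cdot\mathbf n)\mathbf n$. $(\boldsymbol\theta,\boldsymbol\eta)_{\mathrm{curl}}=(\boldsymbol\theta,\boldsymbol\eta)+(\mathrm{curl}\,\boldsymbol\theta,\mathrm{curl}\,\boldsymbol\eta)$, with $(\cdot,\cdot)$ the $L^2(\Omega)$ inner product and $\mathrm{curl}$ the scalar curl $\partial_x\theta_2-\partial_y\theta_1$ if $d=2$, the usual curl if $d=3$. Bilinear form: $B:H^2(\Omega)\times H^2(\Omega)\to\mathbb R$ is bilinear with (i) $|B(u,v)|\le M_B\|u\|_2\|v\|_2$ for all $u,v\in H^2(\Omega)$, for some $M_B>0$; (ii) $\inf_{0\ne u\in H^2_\Gamma(\Omega)}\sup_{0\ne v\in H^2_\Gamma(\Omega)}\frac{B(u,v)}{\|u\|_2\|v\|_2}\ge\alpha$ for some $\alpha>0$; (iii) $\sup_{u\in H^2_\Gamma(\Omega)}B(u,v)>0$ for every $0\neq v\in H^2_\Gamma(\Omega)$. Moreover $B(w,v)=a(\nabla w,\nabla v)+c(w,v)$ for all $w,v\in H^2(\Omega)$,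 where $a$ and $c$ are bilinear forms on $H^1(\Omega)^d$ and $H^1(\Omega)$ with $|a(\boldsymbol\theta,\boldsymbol\psi)|\le M\|\boldsymbol\theta\|_1\|\boldsymbol\psi\|_1$ and $|c(w,v)|\le M\|w\|_1\|v\|_1$ for some $M>0$. *)

theory Defs
  imports "HOL-Analysis.Analysis"
begin

section \<open>Geometry\<close>

text \<open>
  Coordinates of \<open>\<real>\<^sup>d\<close> are indexed by a type \<open>'d\<close> with \<open>d\<close> elements.  Where individual
  coordinates are named (only in the curl), \<open>'d\<close> is a finite commutative ring with \<open>0 \<noteq> 1\<close>, as are
  the numeral types \<open>2\<close> and \<open>3\<close>, so that \<open>1, 2\<close> respectively \<open>1, 2, 3\<close> enumerate the coordinates,
  as they do for \<open>real ^ 2\<close> and \<open>real ^ 3\<close>.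
\<close>

text \<open>
  Locally, after a rotation taking the last coordinate direction to \<open>e\<close>, the set is the
  subgraph of a Lipschitz function of the remaining coordinates.
  Connectedness is not part of the notion.
\<close>

definition lipschitz_domain :: "'a::euclidean_space set \<Rightarrow> bool" where
  "lipschitz_domain \<Omega> \<longleftrightarrow> open \<Omega> \<and> bounded \<Omega> \<and> \<Omega> \<noteq> {} \<and>
     (\<forall>p\<in>frontier \<Omega>. \<exists>r>0. \<exists>e L. \<exists>\<phi>::'a \<Rightarrow> real. norm e = 1 \<and> lipschitz_on L {y. y \<bullet> e = 0} \<phi> \<and>
        \<Omega> \<inter> ball p r = {x \<in> ball p r. x \<bullet> e < \<phi> (x - (x \<bullet> e) *\<^sub>R e)})"

definition polyhedral :: "'a::euclidean_space set \<Rightarrow> bool" where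
  "polyhedral \<Omega> \<longleftrightarrow> (\<exists>\<F>. finite \<F> \<and> (\<forall>P\<in>\<F>. polytope P) \<and> closure \<Omega> = \<Union>\<F>)"

definition polygonal_with_holes :: "'a::euclidean_space set \<Rightarrow> bool" where
  "polygonal_with_holes \<Omega> \<longleftrightarrow>
     (\<exists>(N::nat) D. (\<forall>j\<le>N. simply_connected (D j) \<and> lipschitz_domain (D j) \<and> polyhedral (D j)) \<and>
        (\<forall>j\<in>{1..N}. closure (D j) \<subset> D 0) \<and>
        (\<forall>i\<in>{1..N}. \<forall>j\<in>{1..N}. i \<noteq> j \<longrightarrow> closure (D i) \<inter> closure (D j) = {}) \<and>
        \<Omega> = D 0 - (\<Union>j\<in>{1..N}. closure (D j)))"

definition extendable_across :: "'a::euclidean_space set \<Rightarrow> 'a set \<Rightarrow> bool" where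
  "extendable_across \<Omega> \<Gamma>cs \<longleftrightarrow>
     finite (components \<Gamma>cs) \<and>
     (\<exists>D. (\<forall>C\<in>components \<Gamma>cs. lipschitz_domain (D C) \<and>
              closure (D C) \<inter> closure \<Omega> = closure C \<and> D C \<inter> \<Omega> = {}) \<and>
          (\<forall>C\<in>components \<Gamma>cs. \<forall>C'\<in>components \<Gamma>cs. C \<noteq> C' \<longrightarrow> setdist (D C) (D C') > 0) \<and>
          lipschitz_domain (interior (closure \<Omega> \<union> (\<Union>C\<in>components \<Gamma>cs. closure (D C)))))"

text \<open>
  The unit outward normal at a point in the relative interior of a flat boundary face.  The other
  boundary points of a polyhedral domain form a set of surface measure zero.
\<close>

definition outward_normal :: "'a::euclidean_space set \<Rightarrow> 'a \<Rightarrow> 'a" where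
  "outward_normal \<Omega> x =
     (THE n. norm n = 1 \<and> (\<exists>r>0. \<Omega> \<inter> ball x r = {y \<in> ball x r. (y - x) \<bullet> n < 0}))"

text \<open>
  Hausdorff measure of integer dimension \<open>s \<ge> 1\<close>, normalised to agree with Lebesgue measure on
  \<open>s\<close>-dimensional planes.  The outer measure is a metric outer measure, hence countably additive on
  the Borel sets (Caratheodory's criterion), so that \<open>measure_of\<close> indeed yields its restriction.
\<close>

definition hausdorff_outer :: "nat \<Rightarrow> 'a::euclidean_space set \<Rightarrow> ennreal" where
  "hausdorff_outer s A =
     (SUP \<delta>\<in>{0::real<..}.
        INF E\<in>{E. A \<subseteq> (\<Union>k. E k) \<and> (\<forall>k. bounded (E k) \<and> diameter (E k) \<le> \<delta>)}.
          (\<Sum>k. ennreal (unit_ball_vol (real s) * (diameter (E k) / 2) ^ s)))"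

definition hausdorff_measure :: "nat \<Rightarrow> 'a::euclidean_space measure" where
  "hausdorff_measure s = measure_of UNIV (sets borel) (hausdorff_outer s)"

abbreviation surface_measure :: "'a::euclidean_space measure" where
  "surface_measure \<equiv> hausdorff_measure (DIM('a) - 1)"


section \<open>Functions modulo equality almost everywhere\<close>

text \<open>
  A function on \<open>\<Omega>\<close> is identified with the class of its extension by zero to \<open>\<real>\<^sup>d\<close>.  Thus equality
  of such classes is equality almost everywhere in \<open>\<Omega>\<close>, and subspaces, spans, products and vector
  fields (\<open>'a ae_fun ^ 'd\<close>) are those of the library.
\<close>

quotient_type (overloaded) 'a ae_fun = "'a::euclidean_space \<Rightarrow> real" /
  "\<lambda>f g. AE x in lebesgue. f x = g x"
proof (rule equivpI)
  show "symp (\<lambda>f g::'a \<Rightarrow> real. AE x in lebesgue. f x = g x)"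
    by (auto intro!: sympI)
  show "transp (\<lambda>f g::'a \<Rightarrow> real. AE x in lebesgue. f x = g x)"
  proof (rule transpI)
    fix f g h :: "'a \<Rightarrow> real"
    assume "AE x in lebesgue. f x = g x" "AE x in lebesgue. g x = h x"
    then show "AE x in lebesgue. f x = h x" by eventually_elim simp
  qed
qed (auto intro!: reflpI)

instantiation ae_fun :: (euclidean_space) real_vector
begin

lift_definition zero_ae_fun :: "'a ae_fun" is "\<lambda>_. 0" .

lift_definition plus_ae_fun :: "'a ae_fun \<Rightarrow> 'a ae_fun \<Rightarrow> 'a ae_fun" is "\<lambda>f g x. f x + g x"
  by auto

lift_definition minus_ae_fun :: "'a ae_fun \<Rightarrow> 'a ae_fun \<Rightarrow> 'a ae_fun" is "\<lambda>f g x. f x - g x"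
  by auto

lift_definition uminus_ae_fun :: "'a ae_fun \<Rightarrow> 'a ae_fun" is "\<lambda>f x. - f x"
  by auto

lift_definition scaleR_ae_fun :: "real \<Rightarrow> 'a ae_fun \<Rightarrow> 'a ae_fun" is "\<lambda>c f x. c * f x"
  by auto

instance
  by standard (transfer, simp add: algebra_simps)+

end

lift_definition restriction :: "'a::euclidean_space set \<Rightarrow> ('a \<Rightarrow> real) \<Rightarrow> 'a ae_fun"
  is "\<lambda>\<Omega> f x. indicator \<Omega> x * f x" .

text \<open>
  All uses of \<^const>\<open>rep_ae_fun\<close>, an arbitrary representative, are under integrals or up to null sets.
\<close>

definition L2 :: "'a::euclidean_space set \<Rightarrow> 'a ae_fun set" where
  "L2 \<Omega> = {u. rep_ae_fun u \<in> borel_measurable lebesgue \<and>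
              integrable lebesgue (\<lambda>x. (rep_ae_fun u x)\<^sup>2) \<and>
              (AE x in lebesgue. x \<notin> \<Omega> \<longrightarrow> rep_ae_fun u x = 0)}"

definition L2_inner :: "'a::euclidean_space set \<Rightarrow> 'a ae_fun \<Rightarrow> 'a ae_fun \<Rightarrow> real" where
  "L2_inner \<Omega> u v = (LINT x:\<Omega>|lebesgue. rep_ae_fun u x * rep_ae_fun v x)"


section \<open>Weak derivatives and Sobolev spaces\<close>

type_synonym 'd space = "(real, 'd) vec"
type_synonym 'd field = "'d space ae_fun"
type_synonym 'd vfield = "('d field, 'd) vec"

definition partial_deriv :: "'d::finite \<Rightarrow> ('d space \<Rightarrow> real) \<Rightarrow> 'd space \<Rightarrow> real" where
  "partial_deriv i f x = frechet_derivative f (at x) (axis i 1)"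

primrec times_cont_differentiable :: "nat \<Rightarrow> ('d::finite space \<Rightarrow> real) \<Rightarrow> bool" where
  "times_cont_differentiable 0 f \<longleftrightarrow> continuous_on UNIV f"
| "times_cont_differentiable (Suc k) f \<longleftrightarrow>
     f differentiable_on UNIV \<and> (\<forall>i. times_cont_differentiable k (partial_deriv i f))"

definition smooth :: "('d::finite space \<Rightarrow> real) \<Rightarrow> bool" where
  "smooth f \<longleftrightarrow> (\<forall>k. times_cont_differentiable k f)"

definition test_functions :: "'d::finite space set \<Rightarrow> ('d space \<Rightarrow> real) set" where
  "test_functions \<Omega> =
     {\<phi>. smooth \<phi> \<and> compact (closure {x. \<phi> x \<noteq> 0}) \<and> closure {x. \<phi> x \<noteq> 0} \<subseteq> \<Omega>}"

definition has_weak_deriv ::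
  "'d::finite space set \<Rightarrow> 'd \<Rightarrow> 'd field \<Rightarrow> 'd field \<Rightarrow> bool" where
  "has_weak_deriv \<Omega> i u g \<longleftrightarrow>
     (\<forall>\<phi>\<in>test_functions \<Omega>.
        (LINT x:\<Omega>|lebesgue. rep_ae_fun u x * partial_deriv i \<phi> x) =
        - (LINT x:\<Omega>|lebesgue. rep_ae_fun g x * \<phi> x))"

definition weak_deriv ::
  "'d::finite space set \<Rightarrow> 'd \<Rightarrow> 'd field \<Rightarrow> 'd field" where
  "weak_deriv \<Omega> i u = (THE g. g \<in> L2 \<Omega> \<and> has_weak_deriv \<Omega> i u g)"

definition grad :: "'d::finite space set \<Rightarrow> 'd field \<Rightarrow> 'd vfield" where
  "grad \<Omega> u = (\<chi> i. weak_deriv \<Omega> i u)"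

primrec sobolev :: "nat \<Rightarrow> 'd::finite space set \<Rightarrow> 'd field set" where
  "sobolev 0 \<Omega> = L2 \<Omega>"
| "sobolev (Suc k) \<Omega> = {u \<in> L2 \<Omega>. \<forall>i. \<exists>g \<in> sobolev k \<Omega>. has_weak_deriv \<Omega> i u g}"

text \<open>The squared \<open>H\<^sup>k\<close> norm is the sum of \<open>\<parallel>\<nabla>\<^sup>j u\<parallel>\<^sup>2\<close> (full derivative tensors) over \<open>j \<le> k\<close>.\<close>

primrec sobolev_norm_sq :: "nat \<Rightarrow> 'd::finite space set \<Rightarrow> 'd field \<Rightarrow> real" where
  "sobolev_norm_sq 0 \<Omega> u = L2_inner \<Omega> u u"
| "sobolev_norm_sq (Suc k) \<Omega> u =
     L2_inner \<Omega> u u + (\<Sum>i\<in>UNIV. sobolev_norm_sq k \<Omega> (weak_deriv \<Omega> i u))"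

definition sobolev_norm :: "nat \<Rightarrow> 'd::finite space set \<Rightarrow> 'd field \<Rightarrow> real" where
  "sobolev_norm k \<Omega> u = sqrt (sobolev_norm_sq k \<Omega> u)"

definition sobolev_vec :: "nat \<Rightarrow> 'd::finite space set \<Rightarrow> 'd vfield set" where
  "sobolev_vec k \<Omega> = {\<psi>. \<forall>i. \<psi> $ i \<in> sobolev k \<Omega>}"

definition sobolev_vec_norm ::
  "nat \<Rightarrow> 'd::finite space set \<Rightarrow> 'd vfield \<Rightarrow> real" where
  "sobolev_vec_norm k \<Omega> \<psi> = (\<Sum>i\<in>UNIV. sobolev_norm k \<Omega> (\<psi> $ i))"


section \<open>The weak curl\<close>

text \<open>
  \<open>rot \<Omega> i j \<theta>\<close> is \<open>\<partial>\<^sub>i \<theta>\<^sub>j - \<partial>\<^sub>j \<theta>\<^sub>i\<close> in the sense of distributions.  It may be in \<open>L\<^sup>2\<close> although the two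
  derivatives separately are not, e.g. for the gradient of an \<open>H\<^sup>1\<close> function.
\<close>

definition has_weak_rot ::
  "'d::finite space set \<Rightarrow> 'd \<Rightarrow> 'd \<Rightarrow> 'd vfield \<Rightarrow> 'd field \<Rightarrow> bool" where
  "has_weak_rot \<Omega> i j \<theta> g \<longleftrightarrow>
     (\<forall>\<phi>\<in>test_functions \<Omega>.
        (LINT x:\<Omega>|lebesgue. rep_ae_fun (\<theta> $ j) x * partial_deriv i \<phi> x
                         - rep_ae_fun (\<theta> $ i) x * partial_deriv j \<phi> x) =
        - (LINT x:\<Omega>|lebesgue. rep_ae_fun g x * \<phi> x))"

definition rot ::
  "'d::finite space set \<Rightarrow> 'd \<Rightarrow> 'd \<Rightarrow> 'd vfield \<Rightarrow> 'd field" where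
  "rot \<Omega> i j \<theta> = (THE g. g \<in> L2 \<Omega> \<and> has_weak_rot \<Omega> i j \<theta> g)"

text \<open>The list of components of the curl: the scalar curl if \<open>d = 2\<close>, three components if \<open>d = 3\<close>.\<close>

definition curl ::
  "'d::{finite, comm_ring_1} space set \<Rightarrow> 'd vfield \<Rightarrow> 'd field list" where
  "curl \<Omega> \<theta> = (if CARD('d) = 2 then [rot \<Omega> 1 2 \<theta>] else [rot \<Omega> 2 3 \<theta>, rot \<Omega> 3 1 \<theta>, rot \<Omega> 1 2 \<theta>])"

definition curl_inner ::
  "'d::{finite, comm_ring_1} space set \<Rightarrow> 'd vfield \<Rightarrow> 'd vfield \<Rightarrow> real" where
  "curl_inner \<Omega> \<theta> \<eta> =
     (\<Sum>i\<in>UNIV. L2_inner \<Omega> (\<theta> $ i) (\<eta> $ i)) + sum_list (map2 (L2_inner \<Omega>) (curl \<Omega> \<theta>) (curl \<Omega> \<eta>))"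


section \<open>Traces and boundary conditions\<close>

text \<open>
  The trace operator \<open>H\<^sup>1(\<Omega>) \<rightarrow> L\<^sup>2(\<partial>\<Omega>)\<close> is the continuous extension of \<open>f \<mapsto> f|\<^sub>\<partial>\<^sub>\<Omega>\<close> from functions
  smooth up to the boundary; \<open>has_trace \<Omega> v g\<close> is its graph.
\<close>

definition has_trace ::
  "'d::finite space set \<Rightarrow> 'd field \<Rightarrow> ('d space \<Rightarrow> real) \<Rightarrow> bool" where
  "has_trace \<Omega> v g \<longleftrightarrow> v \<in> sobolev 1 \<Omega> \<and> g \<in> borel_measurable borel \<and>
     (\<exists>f::nat \<Rightarrow> 'd space \<Rightarrow> real. (\<forall>k. smooth (f k)) \<and>
        (\<lambda>k. sobolev_norm 1 \<Omega> (restriction \<Omega> (f k) - v)) \<longlonglongrightarrow> 0 \<and>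
        (\<lambda>k. \<integral>\<^sup>+x\<in>frontier \<Omega>. ennreal ((f k x - g x)\<^sup>2) \<partial>surface_measure) \<longlonglongrightarrow> 0)"

definition has_trace_vec ::
  "'d::finite space set \<Rightarrow> 'd vfield \<Rightarrow> ('d space \<Rightarrow> 'd space) \<Rightarrow> bool" where
  "has_trace_vec \<Omega> \<psi> g \<longleftrightarrow> (\<forall>i. has_trace \<Omega> (\<psi> $ i) (\<lambda>x. g x $ i))"

definition tangential :: "'a::real_inner \<Rightarrow> 'a \<Rightarrow> 'a" where
  "tangential n \<psi> = \<psi> - (\<psi> \<bullet> n) *\<^sub>R n"

definition H1_bc :: "'d::finite space set \<Rightarrow> 'd space set \<Rightarrow> 'd field set" where
  "H1_bc \<Omega> \<Gamma>cs = {v \<in> sobolev 1 \<Omega>.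
     \<exists>g. has_trace \<Omega> v g \<and> (AE x in surface_measure. x \<in> \<Gamma>cs \<longrightarrow> g x = 0)}"

definition H2_bc ::
  "'d::finite space set \<Rightarrow> 'd space set \<Rightarrow> 'd space set \<Rightarrow> 'd field set" where
  "H2_bc \<Omega> \<Gamma>c \<Gamma>s = {v \<in> sobolev 2 \<Omega>.
     (\<exists>g. has_trace \<Omega> v g \<and> (AE x in surface_measure. x \<in> \<Gamma>c \<union> \<Gamma>s \<longrightarrow> g x = 0)) \<and>
     (\<exists>h. has_trace_vec \<Omega> (grad \<Omega> v) h \<and>
          (AE x in surface_measure. x \<in> \<Gamma>c \<longrightarrow> h x \<bullet> outward_normal \<Omega> x = 0))}"

definition G_bc ::
  "'d::finite space set \<Rightarrow> 'd space set \<Rightarrow> 'd space set \<Rightarrow> 'd vfield set" where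
  "G_bc \<Omega> \<Gamma>c \<Gamma>s = {\<psi> \<in> sobolev_vec 1 \<Omega>.
     \<exists>h. has_trace_vec \<Omega> \<psi> h \<and>
         (AE x in surface_measure. x \<in> \<Gamma>c \<longrightarrow> h x = 0) \<and>
         (AE x in surface_measure. x \<in> \<Gamma>s \<longrightarrow> tangential (outward_normal \<Omega> x) (h x) = 0)}"


section \<open>Linear and bilinear forms on subspaces\<close>

definition linear_form_on :: "'v::real_vector set \<Rightarrow> ('v \<Rightarrow> real) \<Rightarrow> bool" where
  "linear_form_on V F \<longleftrightarrow>
     (\<forall>u\<in>V. \<forall>v\<in>V. F (u + v) = F u + F v) \<and> (\<forall>r. \<forall>v\<in>V. F (r *\<^sub>R v) = r * F v)"

definition bilinear_form_on :: "'v::real_vector set \<Rightarrow> ('v \<Rightarrow> 'v \<Rightarrow> real) \<Rightarrow> bool" where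
  "bilinear_form_on V B \<longleftrightarrow>
     (\<forall>u\<in>V. linear_form_on V (\<lambda>v. B u v)) \<and> (\<forall>v\<in>V. linear_form_on V (\<lambda>u. B u v))"

definition dual_space :: "'v::real_vector set \<Rightarrow> ('v \<Rightarrow> real) \<Rightarrow> ('v \<Rightarrow> real) set" where
  "dual_space V nrm = {F. linear_form_on V F \<and> (\<exists>K. \<forall>v\<in>V. \<bar>F v\<bar> \<le> K * nrm v)}"

definition finite_dim_subspace :: "'v::real_vector set \<Rightarrow> bool" where
  "finite_dim_subspace V \<longleftrightarrow> (\<exists>S. finite S \<and> V = span S)"

text \<open>Over \<open>V = {0}\<close> the infimum is \<open>\<infinity>\<close>.\<close>

definition inf_sup :: "'v::real_vector set \<Rightarrow> ('v \<Rightarrow> real) \<Rightarrow> ('v \<Rightarrow> 'v \<Rightarrow> real) \<Rightarrow> ereal" where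
  "inf_sup V nrm B = (INF u\<in>V - {0}. SUP v\<in>V - {0}. ereal (B u v / (nrm u * nrm v)))"

definition Xi :: "'d::finite space set \<Rightarrow> 'd field \<times> 'd vfield \<Rightarrow> 'd vfield" where
  "Xi \<Omega> = (\<lambda>(v, \<psi>). grad \<Omega> v - \<psi>)"

end

theory Submission
  imports Defs
begin

text \<open>
  Write \<open>V = Wt\<^sub>\<Gamma> \<times> G\<^sub>\<Gamma>\<close>, \<open>X = Xi \<Omega>\<close> and \<open>A (w, \<gamma>) (v, \<psi>) = a \<gamma> \<psi> + c w v\<close>.  The problem is a
  finite-dimensional saddle point problem whose multiplier space is the whole image \<open>X ` V\<close>, on
  which \<open>curl_inner\<close> is an inner product.  A functional on \<open>V\<close> that vanishes on \<open>ker X\<close> is therefore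
  represented by a unique multiplier, so unique solvability is equivalent to nondegeneracy of \<open>A\<close>
  on \<open>ker X = {(v, \<nabla>v) | v \<in> W\<^sub>\<Gamma>}\<close>.  There \<open>A\<close> is \<open>B\<close>, and in finite dimension an inf-sup
  constant is positive iff the form is nondegenerate.

  The analytic content is that all the objects are linear.  Weak derivatives and rotations are unique
  because smooth bumps approximate indicators of boxes; restrictions of smooth functions are in
  \<open>H\<^sup>1\<close>, so that traces are linear; and gradients have weak rotation zero by symmetry of second
  derivatives, so that \<open>curl_inner\<close> is defined on the image of \<open>X\<close>.
\<close>

section \<open>Finite-dimensional saddle point problems\<close>

text \<open>\<open>weak_deriv\<close> and \<open>rot\<close> are definite descriptions, and
  \<open>a\<close>, \<open>B\<close>, \<open>c\<close> are forms on Sobolev spaces only, so nothing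
  here is linear on a whole type. All algebra is therefore relative to a subspace V, with linearity
  assumed on V alone.

  Three facts fix the shape of the abstract statements. Uniqueness for zero data already forces
  nondegeneracy on the kernel, while nondegeneracy yields a solution for every linear right-hand
  side, so a set of right-hand sides only has to consist of linear forms and to contain 0.
  Nondegeneracy in one argument passes to the other because both arguments range over the same
  finite-dimensional space. Finally, positivity of the inf-sup constant depends on the norm only
  through the norm axioms on \<open>W\<^sub>\<Gamma>\<close>; this is the form in which the H^2 norm
  enters. For \<open>W\<^sub>\<Gamma> = {0}\<close> the infimum is infinite, in agreement with
  nondegeneracy being vacuous.\<close>

lemma linear_form_on_zero:
  assumes "subspace V" "linear_form_on V F"
  shows "F 0 = 0"
  using assms subspace_0[of V] unfolding linear_form_on_def by (metis mult_zero_left scaleR_zero_left)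

lemma linear_form_on_diff:
  assumes "subspace V" "linear_form_on V F" "u \<in> V" "v \<in> V"
  shows "F (u - v) = F u - F v"
proof -
  have "(-1) *\<^sub>R v \<in> V" using assms(1,4) by (rule subspace_scale)
  then have "F (u + (-1) *\<^sub>R v) = F u + F ((-1) *\<^sub>R v)" "F ((-1) *\<^sub>R v) = (-1) * F v"
    using assms unfolding linear_form_on_def by blast+
  then show ?thesis by simp
qed

lemma linear_form_on_eqI:
  assumes "subspace V" "linear_form_on V F" "linear_form_on V G" "V = span S"
    and "\<And>b. b \<in> S \<Longrightarrow> F b = G b" "v \<in> V"
  shows "F v = G v"
proof -
  have "v \<in> V \<and> F v = G v" if "v \<in> span S" for v
    using that
  proof (induction rule: span_induct_alt)
    case base
    then show ?case using linear_form_on_zero assms subspace_0 by metis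
  next
    case (step c x y)
    have "x \<in> V" using step assms span_base by auto
    moreover have "c *\<^sub>R x \<in> V" using calculation assms subspace_scale by blast
    ultimately show ?case using step assms(2,3,5) subspace_add[OF assms(1)] unfolding linear_form_on_def by auto
  qed
  then show ?thesis using assms by auto
qed

section \<open>Bases of finite-dimensional subspaces\<close>

lemma finite_dim_subspace_basis:
  assumes "finite_dim_subspace V"
  obtains B where "finite B" "independent B" "V = span B" "subspace V" "B \<subseteq> V"
proof -
  obtain S where S: "finite S" "V = span S" using assms unfolding finite_dim_subspace_def by blast
  obtain B where B: "B \<subseteq> V" "independent B" "V \<subseteq> span B"
    using maximal_independent_subset[of V] by auto
  have "finite B" using independent_span_bound[OF S(1) B(2)] B(1) S by auto
  moreover have "V = span B" using B S by (metis span_minimal subset_antisym subspace_span)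
  ultimately show ?thesis using that B S by auto
qed

lemma finite_dim_subspace_mono:
  assumes "finite_dim_subspace V" "subspace U" "U \<subseteq> V"
  shows "finite_dim_subspace U"
proof -
  obtain S where S: "finite S" "V = span S" using assms unfolding finite_dim_subspace_def by blast
  obtain B where B: "B \<subseteq> U" "independent B" "U \<subseteq> span B"
    using maximal_independent_subset[of U] by auto
  have "finite B" using independent_span_bound[OF S(1) B(2)] B(1) S assms by auto
  moreover have "U = span B" using B assms by (metis span_minimal subset_antisym)
  ultimately show ?thesis unfolding finite_dim_subspace_def by auto
qed

lemma finite_dim_subspace_Times:
  assumes "finite_dim_subspace U" "finite_dim_subspace V"
  shows "finite_dim_subspace (U \<times> V)"
proof -
  obtain S where S: "finite S" "U = span S" using assms(1) unfolding finite_dim_subspace_def by blast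
  obtain T where T: "finite T" "V = span T" using assms(2) unfolding finite_dim_subspace_def by blast
  let ?R = "(\<lambda>u. (u, 0)) ` S \<union> (\<lambda>v. (0, v)) ` T"
  have l1: "linear (\<lambda>u::'a. (u, 0::'b))" and l2: "linear (\<lambda>v::'b. (0::'a, v))"
    by (auto intro!: linearI)
  have "U \<times> V \<subseteq> span ?R"
  proof
    fix x assume x: "x \<in> U \<times> V"
    have "(fst x, 0::'b) \<in> (\<lambda>u. (u, 0)) ` span S" "(0::'a, snd x) \<in> Pair 0 ` span T"
      using x S(2) T(2) by (simp_all add: image_iff mem_Times_iff)
    then have "(fst x, 0::'b) \<in> span ((\<lambda>u. (u, 0)) ` S)" "(0::'a, snd x) \<in> span ((\<lambda>v. (0, v)) ` T)"
      using linear_span_image[OF l1, of S] linear_span_image[OF l2, of T] by auto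
    then have "(fst x, 0) \<in> span ?R" "(0, snd x) \<in> span ?R"
      using span_mono[of _ ?R] by blast+
    from span_add[OF this] show "x \<in> span ?R" by auto
  qed
  moreover have "span ?R \<subseteq> U \<times> V"
  proof (rule span_minimal)
    show "?R \<subseteq> U \<times> V" using S T by (auto intro: span_base span_zero)
    show "subspace (U \<times> V)" using S T subspace_Times by auto
  qed
  ultimately show ?thesis unfolding finite_dim_subspace_def using S T
    by (metis finite_UnI finite_imageI subset_antisym)
qed

text \<open>The values of \<open>b u\<close> on a basis, used as coordinates, define an endomorphism
  of V. Nondegeneracy is its injectivity; counting dimensions gives surjectivity, and a preimage of
  the vector with coordinates \<open>F s\<close> represents F.\<close>

lemma nondegenerate_form_represents:
  assumes V: "finite_dim_subspace V" and b: "bilinear_form_on V b"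
    and nd: "\<And>u. u \<in> V \<Longrightarrow> (\<And>v. v \<in> V \<Longrightarrow> b u v = 0) \<Longrightarrow> u = 0"
    and F: "linear_form_on V F"
  obtains u where "u \<in> V" "\<And>v. v \<in> V \<Longrightarrow> b u v = F v"
proof -
  obtain S where S: "finite S" "independent S" "V = span S" "subspace V" "S \<subseteq> V"
    using finite_dim_subspace_basis[OF V] by metis
  have bl: "linear_form_on V (\<lambda>v. b u v)" "linear_form_on V (\<lambda>v. b v u)" if "u \<in> V" for u
    using b that unfolding bilinear_form_on_def by auto
  define T where "T u = (\<Sum>s\<in>S. b u s *\<^sub>R s)" for u
  \<comment> \<open>\<open>T\<close> is known to be linear on V only, because \<open>b\<close> is
    bilinear there; \<open>g\<close> is a linear map of the whole space that agrees with it on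
    V.\<close>
  obtain g where g: "linear g" "\<And>x. x \<in> S \<Longrightarrow> g x = T x"
    using linear_independent_extend[OF S(2)] by metis
  have gT: "g u = T u" if "u \<in> V" for u
  proof -
    have "u \<in> V \<and> g u = T u" if "u \<in> span S" for u
      using that
    proof (induction rule: span_induct_alt)
      case base
      have "b 0 s = 0" if "s \<in> S" for s
        using linear_form_on_zero[OF S(4) bl(2)] that S by auto
      then show ?case using linear_0[OF g(1)] S subspace_0 by (auto simp: T_def)
    next
      case (step c x y)
      have x: "x \<in> V" and cx: "c *\<^sub>R x \<in> V" using step S subspace_scale by blast+
      have "T (c *\<^sub>R x + y) = c *\<^sub>R T x + T y"
        unfolding T_def scaleR_sum_right sum.distrib[symmetric]
      proof (rule sum.cong)
        fix s assume "s \<in> S"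
        then have "b (c *\<^sub>R x + y) s = c * b x s + b y s"
          using bl(2)[of s] x cx step S unfolding linear_form_on_def by auto
        then show "b (c *\<^sub>R x + y) s *\<^sub>R s = c *\<^sub>R b x s *\<^sub>R s + b y s *\<^sub>R s"
          by (simp add: algebra_simps)
      qed simp
      moreover have "g (c *\<^sub>R x + y) = c *\<^sub>R g x + g y" using g(1) by (simp add: linear_add linear_scale)
      moreover have "c *\<^sub>R x + y \<in> V" using cx step subspace_add[OF S(4)] by blast
      ultimately show ?case using step g by simp
    qed
    then show ?thesis using that S by auto
  qed
  have TV: "T u \<in> V" for u
    unfolding T_def using S by (auto intro!: subspace_sum subspace_scale)
  have ker: "u = 0" if "u \<in> V" "T u = 0" for u
  proof (rule nd[OF that(1)])
    have *: "b u s = 0" if "s \<in> S" for s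
      using \<open>T u = 0\<close> S(2) that independentD[OF S(2,1) subset_refl] unfolding T_def by blast
    fix v assume v: "v \<in> V"
    have "linear_form_on V (\<lambda>_. 0)" unfolding linear_form_on_def by auto
    from linear_form_on_eqI[OF S(4) bl(1)[OF \<open>u \<in> V\<close>] this S(3) _ v]
    show "b u v = 0" using * by auto
  qed
  have inj: "inj_on g (span S)"
  proof (rule inj_onI)
    fix x y assume xy: "x \<in> span S" "y \<in> span S" "g x = g y"
    then have "x - y \<in> V" using S subspace_diff by blast
    moreover have "g (x - y) = 0" using xy linear_diff[OF g(1)] by simp
    ultimately show "x = y" using ker gT by fastforce
  qed
  have ind: "independent (g ` S)" using linear_independent_injective_image[OF g(1) S(2) inj] .
  have card: "card (g ` S) = card S" using inj span_superset by (metis card_image inj_on_subset)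
  have sub: "g ` S \<subseteq> span S" using g TV S by auto
  \<comment> \<open>Otherwise x together with the images of the basis would be
    \<open>card S + 1\<close> independent vectors in the span of S.\<close>
  have "x \<in> span (g ` S)" if x: "x \<in> span S" for x
  proof (rule ccontr)
    assume n: "x \<notin> span (g ` S)"
    then have "independent (insert x (g ` S))" using ind by (simp add: independent_insert span_base)
    from independent_span_bound[OF S(1) this] sub x
    have "card (insert x (g ` S)) \<le> card S" by auto
    moreover have "x \<notin> g ` S" using n span_base[of x "g ` S"] by metis
    ultimately show False using card S(1) by auto
  qed
  then have surj: "V \<subseteq> g ` V" unfolding S(3) linear_span_image[OF g(1), of S, symmetric] by blast
  have "(\<Sum>s\<in>S. F s *\<^sub>R s) \<in> V" using S by (auto intro!: subspace_sum subspace_scale)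
  then have "(\<Sum>s\<in>S. F s *\<^sub>R s) \<in> g ` V" using surj by (rule rev_subsetD)
  then obtain u where u: "u \<in> V" "g u = (\<Sum>s\<in>S. F s *\<^sub>R s)" by (metis imageE)
  then have "(\<Sum>s\<in>S. (b u s - F s) *\<^sub>R s) = 0"
    unfolding gT[OF u(1)] T_def by (simp add: scaleR_diff_left sum_subtractf)
  then have *: "b u s = F s" if "s \<in> S" for s
    using independentD[OF S(2,1) subset_refl, of "\<lambda>s. b u s - F s" s] that by simp
  have "b u v = F v" if "v \<in> V" for v
    using linear_form_on_eqI[OF S(4) bl(1)[OF u(1)] F S(3) *] that by blast
  then show ?thesis using that u by blast
qed

section \<open>Transposed forms and the inf-sup constant\<close>

lemma bilinear_form_on_transpose: "bilinear_form_on V b \<Longrightarrow> bilinear_form_on V (\<lambda>u v. b v u)"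
  unfolding bilinear_form_on_def by auto

lemma linear_form_on_coordinate:
  assumes "independent S" "V = span S"
  shows "linear_form_on V (\<lambda>v. representation S v s)"
  using assms unfolding linear_form_on_def by (simp add: representation_add representation_scale)

text \<open>Every coordinate functional is \<open>b u\<close> for some u in V, so all coordinates of
  v vanish.\<close>

lemma nondegenerate_transpose:
  assumes V: "finite_dim_subspace V" and b: "bilinear_form_on V b"
    and nd: "\<And>u. u \<in> V \<Longrightarrow> (\<And>v. v \<in> V \<Longrightarrow> b u v = 0) \<Longrightarrow> u = 0"
    and v: "v \<in> V" "\<And>u. u \<in> V \<Longrightarrow> b u v = 0"
  shows "v = 0"
proof -
  obtain S where S: "finite S" "independent S" "V = span S" "subspace V" "S \<subseteq> V"
    using finite_dim_subspace_basis[OF V] by metis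
  have "representation S v s = 0" for s
    using nondegenerate_form_represents[OF V b nd linear_form_on_coordinate[OF S(2,3), of s]] v
    by metis
  then show ?thesis
    using sum_representation_eq[OF S(2) _ S(1) subset_refl, of v] v S by simp
qed

text \<open>For the lower bound an explicit constant takes the place of compactness of the unit
  sphere. If the supremum at some nonzero u were below \<open>1 / C\<close>, testing with the
  vectors dual to a basis would make all coordinates of u so small that the triangle inequality
  gives \<open>nrm u < nrm u\<close>.\<close>

lemma inf_sup_pos_iff_nondegenerate:
  assumes V: "finite_dim_subspace V" and b: "bilinear_form_on V b"
    and pos: "\<And>u. u \<in> V \<Longrightarrow> u \<noteq> 0 \<Longrightarrow> nrm u > 0"
    and tri: "\<And>u v. u \<in> V \<Longrightarrow> v \<in> V \<Longrightarrow> nrm (u + v) \<le> nrm u + nrm v"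
    and scale: "\<And>r u. u \<in> V \<Longrightarrow> nrm (r *\<^sub>R u) = \<bar>r\<bar> * nrm u"
  shows "inf_sup V nrm b > 0 \<longleftrightarrow> (\<forall>u\<in>V. (\<forall>v\<in>V. b u v = 0) \<longrightarrow> u = 0)"
proof
  assume i: "inf_sup V nrm b > 0"
  show "\<forall>u\<in>V. (\<forall>v\<in>V. b u v = 0) \<longrightarrow> u = 0"
  proof (intro ballI impI, rule ccontr)
    fix u assume u: "u \<in> V" "\<forall>v\<in>V. b u v = 0" "u \<noteq> 0"
    have "inf_sup V nrm b \<le> (SUP v\<in>V - {0}. ereal (b u v / (nrm u * nrm v)))"
      unfolding inf_sup_def by (rule INF_lower) (use u in auto)
    also have "\<dots> \<le> 0" by (rule SUP_least) (use u in auto)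
    finally show False using i by auto
  qed
next
  assume nd: "\<forall>u\<in>V. (\<forall>v\<in>V. b u v = 0) \<longrightarrow> u = 0"
  obtain S where S: "finite S" "independent S" "V = span S" "subspace V" "S \<subseteq> V"
    using finite_dim_subspace_basis[OF V] by metis
  \<comment> \<open>The vectors dual to the basis stand in the second argument, hence the
    representation theorem is applied to the transposed form.\<close>
  have "\<exists>f. f \<in> V \<and> (\<forall>u\<in>V. b u f = representation S u s)" for s
    using nondegenerate_form_represents[OF V bilinear_form_on_transpose[OF b] _
        linear_form_on_coordinate[OF S(2,3), of s]] nondegenerate_transpose[OF V b] nd by metis
  then obtain f where f: "\<And>s. f s \<in> V" "\<And>s u. u \<in> V \<Longrightarrow> b u (f s) = representation S u s"
    by metis
  have n0: "nrm 0 = 0" using scale[of 0 0] subspace_0[OF S(4)] by simp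
  then have nn: "nrm u \<ge> 0" if "u \<in> V" for u using pos[OF that] by (cases "u = 0") auto
  have nsum: "nrm (\<Sum>s\<in>I. x s) \<le> (\<Sum>s\<in>I. nrm (x s))" if "finite I" "\<And>s. s \<in> I \<Longrightarrow> x s \<in> V" for I x
    using that
  proof (induction I)
    case (insert i I)
    then have "(\<Sum>s\<in>I. x s) \<in> V" by (intro subspace_sum[OF S(4)]) auto
    then show ?case using insert tri[of "x i" "\<Sum>s\<in>I. x s"] by auto
  qed (use n0 in auto)
  \<comment> \<open>The sum is what the triangle inequality produces at the end; the extra 1 keeps C
    positive on an empty basis and makes the factor \<open>(C - 1) / C\<close> smaller than
    1.\<close>
  define C where "C = 1 + (\<Sum>s\<in>S. nrm (f s) * nrm s)"
  have C: "C > 0" unfolding C_def using nn f S by (intro add_pos_nonneg sum_nonneg) auto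
  have "ereal (1 / C) \<le> (SUP v\<in>V - {0}. ereal (b u v / (nrm u * nrm v)))" if u: "u \<in> V" "u \<noteq> 0" for u
  proof (rule ccontr)
    assume "\<not> ?thesis"
    then have lt: "(SUP v\<in>V - {0}. ereal (b u v / (nrm u * nrm v))) < ereal (1 / C)" by simp
    have up: "nrm u > 0" using pos u by auto
    have le: "b u v \<le> (nrm u * nrm v) / C" if v: "v \<in> V" for v
    proof (cases "v = 0")
      case True
      then show ?thesis using linear_form_on_zero[OF S(4), of "b u"] b u n0
        unfolding bilinear_form_on_def by auto
    next
      case False
      have "ereal (b u v / (nrm u * nrm v)) < ereal (1 / C)"
        using False v by (intro le_less_trans[OF SUP_upper lt]) auto
      moreover have "nrm u * nrm v > 0" using up pos v False by auto
      ultimately show ?thesis by (simp add: pos_divide_less_eq)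
    qed
    \<comment> \<open>\<open>le\<close> bounds from above only, so both \<open>f s\<close> and its
      negative are tested.\<close>
    have rep: "\<bar>representation S u s\<bar> \<le> (nrm u * nrm (f s)) / C" for s
    proof -
      have "b u ((-1) *\<^sub>R f s) = (-1) * b u (f s)" using b u f(1)
        unfolding bilinear_form_on_def linear_form_on_def by blast
      moreover have "nrm ((-1) *\<^sub>R f s) = nrm (f s)" using scale[OF f(1), of "-1" s] by simp
      moreover have "(-1) *\<^sub>R f s \<in> V" using f S subspace_scale by blast
      ultimately show ?thesis using le[of "(-1) *\<^sub>R f s"] le[OF f(1), of s] f u by auto
    qed
    have "nrm u = nrm (\<Sum>s\<in>S. representation S u s *\<^sub>R s)"
      using sum_representation_eq[OF S(2) _ S(1) subset_refl, of u] u S by simp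
    also have "\<dots> \<le> (\<Sum>s\<in>S. nrm (representation S u s *\<^sub>R s))"
      by (rule nsum) (use S in \<open>auto intro: subspace_scale\<close>)
    also have "\<dots> = (\<Sum>s\<in>S. \<bar>representation S u s\<bar> * nrm s)"
      by (rule sum.cong) (use S scale in auto)
    also have "\<dots> \<le> (\<Sum>s\<in>S. (nrm u * nrm (f s)) / C * nrm s)"
      by (intro sum_mono mult_right_mono rep) (use nn S in auto)
    also have "\<dots> = nrm u * ((C - 1) / C)"
      by (simp add: C_def sum_distrib_left sum_divide_distrib algebra_simps)
    also have "\<dots> < nrm u * 1" using C up by (intro mult_strict_left_mono) auto
    finally show False by simp
  qed
  then have "ereal (1 / C) \<le> inf_sup V nrm b" unfolding inf_sup_def by (intro INF_greatest) auto
  then show "inf_sup V nrm b > 0" using C by (meson ereal_less(2) less_le_trans zero_less_divide_1_iff)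
qed

section \<open>Saddle point problems with the full image as multiplier space\<close>

lemma subspace_image_on:
  assumes "subspace V"
    and Xadd: "\<And>s t. s \<in> V \<Longrightarrow> t \<in> V \<Longrightarrow> X (s + t) = X s + X t"
    and Xscale: "\<And>r s. s \<in> V \<Longrightarrow> X (r *\<^sub>R s) = r *\<^sub>R X s"
  shows "subspace (X ` V)"
proof (rule subspaceI)
  show "0 \<in> X ` V" using Xscale[of 0 0] subspace_0[OF assms(1)] by force
  show "x + y \<in> X ` V" if "x \<in> X ` V" "y \<in> X ` V" for x y
    using that Xadd subspace_add[OF assms(1)] by (smt (verit, best) image_iff)
  show "c *\<^sub>R x \<in> X ` V" if "x \<in> X ` V" for c x
    using that Xscale subspace_scale[OF assms(1)] by (smt (verit, best) image_iff)
qed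

text \<open>L takes equal values where X does, so it factors through X. The factor is linear on the
  image, where the definite form \<open>ip\<close> represents it by some q.\<close>

lemma functional_vanishing_on_kernel:
  assumes V: "finite_dim_subspace V"
    and Xadd: "\<And>s t. s \<in> V \<Longrightarrow> t \<in> V \<Longrightarrow> X (s + t) = X s + X t"
    and Xscale: "\<And>r s. s \<in> V \<Longrightarrow> X (r *\<^sub>R s) = r *\<^sub>R X s"
    and ip: "bilinear_form_on (X ` V) ip"
    and ip_pos: "\<And>q. q \<in> X ` V \<Longrightarrow> ip q q = 0 \<Longrightarrow> q = 0"
    and L: "linear_form_on V L" "\<And>t. t \<in> V \<Longrightarrow> X t = 0 \<Longrightarrow> L t = 0"
  obtains q where "q \<in> X ` V" "\<And>t. t \<in> V \<Longrightarrow> ip (X t) q = L t"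
proof -
  obtain S where S: "finite S" "V = span S" "subspace V"
    using finite_dim_subspace_basis[OF V] by metis
  have X0: "X 0 = 0" using Xscale[of 0 0] subspace_0[OF S(3)] by simp
  have sub: "subspace (X ` V)" by (rule subspace_image_on[OF S(3) Xadd Xscale])
  have "X ` V = span (X ` S)"
  proof
    have "t \<in> V \<and> X t \<in> span (X ` S)" if "t \<in> span S" for t
      using that
    proof (induction rule: span_induct_alt)
      case base
      then show ?case using X0 subspace_0[OF S(3)] span_zero by auto
    next
      case (step c x y)
      have x: "x \<in> V" and cx: "c *\<^sub>R x \<in> V" using step S span_base subspace_scale by blast+
      have "c *\<^sub>R X x + X y \<in> span (X ` S)" 
        by (rule span_add[OF span_scale[OF span_base[OF imageI[OF step(1)]]]]) (use step in simp)
      moreover have "X (c *\<^sub>R x + y) = c *\<^sub>R X x + X y" using Xadd[OF cx] Xscale[OF x] step by simp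
      ultimately show ?case using cx step subspace_add[OF S(3)] by simp
    qed
    then show "X ` V \<subseteq> span (X ` S)" using S by auto
    show "span (X ` S) \<subseteq> X ` V"
      by (rule span_minimal[OF _ sub]) (use S span_superset in blast)
  qed
  then have Q: "finite_dim_subspace (X ` V)" unfolding finite_dim_subspace_def using S by blast
  have Xdiff: "X (s - t) = X s - X t" if "s \<in> V" "t \<in> V" for s t
    using Xadd[OF that(1) subspace_neg[OF S(3) that(2)]] Xscale[OF that(2), of "-1"] by simp
  have eq: "L s = L t" if "s \<in> V" "t \<in> V" "X s = X t" for s t
  proof -
    have "s - t \<in> V" using that subspace_diff[OF S(3)] by blast
    moreover have "X (s - t) = 0" using Xdiff that by simp
    ultimately have "L (s - t) = 0" using L by blast
    moreover have "L (s - t) = L s - L t" using linear_form_on_diff[OF S(3) L(1)] that by blast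
    ultimately show ?thesis by simp
  qed
  \<comment> \<open>By \<open>eq\<close> the choice of the preimage is immaterial.\<close>
  define l where "l q = L (SOME t. t \<in> V \<and> X t = q)" for q
  have l: "l (X t) = L t" if "t \<in> V" for t
  proof -
    have "(SOME s. s \<in> V \<and> X s = X t) \<in> V \<and> X (SOME s. s \<in> V \<and> X s = X t) = X t"
      by (rule someI[of _ t]) (use that in auto)
    then show ?thesis unfolding l_def using eq that by blast
  qed
  have "linear_form_on (X ` V) l"
    unfolding linear_form_on_def
  proof (intro conjI ballI allI)
    fix u v assume "u \<in> X ` V" "v \<in> X ` V"
    then obtain s t where "s \<in> V" "t \<in> V" "u = X s" "v = X t" by blast
    then show "l (u + v) = l u + l v"
      using l Xadd[of s t, symmetric] L(1) subspace_add[OF S(3)] unfolding linear_form_on_def by auto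
  next
    fix r v assume "v \<in> X ` V"
    then obtain t where "t \<in> V" "v = X t" by blast
    then show "l (r *\<^sub>R v) = r * l v"
      using l Xscale[of t r, symmetric] L(1) subspace_scale[OF S(3)] unfolding linear_form_on_def by auto
  qed
  from nondegenerate_form_represents[OF Q bilinear_form_on_transpose[OF ip] ip_pos this]
  obtain q where "q \<in> X ` V" "\<And>v. v \<in> X ` V \<Longrightarrow> ip v q = l v" by metis
  then show ?thesis using that l by auto
qed

text \<open>Testing the second equation with \<open>X s\<close> itself confines s to the kernel of
  X. Tested on that kernel, the first equation loses its multiplier and becomes a problem for s
  alone; what remains of it determines q. The set FF can stay abstract because one direction takes
  the datum 0 and the other treats each linear datum separately.\<close>

lemma saddle_point_unique_solution_iff:
  assumes V: "finite_dim_subspace V"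
    and Xadd: "\<And>s t. s \<in> V \<Longrightarrow> t \<in> V \<Longrightarrow> X (s + t) = X s + X t"
    and Xscale: "\<And>r s. s \<in> V \<Longrightarrow> X (r *\<^sub>R s) = r *\<^sub>R X s"
    and ip: "bilinear_form_on (X ` V) ip"
    and ip_pos: "\<And>q. q \<in> X ` V \<Longrightarrow> ip q q = 0 \<Longrightarrow> q = 0"
    and A: "bilinear_form_on V A"
    and FF: "\<And>F. F \<in> FF \<Longrightarrow> linear_form_on V F" "(\<lambda>_. 0) \<in> FF"
  shows "(\<forall>F\<in>FF. \<exists>!(s, q). s \<in> V \<and> q \<in> X ` V \<and> (\<forall>t\<in>V. A s t + ip (X t) q = F t) \<and>
              (\<forall>\<eta>\<in>X ` V. ip (X s) \<eta> = 0)) \<longleftrightarrow>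
         (\<forall>u\<in>{s\<in>V. X s = 0}. (\<forall>v\<in>{s\<in>V. X s = 0}. A u v = 0) \<longrightarrow> u = 0)"
    (is "?L \<longleftrightarrow> (\<forall>u\<in>?K. _)")
proof -
  have sub: "subspace V" using finite_dim_subspace_basis[OF V] by metis
  have lin: "linear_form_on V (A u)" "linear_form_on V (\<lambda>v. A v u)" if "u \<in> V" for u
    using A that unfolding bilinear_form_on_def by auto
  have ipl: "linear_form_on (X ` V) (ip u)" "linear_form_on (X ` V) (\<lambda>v. ip v u)" if "u \<in> X ` V" for u
    using ip that unfolding bilinear_form_on_def by auto
  have X0: "X 0 = 0" using Xscale[of 0 0] subspace_0[OF sub] by simp
  have Xdiff: "X (s - t) = X s - X t" if "s \<in> V" "t \<in> V" for s t
    using Xadd[OF that(1) subspace_neg[OF sub that(2)]] Xscale[OF that(2), of "-1"] by simp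
  have K: "subspace ?K"
    using sub Xadd Xscale X0 unfolding subspace_def by auto
  have Kfin: "finite_dim_subspace ?K" by (rule finite_dim_subspace_mono[OF V K]) auto
  have Q: "subspace (X ` V)" by (rule subspace_image_on[OF sub Xadd Xscale])
  have QX: "0 \<in> X ` V" using X0 subspace_0[OF sub] by force
  \<comment> \<open>If u solves the first equation on the kernel, the defect \<open>F - A u\<close>
    vanishes there and is therefore the pairing with a multiplier.\<close>
  have residual: "\<exists>q\<in>X ` V. \<forall>t\<in>V. A u t + ip (X t) q = F t"
    if u: "u \<in> V" and F: "linear_form_on V F" and AF: "\<And>v. v \<in> ?K \<Longrightarrow> A u v = F v" for u F
  proof -
    have "linear_form_on V (\<lambda>t. F t - A u t)"
      using F lin(1)[OF u] unfolding linear_form_on_def by (auto simp: algebra_simps)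
    moreover have "F t - A u t = 0" if "t \<in> V" "X t = 0" for t using AF that by simp
    ultimately obtain q where "q \<in> X ` V" "\<And>t. t \<in> V \<Longrightarrow> ip (X t) q = F t - A u t"
      using functional_vanishing_on_kernel[OF V Xadd Xscale ip ip_pos, of "\<lambda>t. F t - A u t"] by blast
    then show ?thesis by (intro bexI[of _ q]) auto
  qed
  have ip0: "ip q 0 = 0" "ip 0 q = 0" if "q \<in> X ` V" for q
  proof -
    have "ip q (0 *\<^sub>R q) = 0 * ip q q" "ip (0 *\<^sub>R q) q = 0 * ip q q"
      using ipl[OF that] that unfolding linear_form_on_def by blast+
    then show "ip q 0 = 0" "ip 0 q = 0" by auto
  qed
  have A0: "A 0 t = 0" if "t \<in> V" for t using linear_form_on_zero[OF sub lin(2)[OF that]] .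
  show ?thesis
  proof
    assume L: ?L
    show "\<forall>u\<in>?K. (\<forall>v\<in>?K. A u v = 0) \<longrightarrow> u = 0"
    proof (intro ballI impI)
      fix u assume u: "u \<in> ?K" "\<forall>v\<in>?K. A u v = 0"
      have "linear_form_on V (\<lambda>_. 0)" unfolding linear_form_on_def by auto
      moreover have "u \<in> V" using u by simp
      ultimately have "\<exists>q\<in>X ` V. \<forall>t\<in>V. A u t + ip (X t) q = 0"
        using residual[of u "\<lambda>_. 0"] u(2) by blast
      \<comment> \<open>With this multiplier a degenerate u becomes a solution for the datum 0, just
        as (0, 0) is one; uniqueness identifies the two.\<close>
      then obtain q where q: "q \<in> X ` V" "\<forall>t\<in>V. A u t + ip (X t) q = 0" by blast
      let ?P = "\<lambda>(s, q). s \<in> V \<and> q \<in> X ` V \<and> (\<forall>t\<in>V. A s t + ip (X t) q = 0) \<and>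
              (\<forall>\<eta>\<in>X ` V. ip (X s) \<eta> = 0)"
      have ex1: "\<exists>!x. ?P x" using bspec[OF L FF(2)] .
      have "?P (u, q)" using u(1) q ip0(2) by simp
      then have "(THE x. ?P x) = (u, q)" by (rule the1_equality[OF ex1])
      moreover have "?P (0, 0)" using QX subspace_0[OF sub] A0 ip0[OF imageI] X0 by simp
      then have "(THE x. ?P x) = (0, 0)" by (rule the1_equality[OF ex1])
      ultimately have "(u, q) = (0, 0)" by (rule trans[OF sym])
      then show "u = 0" by simp
    qed
  next
    assume nd: "\<forall>u\<in>?K. (\<forall>v\<in>?K. A u v = 0) \<longrightarrow> u = 0"
    then have nd': "u = 0" if "u \<in> ?K" "\<And>v. v \<in> ?K \<Longrightarrow> A u v = 0" for u using that by blast
    have AK: "bilinear_form_on ?K A"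
      using A K unfolding bilinear_form_on_def linear_form_on_def by auto
    show ?L
    proof
      fix F assume "F \<in> FF"
      then have F: "linear_form_on V F" using FF by blast
      then have FK: "linear_form_on ?K F" unfolding linear_form_on_def by auto
      have "\<exists>u\<in>?K. \<forall>v\<in>?K. A u v = F v"
        by (rule nondegenerate_form_represents[OF Kfin AK nd' FK]) blast+
      then obtain u where u: "u \<in> ?K" "\<And>v. v \<in> ?K \<Longrightarrow> A u v = F v" by blast
      have "u \<in> V" using u(1) by simp
      then obtain q where q: "q \<in> X ` V" "\<forall>t\<in>V. A u t + ip (X t) q = F t"
        using residual[OF _ F u(2)] by metis
      let ?P = "\<lambda>(s, q). s \<in> V \<and> q \<in> X ` V \<and> (\<forall>t\<in>V. A s t + ip (X t) q = F t) \<and>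
              (\<forall>\<eta>\<in>X ` V. ip (X s) \<eta> = 0)"
      show "\<exists>!x. ?P x"
      proof (rule ex1I)
        show "?P (u, q)" using u(1) q ip0(2) by simp
        fix x assume "?P x"
        then obtain s p where x: "x = (s, p)" "s \<in> V" "p \<in> X ` V"
          "\<forall>t\<in>V. A s t + ip (X t) p = F t" "\<forall>\<eta>\<in>X ` V. ip (X s) \<eta> = 0" by (cases x) simp
        have s: "X s = 0" using ip_pos[OF imageI[OF x(2)]] x(5) x(2) by blast
        let ?d = "s - u"
        have dK: "?d \<in> ?K" using u(1) x(2) s Xdiff subspace_diff[OF sub] by auto
        have Ad: "A ?d t = A s t - A u t" if "t \<in> V" for t
          using linear_form_on_diff[OF sub lin(2)[OF that] x(2)] u(1) by blast
        have "A ?d v = 0" if v: "v \<in> ?K" for v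
        proof -
          have "A s v = F v" using x v ip0(2)[OF x(3)] by fastforce
          then show ?thesis using Ad u(2)[OF v] v by auto
        qed
        then have "?d = 0" by (rule nd'[OF dK])
        then have su: "s = u" by simp
        \<comment> \<open>Multipliers are images, so \<open>p - q\<close> is X of the test element
          \<open>z - y\<close>. Since s = u, the first equations of the two solutions give the same
          value for its pairing with p and with q.\<close>
        obtain y where y: "y \<in> V" "q = X y" using q(1) by blast
        obtain z where z: "z \<in> V" "p = X z" using x(3) by blast
        have zy: "z - y \<in> V" using z y subspace_diff[OF sub] by blast
        have Xzy: "X (z - y) = p - q" using Xdiff y z by simp
        then have pq: "p - q \<in> X ` V" using zy by (metis imageI)
        have "ip (p - q) (p - q) = ip (p - q) p - ip (p - q) q"
          using linear_form_on_diff[OF Q ipl(1)[OF pq]] x(3) q(1) by blast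
        also have "ip (p - q) p = F (z - y) - A s (z - y)"
          using bspec[OF x(4) zy] Xzy by simp
        also have "ip (p - q) q = F (z - y) - A u (z - y)"
          using bspec[OF q(2) zy] Xzy by simp
        finally have "p - q = 0" using ip_pos[OF pq] su by simp
        then show "x = (u, q)" using x su by simp
      qed
    qed
  qed
qed


section \<open>Square integrable functions\<close>

lemma rep_abs_ae_fun: "AE x in lebesgue. rep_ae_fun (abs_ae_fun f) x = f x"
  by (rule Quotient3_rep_abs[OF Quotient3_ae_fun]) simp

lemma ae_fun_eq_iff: "u = v \<longleftrightarrow> (AE x in lebesgue. rep_ae_fun u x = rep_ae_fun v x)"
  using Quotient3_rel_rep[OF Quotient3_ae_fun, of u v] by auto

lemma rep_zero_ae_fun: "AE x in lebesgue. rep_ae_fun 0 x = 0"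
  unfolding zero_ae_fun_def by (rule rep_abs_ae_fun)

lemma rep_add_ae_fun: "AE x in lebesgue. rep_ae_fun (u + v) x = rep_ae_fun u x + rep_ae_fun v x"
  unfolding plus_ae_fun_def map_fun_def comp_def id_def by (rule rep_abs_ae_fun)

lemma rep_scaleR_ae_fun: "AE x in lebesgue. rep_ae_fun (c *\<^sub>R u) x = c * rep_ae_fun u x"
  unfolding scaleR_ae_fun_def map_fun_def comp_def id_def by (rule rep_abs_ae_fun)

lemma rep_restriction: "AE x in lebesgue. rep_ae_fun (restriction \<Omega> f) x = indicator \<Omega> x * f x"
  unfolding restriction_def map_fun_def comp_def id_def by (rule rep_abs_ae_fun)

lemma restriction_add: "restriction \<Omega> (\<lambda>x. f x + g x) = restriction \<Omega> f + restriction \<Omega> g"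
  by transfer (simp add: algebra_simps)

lemma restriction_scale: "restriction \<Omega> (\<lambda>x. c * f x) = c *\<^sub>R restriction \<Omega> f"
  by transfer (simp add: algebra_simps)

lemma restriction_zero: "restriction \<Omega> (\<lambda>x. 0) = 0"
  by transfer simp

text \<open>The condition of \<open>L2\<close> on functions instead of classes, without the support
  condition, so that test functions and representatives are treated alike.\<close>

definition square_integrable :: "('a::euclidean_space \<Rightarrow> real) \<Rightarrow> bool" where
  "square_integrable f \<longleftrightarrow> f \<in> borel_measurable lebesgue \<and> integrable lebesgue (\<lambda>x. (f x)\<^sup>2)"

lemma square_integrable_mult:
  assumes "square_integrable f" "square_integrable g"
  shows "integrable lebesgue (\<lambda>x. f x * g x)"
proof (rule Bochner_Integration.integrable_bound)
  show "integrable lebesgue (\<lambda>x. (f x)\<^sup>2 + (g x)\<^sup>2)"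
    using assms unfolding square_integrable_def by auto
  have "\<bar>f x * g x\<bar> \<le> (f x)\<^sup>2 + (g x)\<^sup>2" for x
    using sum_squares_bound[of "f x" "g x"] sum_squares_bound[of "f x" "- g x"]
    by (auto simp: abs_if power2_eq_square)
  then show "AE x in lebesgue. norm (f x * g x) \<le> norm ((f x)\<^sup>2 + (g x)\<^sup>2)" by simp
qed (use assms in \<open>auto simp: square_integrable_def\<close>)

lemma square_integrable_add:
  assumes "square_integrable f" "square_integrable g"
  shows "square_integrable (\<lambda>x. f x + g x)"
  using assms square_integrable_mult[OF assms]
  unfolding square_integrable_def power2_sum by (auto simp: mult.assoc)

lemma square_integrable_scale:
  assumes "square_integrable f"
  shows "square_integrable (\<lambda>x. c * f x)"
  using assms unfolding square_integrable_def power_mult_distrib by auto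

lemma square_integrable_cong_AE:
  assumes "AE x in lebesgue. f x = g x" "square_integrable f"
  shows "square_integrable g"
proof -
  have g: "g \<in> borel_measurable lebesgue"
    using borel_measurable_AE[OF _ assms(1)] assms(2) unfolding square_integrable_def by auto
  moreover have "integrable lebesgue (\<lambda>x. (f x)\<^sup>2) \<longleftrightarrow> integrable lebesgue (\<lambda>x. (g x)\<^sup>2)"
    using assms g unfolding square_integrable_def by (intro integrable_cong_AE) auto
  ultimately show ?thesis using assms(2) unfolding square_integrable_def by auto
qed

lemma L2_square_integrable: "u \<in> L2 \<Omega> \<Longrightarrow> square_integrable (rep_ae_fun u)"
  unfolding L2_def square_integrable_def by auto

lemma L2I:
  assumes "AE x in lebesgue. rep_ae_fun u x = f x" "square_integrable f"
    and "AE x in lebesgue. x \<notin> \<Omega> \<longrightarrow> f x = 0"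
  shows "u \<in> L2 \<Omega>"
proof -
  have "square_integrable (rep_ae_fun u)"
    by (rule square_integrable_cong_AE[OF _ assms(2)]) (use assms(1) in auto)
  moreover have "AE x in lebesgue. x \<notin> \<Omega> \<longrightarrow> rep_ae_fun u x = 0"
    using assms(1,3) by eventually_elim auto
  ultimately show ?thesis unfolding L2_def square_integrable_def by auto
qed

lemma subspace_L2: "subspace (L2 \<Omega>)"
proof (rule subspaceI)
  show "0 \<in> L2 \<Omega>" by (rule L2I[OF rep_zero_ae_fun]) (auto simp: square_integrable_def)
  show "u + v \<in> L2 \<Omega>" if "u \<in> L2 \<Omega>" "v \<in> L2 \<Omega>" for u v
  proof (rule L2I[OF rep_add_ae_fun])
    show "AE x in lebesgue. x \<notin> \<Omega> \<longrightarrow> rep_ae_fun u x + rep_ae_fun v x = 0"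
      using that unfolding L2_def by auto
  qed (use that L2_square_integrable square_integrable_add in blast)
  show "c *\<^sub>R u \<in> L2 \<Omega>" if "u \<in> L2 \<Omega>" for c u
  proof (rule L2I[OF rep_scaleR_ae_fun])
    show "AE x in lebesgue. x \<notin> \<Omega> \<longrightarrow> c * rep_ae_fun u x = 0"
      using that unfolding L2_def by auto
  qed (use that L2_square_integrable square_integrable_scale in blast)
qed

text \<open>One argument is a class and the other a function. This covers both
  \<open>L2_inner\<close>, where the function is a representative, and the identities that define
  weak derivatives, where it is a test function or a derivative of one.\<close>

definition L2_pairing :: "'a::euclidean_space set \<Rightarrow> 'a ae_fun \<Rightarrow> ('a \<Rightarrow> real) \<Rightarrow> real" where
  "L2_pairing \<Omega> u f = (LINT x:\<Omega>|lebesgue. rep_ae_fun u x * f x)"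

lemma L2_pairing_integrable:
  assumes "\<Omega> \<in> sets lebesgue" "u \<in> L2 \<Omega>" "square_integrable f"
  shows "set_integrable lebesgue \<Omega> (\<lambda>x. rep_ae_fun u x * f x)"
  using square_integrable_mult[OF L2_square_integrable[OF assms(2)] assms(3)] assms(1)
  unfolding set_integrable_def by (intro integrable_mult_indicator)

lemma L2_pairing_add:
  assumes "\<Omega> \<in> sets lebesgue" "u \<in> L2 \<Omega>" "v \<in> L2 \<Omega>" "square_integrable f"
  shows "L2_pairing \<Omega> (u + v) f = L2_pairing \<Omega> u f + L2_pairing \<Omega> v f"
proof -
  note uv = L2_square_integrable[OF assms(2)] L2_square_integrable[OF assms(3)]
    L2_square_integrable[OF subspace_add[OF subspace_L2 assms(2,3)]]
  have "L2_pairing \<Omega> (u + v) f = (LINT x:\<Omega>|lebesgue. rep_ae_fun u x * f x + rep_ae_fun v x * f x)"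
    unfolding L2_pairing_def
  proof (rule set_lebesgue_integral_cong_AE)
    show "AE x\<in>\<Omega> in lebesgue. rep_ae_fun (u + v) x * f x = rep_ae_fun u x * f x + rep_ae_fun v x * f x"
      using rep_add_ae_fun[of u v] by eventually_elim (simp add: algebra_simps)
  qed (use assms uv in \<open>auto simp: square_integrable_def\<close>)
  also have "\<dots> = L2_pairing \<Omega> u f + L2_pairing \<Omega> v f"
    unfolding L2_pairing_def by (intro set_integral_add L2_pairing_integrable assms)
  finally show ?thesis .
qed

lemma L2_pairing_scale:
  assumes "\<Omega> \<in> sets lebesgue" "u \<in> L2 \<Omega>" "square_integrable f"
  shows "L2_pairing \<Omega> (c *\<^sub>R u) f = c * L2_pairing \<Omega> u f"
proof -
  note u = L2_square_integrable[OF assms(2)] L2_square_integrable[OF subspace_scale[OF subspace_L2 assms(2)]]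
  have "L2_pairing \<Omega> (c *\<^sub>R u) f = (LINT x:\<Omega>|lebesgue. c * (rep_ae_fun u x * f x))"
    unfolding L2_pairing_def
  proof (rule set_lebesgue_integral_cong_AE)
    show "AE x\<in>\<Omega> in lebesgue. rep_ae_fun (c *\<^sub>R u) x * f x = c * (rep_ae_fun u x * f x)"
      using rep_scaleR_ae_fun[of c u] by eventually_elim simp
  qed (use assms u in \<open>auto simp: square_integrable_def intro!: borel_measurable_times\<close>)
  also have "\<dots> = c * L2_pairing \<Omega> u f"
    unfolding L2_pairing_def by simp
  finally show ?thesis .
qed

lemma L2_inner_eq_pairing: "L2_inner \<Omega> u v = L2_pairing \<Omega> u (rep_ae_fun v)"
  unfolding L2_inner_def L2_pairing_def ..

lemma L2_inner_commute: "L2_inner \<Omega> u v = L2_inner \<Omega> v u"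
  unfolding L2_inner_def by (simp add: mult.commute)

lemma L2_inner_add:
  assumes "\<Omega> \<in> sets lebesgue" "u \<in> L2 \<Omega>" "v \<in> L2 \<Omega>" "w \<in> L2 \<Omega>"
  shows "L2_inner \<Omega> (u + v) w = L2_inner \<Omega> u w + L2_inner \<Omega> v w"
    and "L2_inner \<Omega> w (u + v) = L2_inner \<Omega> w u + L2_inner \<Omega> w v"
  using L2_pairing_add[OF assms(1-3) L2_square_integrable[OF assms(4)], folded L2_inner_eq_pairing]
  by (simp_all add: L2_inner_commute[of \<Omega> w])

lemma L2_inner_scale:
  assumes "\<Omega> \<in> sets lebesgue" "u \<in> L2 \<Omega>" "w \<in> L2 \<Omega>"
  shows "L2_inner \<Omega> (c *\<^sub>R u) w = c * L2_inner \<Omega> u w"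
    and "L2_inner \<Omega> w (c *\<^sub>R u) = c * L2_inner \<Omega> w u"
  using L2_pairing_scale[OF assms(1-2) L2_square_integrable[OF assms(3)], folded L2_inner_eq_pairing]
  by (simp_all add: L2_inner_commute[of \<Omega> w])

lemma L2_inner_nonneg: "L2_inner \<Omega> u u \<ge> 0"
  unfolding L2_inner_def set_lebesgue_integral_def by (intro integral_nonneg_AE) auto

lemma L2_inner_self_eq_0:
  assumes "\<Omega> \<in> sets lebesgue" "u \<in> L2 \<Omega>" "L2_inner \<Omega> u u = 0"
  shows "u = 0"
proof -
  let ?h = "\<lambda>x. indicator \<Omega> x *\<^sub>R (rep_ae_fun u x * rep_ae_fun u x)"
  have "integrable lebesgue ?h"
    using L2_pairing_integrable[OF assms(1,2) L2_square_integrable[OF assms(2)]]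
    unfolding set_integrable_def .
  then have "AE x in lebesgue. ?h x = 0"
    using assms(3) unfolding L2_inner_def set_lebesgue_integral_def
    by (subst (asm) integral_nonneg_eq_0_iff_AE) auto
  moreover have "AE x in lebesgue. x \<notin> \<Omega> \<longrightarrow> rep_ae_fun u x = 0" using assms(2) unfolding L2_def by auto
  ultimately have "AE x in lebesgue. rep_ae_fun u x = rep_ae_fun 0 x"
    using rep_zero_ae_fun by eventually_elim (auto split: split_indicator_asm)
  then show ?thesis unfolding ae_fun_eq_iff .
qed

lemma L2_inner_Cauchy_Schwarz:
  assumes "\<Omega> \<in> sets lebesgue" "u \<in> L2 \<Omega>" "v \<in> L2 \<Omega>"
  shows "(L2_inner \<Omega> u v)\<^sup>2 \<le> L2_inner \<Omega> u u * L2_inner \<Omega> v v"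
proof (cases "L2_inner \<Omega> v v = 0")
  case True
  then have "v = 0 *\<^sub>R v" using L2_inner_self_eq_0[OF assms(1,3)] by simp
  then have "L2_inner \<Omega> u v = 0" using L2_inner_scale(2)[OF assms(1,3,2), of 0] by simp
  then show ?thesis using True by simp
next
  case False
  then have pos: "L2_inner \<Omega> v v > 0" using L2_inner_nonneg[of \<Omega> v] by simp
  \<comment> \<open>The minimiser of the squared norm of u + t v.\<close>
  let ?t = "- (L2_inner \<Omega> u v / L2_inner \<Omega> v v)"
  have tv: "?t *\<^sub>R v \<in> L2 \<Omega>" using assms subspace_scale[OF subspace_L2] by blast
  have utv: "u + ?t *\<^sub>R v \<in> L2 \<Omega>" using tv assms subspace_add[OF subspace_L2] by blast
  have "0 \<le> L2_inner \<Omega> (u + ?t *\<^sub>R v) (u + ?t *\<^sub>R v)" by (rule L2_inner_nonneg)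
  also have "\<dots> = L2_inner \<Omega> u u + 2 * ?t * L2_inner \<Omega> u v + ?t\<^sup>2 * L2_inner \<Omega> v v"
    using assms tv utv L2_inner_commute[of \<Omega> v u]
    by (simp add: L2_inner_add L2_inner_scale power2_eq_square algebra_simps del: scaleR_minus_left)
  also have "\<dots> = L2_inner \<Omega> u u - (L2_inner \<Omega> u v)\<^sup>2 / L2_inner \<Omega> v v"
    using False by (simp add: power2_eq_square)
  finally show ?thesis using pos by (simp add: pos_divide_le_eq)
qed

lemma L2_norm_triangle:
  assumes "\<Omega> \<in> sets lebesgue" "u \<in> L2 \<Omega>" "v \<in> L2 \<Omega>"
  shows "sqrt (L2_inner \<Omega> (u + v) (u + v)) \<le> sqrt (L2_inner \<Omega> u u) + sqrt (L2_inner \<Omega> v v)"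
proof (rule real_le_lsqrt)
  have uv: "u + v \<in> L2 \<Omega>" using assms subspace_add[OF subspace_L2] by blast
  have "\<bar>L2_inner \<Omega> u v\<bar> \<le> sqrt (L2_inner \<Omega> u u * L2_inner \<Omega> v v)"
    using L2_inner_Cauchy_Schwarz[OF assms] real_le_rsqrt by auto
  then show "L2_inner \<Omega> (u + v) (u + v) \<le> (sqrt (L2_inner \<Omega> u u) + sqrt (L2_inner \<Omega> v v))\<^sup>2"
    using assms uv L2_inner_commute[of \<Omega> v u] L2_inner_nonneg[of \<Omega> u] L2_inner_nonneg[of \<Omega> v]
    by (simp add: L2_inner_add power2_sum real_sqrt_mult)
qed (simp add: L2_inner_nonneg)


section \<open>Smooth functions and test functions\<close>

lemma partial_deriv_eqI: "(f has_derivative D) (at x) \<Longrightarrow> partial_deriv i f x = D (axis i 1)"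
  unfolding partial_deriv_def by (simp add: frechet_derivative_at[symmetric])

lemma has_derivative_frechet:
  "f differentiable_on UNIV \<Longrightarrow> (f has_derivative frechet_derivative f (at x)) (at x)"
  unfolding differentiable_on_def by (simp add: frechet_derivative_works)

lemma times_cont_differentiable_const: "times_cont_differentiable k (\<lambda>_. c)"
proof (induction k arbitrary: c)
  case (Suc k)
  have "partial_deriv i (\<lambda>_. c) = (\<lambda>_. 0)" for i :: 'a
    unfolding partial_deriv_def by simp
  then show ?case using Suc by simp
qed simp

lemma partial_deriv_add:
  assumes "f differentiable_on UNIV" "g differentiable_on UNIV"
  shows "partial_deriv i (\<lambda>x. f x + g x) = (\<lambda>x. partial_deriv i f x + partial_deriv i g x)"
  using partial_deriv_eqI[OF has_derivative_add[OF has_derivative_frechet[OF assms(1)] has_derivative_frechet[OF assms(2)]]]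
  unfolding partial_deriv_def by auto

lemma partial_deriv_mult:
  assumes "f differentiable_on UNIV" "g differentiable_on UNIV"
  shows "partial_deriv i (\<lambda>x. f x * g x) = (\<lambda>x. f x * partial_deriv i g x + partial_deriv i f x * g x)"
  using partial_deriv_eqI[OF has_derivative_mult[OF has_derivative_frechet[OF assms(1)] has_derivative_frechet[OF assms(2)]]]
  unfolding partial_deriv_def by auto

lemma times_cont_differentiable_SucD: "times_cont_differentiable (Suc k) f \<Longrightarrow> times_cont_differentiable k f"
proof (induction k arbitrary: f)
  case 0
  then show ?case using differentiable_imp_continuous_on by auto
qed auto

lemma times_cont_differentiable_add:
  "times_cont_differentiable k f \<Longrightarrow> times_cont_differentiable k g \<Longrightarrow> times_cont_differentiable k (\<lambda>x. f x + g x)"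
  by (induction k arbitrary: f g) (auto intro!: continuous_intros simp: partial_deriv_add)

lemma times_cont_differentiable_mult:
  "times_cont_differentiable k f \<Longrightarrow> times_cont_differentiable k g \<Longrightarrow> times_cont_differentiable k (\<lambda>x. f x * g x)"
proof (induction k arbitrary: f g)
  case 0
  then show ?case by (auto intro!: continuous_intros)
next
  case (Suc k)
  then show ?case
    using times_cont_differentiable_SucD[OF Suc.prems(1)] times_cont_differentiable_SucD[OF Suc.prems(2)]
    by (auto intro!: times_cont_differentiable_add simp: partial_deriv_mult)
qed

lemma smooth_const: "smooth (\<lambda>_. c)"
  unfolding smooth_def using times_cont_differentiable_const by blast

lemma smooth_add: "smooth f \<Longrightarrow> smooth g \<Longrightarrow> smooth (\<lambda>x. f x + g x)"
  unfolding smooth_def using times_cont_differentiable_add by blast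

lemma smooth_mult: "smooth f \<Longrightarrow> smooth g \<Longrightarrow> smooth (\<lambda>x. f x * g x)"
  unfolding smooth_def using times_cont_differentiable_mult by blast

lemma smooth_prod: "(\<And>i. i \<in> I \<Longrightarrow> smooth (f i)) \<Longrightarrow> smooth (\<lambda>x. \<Prod>i\<in>I. f i x)"
  by (induction I rule: infinite_finite_induct) (auto intro: smooth_const smooth_mult)

lemma smooth_partial_deriv: "smooth f \<Longrightarrow> smooth (partial_deriv i f)"
  unfolding smooth_def using times_cont_differentiable.simps(2) by blast

lemma smooth_differentiable_on: "smooth f \<Longrightarrow> f differentiable_on UNIV"
  unfolding smooth_def by (metis times_cont_differentiable.simps(2))

lemma smooth_continuous_on: "smooth f \<Longrightarrow> continuous_on UNIV f"
  using smooth_differentiable_on differentiable_imp_continuous_on by blast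

text \<open>\<open>flat 0\<close> is the classical smooth function that vanishes for nonpositive t.
  The powers of t in the denominator make the span of the family closed under differentiation, so
  that one induction over the order of differentiability covers all its members.\<close>

definition flat :: "nat \<Rightarrow> real \<Rightarrow> real" where
  "flat m t = (if t > 0 then exp (- (1 / t)) / t ^ m else 0)"

text \<open>Under t = 1/x this is the limit of \<open>x ^ m / exp x\<close> at infinity.\<close>

lemma flat_at_right_0: "(flat m \<longlongrightarrow> 0) (at_right 0)"
proof -
  have "((\<lambda>x::real. x ^ m / exp x) \<longlongrightarrow> 0) at_top" by (rule tendsto_power_div_exp_0)
  moreover have "\<forall>\<^sub>F x in at_top. x ^ m / exp x = flat m (inverse x)"
    using eventually_gt_at_top[of "0::real"]
    by eventually_elim (simp add: flat_def exp_minus field_simps)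
  ultimately have "((\<lambda>x. flat m (inverse x)) \<longlongrightarrow> 0) at_top" by (rule Lim_transform_eventually)
  then show ?thesis unfolding filterlim_at_right_to_top .
qed

lemma flat_has_real_derivative:
  "(flat m has_real_derivative (flat (m + 2) t - real m * flat (m + 1) t)) (at t)"
proof (cases "t = 0")
  case True
  \<comment> \<open>At 0 the difference quotient is 0 on the left, and on the right it equals
    \<open>flat (m + 1)\<close>, which tends to 0.\<close>
  have "((\<lambda>h. (flat m (0 + h) - flat m 0) / h) \<longlongrightarrow> 0) (at 0)"
  proof (rule filterlim_split_at)
    have "\<forall>\<^sub>F h in at_left 0. 0 = (flat m (0 + h) - flat m 0) / h"
      unfolding eventually_at_left_field by (rule exI[of _ "-1"]) (auto simp: flat_def)
    then show "((\<lambda>h. (flat m (0 + h) - flat m 0) / h) \<longlongrightarrow> 0) (at_left 0)"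
      by (rule Lim_transform_eventually[OF tendsto_const])
    have "\<forall>\<^sub>F h in at_right 0. flat (m + 1) h = (flat m (0 + h) - flat m 0) / h"
      unfolding eventually_at_right_field by (rule exI[of _ 1]) (auto simp: flat_def)
    then show "((\<lambda>h. (flat m (0 + h) - flat m 0) / h) \<longlongrightarrow> 0) (at_right 0)"
      by (rule Lim_transform_eventually[OF flat_at_right_0])
  qed
  then show ?thesis using True by (simp add: DERIV_def flat_def)
next
  case False
  show ?thesis
  proof (cases "t > 0")
    case True
    have "((\<lambda>t. exp (- (1 / t)) / t ^ m) has_real_derivative
        (flat (m + 2) t - real m * flat (m + 1) t)) (at t)"
    proof -
      have "((\<lambda>t. exp (- (1 / t))) has_real_derivative exp (- (1 / t)) * (1 / t\<^sup>2)) (at t)"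
        by (rule derivative_eq_intros refl | use True in \<open>simp add: power2_eq_square\<close>)+
      moreover have "((\<lambda>t. 1 / t ^ m) has_real_derivative - (real m * (1 / t ^ (m + 1)))) (at t)"
      proof (cases m)
        case (Suc l)
        have "((\<lambda>t. inverse (t ^ m)) has_real_derivative
            - (inverse (t ^ m) * (real m * t ^ (m - Suc 0)) * inverse (t ^ m))) (at t)"
          using DERIV_inverse'[OF DERIV_pow[of m t]] True by simp
        moreover have "inverse (t ^ m) * (real m * t ^ (m - Suc 0)) * inverse (t ^ m) = real m * (1 / t ^ (m + 1))"
          using True Suc by (simp add: field_simps)
        ultimately show ?thesis by (simp add: inverse_eq_divide)
      qed simp
      ultimately have "((\<lambda>t. exp (- (1 / t)) * (1 / t ^ m)) has_real_derivative
          (exp (- (1 / t)) * (- (real m * (1 / t ^ (m + 1)))) + exp (- (1 / t)) * (1 / t\<^sup>2) * (1 / t ^ m))) (at t)"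
        by (rule DERIV_mult')
      moreover have "exp (- (1 / t)) * (- (real m * (1 / t ^ (m + 1)))) + exp (- (1 / t)) * (1 / t\<^sup>2) * (1 / t ^ m)
          = flat (m + 2) t - real m * flat (m + 1) t"
        using True by (simp add: flat_def power_add power2_eq_square algebra_simps)
      ultimately show ?thesis by simp
    qed
    moreover have "\<forall>\<^sub>F s in nhds t. exp (- (1 / s)) / s ^ m = flat m s"
      using eventually_nhds_in_open[of "{0<..}" t] True by (auto elim!: eventually_mono simp: flat_def)
    ultimately show ?thesis
      using has_field_derivative_cong_ev[of t t UNIV "\<lambda>s. exp (- (1 / s)) / s ^ m" "flat m"
          "flat (m + 2) t - real m * flat (m + 1) t" "flat (m + 2) t - real m * flat (m + 1) t"] True
      by (simp add: flat_def)
  next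
    case neg: False
    have "((\<lambda>_. 0) has_real_derivative 0) (at t)" by simp
    moreover have "\<forall>\<^sub>F s in nhds t. 0 = flat m s"
      using eventually_nhds_in_open[of "{..<0}" t] neg False by (auto elim!: eventually_mono simp: flat_def)
    ultimately have "(flat m has_real_derivative 0) (at t)"
      using has_field_derivative_cong_ev[of t t UNIV "\<lambda>_. 0" "flat m" 0 0] neg by (auto simp: flat_def)
    then show ?thesis using neg by (simp add: flat_def)
  qed
qed

lemma times_cont_differentiable_flat:
  "times_cont_differentiable k (\<lambda>x. flat m (s * x $ i + t))"
proof (induction k arbitrary: m)
  case 0
  have "continuous_on UNIV (flat m)"
    using flat_has_real_derivative by (intro continuous_at_imp_continuous_on) (blast intro: DERIV_isCont)
  then have "continuous_on UNIV (\<lambda>x. flat m (s * x $ i + t))"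
    by (rule continuous_on_compose2) (auto intro!: continuous_intros)
  then show ?case by simp
next
  case (Suc k)
  have D: "((\<lambda>x. flat m (s * x $ i + t)) has_derivative
      (\<lambda>h. (flat (m + 2) (s * x $ i + t) - real m * flat (m + 1) (s * x $ i + t)) * (s * h $ i))) (at x)" for x
  proof -
    have "((\<lambda>x. s * x $ i + t) has_derivative (\<lambda>h. s * h $ i)) (at x)"
      by (auto intro!: derivative_eq_intros bounded_linear.has_derivative[OF bounded_linear_vec_nth])
    from has_derivative_compose[OF this flat_has_real_derivative[unfolded has_field_derivative_def]]
    show ?thesis .
  qed
  have "(\<lambda>x. flat m (s * x $ i + t)) differentiable_on UNIV"
    unfolding differentiable_on_def differentiable_def using D by auto
  moreover have "times_cont_differentiable k (partial_deriv j (\<lambda>x. flat m (s * x $ i + t)))" for j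
  proof -
    have "partial_deriv j (\<lambda>x. flat m (s * x $ i + t)) =
      (\<lambda>x. (s * axis j 1 $ i) * flat (m + 2) (s * x $ i + t) + (- (s * axis j 1 $ i) * real m) * flat (m + 1) (s * x $ i + t))"
      by (rule ext, simp only: partial_deriv_eqI[OF D]) (simp add: algebra_simps)
    then show ?thesis
      by (simp only:) (intro times_cont_differentiable_add times_cont_differentiable_mult
          times_cont_differentiable_const Suc)
  qed
  ultimately show ?case by simp
qed

lemma smooth_flat: "smooth (\<lambda>x. flat m (s * x $ i + t))"
  unfolding smooth_def using times_cont_differentiable_flat by blast

text \<open>\<open>flat 0\<close> tends to 1 at infinity, so for growing n the two factors of each
  coordinate tend to the indicators of the half-spaces that cut out the open box. The scale is
  \<open>Suc n\<close> because scale 0 would give the zero function, and the arguments have the form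
  \<open>s * x $ i + t\<close> of \<open>smooth_flat\<close>.\<close>

definition box_bump :: "nat \<Rightarrow> 'd::finite space \<Rightarrow> 'd space \<Rightarrow> 'd space \<Rightarrow> real" where
  "box_bump n a b x =
     (\<Prod>i\<in>UNIV. flat 0 (real (Suc n) * x $ i + - real (Suc n) * a $ i) *
               flat 0 (- real (Suc n) * x $ i + real (Suc n) * b $ i))"

lemma smooth_box_bump: "smooth (box_bump n a b)"
  unfolding box_bump_def[abs_def] by (intro smooth_prod smooth_mult smooth_flat)

lemma flat_0_bounds: "0 \<le> flat 0 t" "flat 0 t \<le> 1"
  by (auto simp: flat_def)

lemma box_bump_bounds: "0 \<le> box_bump n a b x" "box_bump n a b x \<le> 1"
  unfolding box_bump_def
  by (auto intro!: prod_nonneg prod_le_1 mult_nonneg_nonneg mult_le_one flat_0_bounds)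

lemma box_bump_zero:
  assumes "x \<notin> box a b"
  shows "box_bump n a b x = 0"
proof -
  obtain i where i: "\<not> (a $ i < x $ i \<and> x $ i < b $ i)" using assms unfolding mem_box_cart by auto
  have "flat 0 (real (Suc n) * x $ i + - real (Suc n) * a $ i) = 0 \<or>
        flat 0 (- real (Suc n) * x $ i + real (Suc n) * b $ i) = 0"
  proof (cases "a $ i < x $ i")
    case True
    then have "real (Suc n) * b $ i \<le> real (Suc n) * x $ i" using i by (intro mult_left_mono) auto
    then show ?thesis by (simp add: flat_def del: of_nat_Suc)
  next
    case False
    then have "real (Suc n) * x $ i \<le> real (Suc n) * a $ i" by (intro mult_left_mono) auto
    then show ?thesis by (simp add: flat_def del: of_nat_Suc)
  qed
  then show ?thesis unfolding box_bump_def by (intro prod_zero bexI[of _ i]) auto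
qed

lemma flat_0_scaled_tendsto:
  assumes "t > 0"
  shows "(\<lambda>n. flat 0 (real (Suc n) * t)) \<longlonglongrightarrow> 1"
proof -
  have "(\<lambda>n. exp (- (1 / t * inverse (real (Suc n))))) \<longlonglongrightarrow> exp (- (1 / t * 0))"
    by (intro tendsto_intros LIMSEQ_inverse_real_of_nat)
  moreover have "flat 0 (real (Suc n) * t) = exp (- (1 / t * inverse (real (Suc n))))" for n
    using assms by (simp add: flat_def inverse_eq_divide mult.commute del: of_nat_Suc)
  ultimately show ?thesis by simp
qed

lemma box_bump_tendsto:
  "(\<lambda>n. box_bump n a b x) \<longlonglongrightarrow> indicator (box a b) x"
proof (cases "x \<in> box a b")
  case True
  then have *: "a $ i < x $ i" "x $ i < b $ i" for i by (auto simp: mem_box_cart)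
  have "(\<lambda>n. \<Prod>i\<in>UNIV. flat 0 (real (Suc n) * (x $ i - a $ i)) * flat 0 (real (Suc n) * (b $ i - x $ i)))
      \<longlonglongrightarrow> (\<Prod>i\<in>(UNIV::'a set). 1 * 1)"
    by (intro tendsto_prod tendsto_mult flat_0_scaled_tendsto) (use * in auto)
  moreover have "box_bump n a b x =
      (\<Prod>i\<in>UNIV. flat 0 (real (Suc n) * (x $ i - a $ i)) * flat 0 (real (Suc n) * (b $ i - x $ i)))" for n
    unfolding box_bump_def by (rule prod.cong) (auto simp: algebra_simps)
  ultimately show ?thesis using True by simp
next
  case False
  then show ?thesis by (simp add: box_bump_zero)
qed

lemma box_bump_test_function:
  assumes "cbox a b \<subseteq> \<Omega>"
  shows "box_bump n a b \<in> test_functions \<Omega>"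
proof -
  have "{x. box_bump n a b x \<noteq> 0} \<subseteq> cbox a b" using box_bump_zero box_subset_cbox by blast
  then have "closure {x. box_bump n a b x \<noteq> 0} \<subseteq> cbox a b" by (intro closure_minimal) auto
  moreover from this have "compact (closure {x. box_bump n a b x \<noteq> 0})"
    by (metis bounded_cbox bounded_subset closed_closure compact_eq_bounded_closed)
  ultimately show ?thesis unfolding test_functions_def using smooth_box_bump assms by auto
qed

lemma test_function_partial_deriv:
  assumes "\<phi> \<in> test_functions \<Omega>"
  shows "partial_deriv i \<phi> \<in> test_functions \<Omega>"
proof -
  have "partial_deriv i \<phi> x = 0" if "x \<notin> closure {x. \<phi> x \<noteq> 0}" for x
  proof -
    have "\<forall>\<^sub>F y in nhds x. y \<in> - closure {x. \<phi> x \<noteq> 0}"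
      using that by (intro eventually_nhds_in_open) auto
    then have "\<forall>\<^sub>F y in nhds x. 0 = \<phi> y"
      by eventually_elim (use closure_subset[of "{x. \<phi> x \<noteq> 0}"] in auto)
    moreover from this have "\<phi> x = 0" using eventually_nhds_x_imp_x by metis
    moreover have "\<forall>\<^sub>F y in at x. 0 = \<phi> y"
      using calculation(1) unfolding eventually_at_filter by (rule eventually_mono) simp
    ultimately have "(\<phi> has_derivative (\<lambda>_. 0)) (at x)"
      by (intro has_derivative_transform_eventually[of "\<lambda>_. 0" "\<lambda>_. 0" x UNIV \<phi>]) auto
    then show ?thesis by (rule partial_deriv_eqI)
  qed
  then have "{x. partial_deriv i \<phi> x \<noteq> 0} \<subseteq> closure {x. \<phi> x \<noteq> 0}" by auto
  then have sub: "closure {x. partial_deriv i \<phi> x \<noteq> 0} \<subseteq> closure {x. \<phi> x \<noteq> 0}"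
    by (intro closure_minimal) auto
  moreover have "compact (closure {x. partial_deriv i \<phi> x \<noteq> 0})"
    using sub assms unfolding test_functions_def
    by (metis (mono_tags, lifting) bounded_subset closed_closure compact_eq_bounded_closed mem_Collect_eq)
  ultimately show ?thesis using assms smooth_partial_deriv unfolding test_functions_def by auto
qed

section \<open>Square integrability of compactly supported functions\<close>

lemma continuous_lebesgue_measurable:
  fixes f :: "'a::euclidean_space \<Rightarrow> real"
  shows "continuous_on UNIV f \<Longrightarrow> f \<in> borel_measurable lebesgue"
  by (intro measurable_completion) (simp add: borel_measurable_continuous_onI)

lemma bounded_support_square_integrable:
  fixes f :: "'a::euclidean_space \<Rightarrow> real"
  assumes "f \<in> borel_measurable lebesgue" "bounded S" "\<And>x. x \<notin> S \<Longrightarrow> f x = 0" "\<And>x. \<bar>f x\<bar> \<le> K"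
  shows "square_integrable f"
proof -
  obtain a b where ab: "S \<subseteq> cbox a b" using bounded_subset_cbox_symmetric[OF assms(2)] by metis
  have "integrable lebesgue (\<lambda>x. K\<^sup>2 * indicator (cbox a b) x)"
    by (intro integrable_mult_right integrable_real_indicator) (auto simp: emeasure_lborel_cbox_eq)
  then have "integrable lebesgue (\<lambda>x. (f x)\<^sup>2)"
  proof (rule Bochner_Integration.integrable_bound)
    have "(f x)\<^sup>2 \<le> K\<^sup>2" for x using assms(4)[of x] by (rule abs_le_square_iff[THEN iffD1, OF order_trans[OF _ abs_ge_self]])
    then show "AE x in lebesgue. norm ((f x)\<^sup>2) \<le> norm (K\<^sup>2 * indicator (cbox a b) x)"
      using assms(3) ab by (auto split: split_indicator)
  qed (use assms(1) in auto)
  then show ?thesis using assms(1) unfolding square_integrable_def by auto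
qed

lemma compact_support_bounded:
  fixes f :: "'a::euclidean_space \<Rightarrow> real"
  assumes "continuous_on UNIV f" "compact (closure {x. f x \<noteq> 0})"
  obtains K where "\<And>x. \<bar>f x\<bar> \<le> K"
proof -
  have "bounded (f ` closure {x. f x \<noteq> 0})"
    using assms by (intro compact_imp_bounded compact_continuous_image) (auto intro: continuous_on_subset)
  then obtain K where K: "\<And>x. x \<in> closure {x. f x \<noteq> 0} \<Longrightarrow> \<bar>f x\<bar> \<le> K" unfolding bounded_iff by auto
  have "\<bar>f x\<bar> \<le> max K 0" for x
    using K[of x] closure_subset[of "{x. f x \<noteq> 0}"] by (cases "f x = 0") auto
  then show ?thesis using that by blast
qed

lemma test_function_square_integrable:
  assumes "\<phi> \<in> test_functions \<Omega>"
  shows "square_integrable \<phi>"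
proof -
  have c: "continuous_on UNIV \<phi>" "compact (closure {x. \<phi> x \<noteq> 0})"
    using assms smooth_continuous_on unfolding test_functions_def by auto
  obtain K where K: "\<And>x. \<bar>\<phi> x\<bar> \<le> K" using compact_support_bounded[OF c] by metis
  show ?thesis
    by (rule bounded_support_square_integrable[OF continuous_lebesgue_measurable[OF c(1)]
          compact_imp_bounded[OF c(2)] _ K]) (use closure_subset[of "{x. \<phi> x \<noteq> 0}"] in auto)
qed


section \<open>The fundamental lemma and integration by parts\<close>

lemma box_in_sets_lebesgue[measurable]: "box a b \<in> sets lebesgue"
  by (rule sets_completionI_sets) simp

text \<open>The positive and the negative part of f are densities of two measures that agree on all
  open boxes. Boxes generate the Borel sets and are closed under intersection, so the measures
  coincide, and with them their densities.\<close>

lemma AE_zero_if_box_integrals_zero: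
  fixes f :: "'a::euclidean_space \<Rightarrow> real"
  assumes f: "integrable lebesgue f"
    and zero: "\<And>a b. (\<integral>x. f x * indicator (box a b) x \<partial>lebesgue) = 0"
  shows "AE x in lebesgue. f x = 0"
proof -
  \<comment> \<open>Boxes generate the Borel sets only, so the argument runs with a Borel function
    that equals f almost everywhere.\<close>
  obtain g where g[measurable]: "g \<in> borel_measurable lborel" and ae: "AE x in lborel. f x = g x"
    using completion_ex_borel_measurable_real[of f lborel] f by blast
  have fg: "AE x in lebesgue. f x = g x" using ae by (rule AE_completion)
  have gl[measurable]: "g \<in> borel_measurable lebesgue" using g by (rule measurable_completion)
  have fm[measurable]: "f \<in> borel_measurable lebesgue" using f by auto
  have "integrable lebesgue g" by (rule integrable_cong_AE_imp[OF f gl]) (use fg in auto)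
  then have gi: "integrable lborel g" using integrable_completion[of g lborel] g by simp
  have gz: "(\<integral>x. g x * indicator (box a b) x \<partial>lborel) = 0" for a b
  proof -
    have "(\<integral>x. g x * indicator (box a b) x \<partial>lborel) = (\<integral>x. g x * indicator (box a b) x \<partial>lebesgue)"
      by (rule integral_completion[symmetric]) auto
    also have "\<dots> = (\<integral>x. f x * indicator (box a b) x \<partial>lebesgue)"
      by (intro integral_cong_AE borel_measurable_times borel_measurable_indicator box_in_sets_lebesgue gl fm)
        (use fg in auto)
    finally show ?thesis using zero by simp
  qed
  \<comment> \<open>\<open>ennreal\<close> truncates at 0, so these densities are the positive and
    the negative part of g.\<close>
  have "density lborel (\<lambda>x. ennreal (g x)) = density lborel (\<lambda>x. ennreal (- g x))"
  proof (rule measure_eqI_generator_eq)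
    let ?E = "range (\<lambda>(a, b). box a b :: 'a set)"
    show "Int_stable ?E" by (auto simp: Int_stable_def box_Int_box)
    show "?E \<subseteq> Pow UNIV" by simp
    show "sets (density lborel (\<lambda>x. ennreal (g x))) = sigma_sets UNIV ?E"
      "sets (density lborel (\<lambda>x. ennreal (- g x))) = sigma_sets UNIV ?E"
      by (simp_all add: borel_eq_box)
    let ?A = "\<lambda>n::nat. box (- (real n *\<^sub>R One)) (real n *\<^sub>R One) :: 'a set"
    show "range ?A \<subseteq> ?E" "(\<Union>i. ?A i) = UNIV"
      unfolding UN_box_eq_UNIV by auto
    have e: "emeasure (density lborel (\<lambda>x. ennreal (s * g x))) (box a b) =
        (\<integral>\<^sup>+x. ennreal (s * (g x * indicator (box a b) x)) \<partial>lborel)" for a b s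
      by (subst emeasure_density) (auto intro!: nn_integral_cong split: split_indicator)
    have hi: "integrable lborel (\<lambda>x. g x * indicator (box a b) x)" for a b :: 'a
      using integrable_real_mult_indicator[OF _ gi, of "box a b"] by simp
    show "emeasure (density lborel (\<lambda>x. ennreal (g x))) (?A i) \<noteq> \<infinity>" for i
      using hi[of "- (real i *\<^sub>R One)" "real i *\<^sub>R One"] e[of 1] unfolding real_integrable_def by simp
    show "emeasure (density lborel (\<lambda>x. ennreal (g x))) X = emeasure (density lborel (\<lambda>x. ennreal (- g x))) X"
      if X: "X \<in> ?E" for X
    proof -
      obtain a b where X: "X = box a b" using X by auto
      let ?P = "\<integral>\<^sup>+x. ennreal (g x * indicator (box a b) x) \<partial>lborel"
      let ?N = "\<integral>\<^sup>+x. ennreal (- (g x * indicator (box a b) x)) \<partial>lborel"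
      have "enn2real ?P - enn2real ?N = 0"
        using real_lebesgue_integral_def[OF hi[of a b]] gz[of a b] by simp
      moreover have "?P \<noteq> \<infinity>" "?N \<noteq> \<infinity>" using hi[of a b] unfolding real_integrable_def by auto
      ultimately have "?P = ?N" by (cases rule: ennreal2_cases[of ?P ?N]) auto
      then show ?thesis using e[of 1 a b] e[of "-1" a b] X by simp
    qed
  qed
  then have "AE x in lborel. ennreal (g x) = ennreal (- g x)"
    by (intro sigma_finite_measure.density_unique[OF sigma_finite_lborel]) auto
  then have "AE x in lborel. g x = 0"
  proof eventually_elim
    case (elim x)
    then show ?case by (cases "g x \<ge> 0") (auto simp: ennreal_neg ennreal_eq_0_iff)
  qed
  then have "AE x in lebesgue. g x = 0" by (rule AE_completion)
  then show ?thesis using fg by eventually_elim simp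
qed

lemma square_integrable_indicator_box:
  "square_integrable (indicator (box a b) :: 'a::euclidean_space \<Rightarrow> real)"
  by (rule bounded_support_square_integrable[of _ "box a b" 1]) (auto split: split_indicator simp: borel_measurable_indicator[OF box_in_sets_lebesgue])

text \<open>By dominated convergence the bumps pass to indicators of boxes whose closed box lies in
  \<Omega>. This makes g vanish almost everywhere on each such box, and countably many of them cover
  \<Omega>.\<close>

lemma L2_eq_0_if_pairing_test_functions_0:
  assumes \<Omega>: "open \<Omega>" and g: "g \<in> L2 \<Omega>"
    and zero: "\<And>\<phi>. \<phi> \<in> test_functions \<Omega> \<Longrightarrow> L2_pairing \<Omega> g \<phi> = 0"
  shows "g = 0"
proof -
  have L[measurable]: "\<Omega> \<in> sets lebesgue" using \<Omega> by auto
  let ?r = "rep_ae_fun g"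
  note sq = L2_square_integrable[OF g]
  have rm[measurable]: "?r \<in> borel_measurable lebesgue" using sq unfolding square_integrable_def by auto
  have box0: "(\<integral>x. ?r x * indicator (box a b) x \<partial>lebesgue) = 0" if ab: "cbox a b \<subseteq> \<Omega>" for a b
  proof -
    have sub: "box a b \<subseteq> \<Omega>" using ab box_subset_cbox by blast
    have int: "integrable lebesgue (\<lambda>x. ?r x * indicator (box a b) x)"
      by (rule square_integrable_mult[OF sq square_integrable_indicator_box])
    have bm[measurable]: "box_bump n a b \<in> borel_measurable lebesgue" for n
      using test_function_square_integrable[OF box_bump_test_function[OF ab]] unfolding square_integrable_def by auto
    have "(\<lambda>n. \<integral>x. ?r x * box_bump n a b x \<partial>lebesgue) \<longlonglongrightarrow> (\<integral>x. ?r x * indicator (box a b) x \<partial>lebesgue)"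
    proof (rule integral_dominated_convergence[where w = "\<lambda>x. \<bar>?r x * indicator (box a b) x\<bar>"])
      show "integrable lebesgue (\<lambda>x. \<bar>?r x * indicator (box a b) x\<bar>)" using int by (rule integrable_abs)
      show "AE x in lebesgue. (\<lambda>n. ?r x * box_bump n a b x) \<longlonglongrightarrow> ?r x * indicator (box a b) x"
        by (intro AE_I2 tendsto_intros box_bump_tendsto)
      show "AE x in lebesgue. norm (?r x * box_bump n a b x) \<le> \<bar>?r x * indicator (box a b) x\<bar>" for n
        using box_bump_bounds[of n a b] box_bump_zero[of _ a b n]
        by (intro AE_I2) (auto simp: abs_mult mult_left_le split: split_indicator)
    qed (intro borel_measurable_times borel_measurable_indicator box_in_sets_lebesgue rm bm)+
    moreover have "(\<integral>x. ?r x * box_bump n a b x \<partial>lebesgue) = 0" for n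
    proof -
      have "(\<integral>x. ?r x * box_bump n a b x \<partial>lebesgue) = L2_pairing \<Omega> g (box_bump n a b)"
        unfolding L2_pairing_def set_lebesgue_integral_def
      proof (rule Bochner_Integration.integral_cong)
        fix x
        have "x \<notin> \<Omega> \<Longrightarrow> box_bump n a b x = 0" using box_bump_zero[of x a b n] sub by blast
        then show "?r x * box_bump n a b x = indicat_real \<Omega> x *\<^sub>R (?r x * box_bump n a b x)"
          by (simp split: split_indicator)
      qed simp
      then show ?thesis using zero[OF box_bump_test_function[OF ab]] by simp
    qed
    ultimately show ?thesis by (simp add: LIMSEQ_const_iff)
  qed
  have AE_box: "AE x in lebesgue. x \<in> cbox a b \<longrightarrow> ?r x = 0" if ab: "cbox a b \<subseteq> \<Omega>" for a b
  proof -
    have "AE x in lebesgue. ?r x * indicator (box a b) x = 0"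
    proof (rule AE_zero_if_box_integrals_zero)
      show "integrable lebesgue (\<lambda>x. ?r x * indicator (box a b) x)"
        by (rule square_integrable_mult[OF sq square_integrable_indicator_box])
      fix c d
      \<comment> \<open>The criterion tests with all boxes, also with those that leave \<Omega>.
        After truncation to \<open>box a b\<close> only intersections matter, and these are again
        boxes.\<close>
      obtain p q where pq: "box a b \<inter> box c d = box p q" using box_Int_box[of a b c d] by blast
      have "(\<integral>x. ?r x * indicator (box p q) x \<partial>lebesgue) = 0"
      \<comment> \<open>An empty open box may belong to a nonempty closed one that lies outside
        \<Omega>, so it is treated apart.\<close>
      proof (cases "box p q = {}")
        case False
        then have "cbox p q = closure (box p q)" by simp
        also have "\<dots> \<subseteq> cbox a b" using pq box_subset_cbox[of a b] by (intro closure_minimal) auto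
        finally show ?thesis using box0 ab by blast
      qed simp
      then show "(\<integral>x. ?r x * indicator (box a b) x * indicator (box c d) x \<partial>lebesgue) = 0"
        using pq by (simp add: indicator_inter_arith[symmetric] mult.assoc)
    qed
    moreover have "AE x in lebesgue. x \<notin> cbox a b - box a b"
      by (rule AE_not_in) (use negligible_frontier_interval[of a b] in \<open>simp add: negligible_iff_null_sets\<close>)
    ultimately show ?thesis by eventually_elim (auto split: split_indicator_asm)
  qed
  obtain \<D> where D: "countable \<D>" "\<D> \<subseteq> Pow \<Omega>" "\<And>X. X \<in> \<D> \<Longrightarrow> \<exists>a b. X = cbox a b" "\<Union>\<D> = \<Omega>"
    using open_countable_Union_open_cbox[OF \<Omega>] by metis
  have "AE x in lebesgue. \<forall>X\<in>\<D>. x \<in> X \<longrightarrow> ?r x = 0"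
    unfolding AE_ball_countable[OF D(1)] using D(2,3) AE_box by (metis PowD subsetD)
  moreover have "AE x in lebesgue. x \<notin> \<Omega> \<longrightarrow> ?r x = 0" using g unfolding L2_def by auto
  ultimately have "AE x in lebesgue. ?r x = rep_ae_fun 0 x"
    using rep_zero_ae_fun by eventually_elim (use D(4) in auto)
  then show ?thesis unfolding ae_fun_eq_iff .
qed

section \<open>Integration by parts against test functions\<close>

lemma bounded_support_integrable:
  fixes f :: "'a::euclidean_space \<Rightarrow> real"
  assumes "f \<in> borel_measurable borel" "bounded S" "\<And>x. x \<notin> S \<Longrightarrow> f x = 0" "\<And>x. \<bar>f x\<bar> \<le> K"
  shows "integrable lborel f"
proof -
  obtain a b where ab: "S \<subseteq> cbox a b" using bounded_subset_cbox_symmetric[OF assms(2)] by metis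
  have "integrable lborel (\<lambda>x. K * indicator (cbox a b) x)"
    by (intro integrable_mult_right integrable_real_indicator) (auto simp: emeasure_lborel_cbox_eq)
  then show ?thesis
  proof (rule Bochner_Integration.integrable_bound)
    show "AE x in lborel. norm (f x) \<le> norm (K * indicator (cbox a b) x)"
      using assms(3,4) ab by (intro AE_I2) (auto split: split_indicator intro: order_trans[OF _ abs_ge_self])
  qed (use assms(1) in auto)
qed

lemma line_has_real_derivative:
  assumes "f differentiable_on UNIV"
  shows "((\<lambda>t. f (y + t *\<^sub>R axis i 1)) has_real_derivative partial_deriv i f (y + t *\<^sub>R axis i 1)) (at t)"
proof -
  let ?D = "frechet_derivative f (at (y + t *\<^sub>R axis i 1))"
  have D: "(f has_derivative ?D) (at (y + t *\<^sub>R axis i 1))" by (rule has_derivative_frechet[OF assms])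
  have "((\<lambda>t. y + t *\<^sub>R axis i 1) has_derivative (\<lambda>h. h *\<^sub>R axis i 1)) (at t)"
    by (auto intro!: derivative_eq_intros)
  from has_derivative_compose[OF this D]
  have "((\<lambda>t. f (y + t *\<^sub>R axis i 1)) has_derivative (\<lambda>h. ?D (h *\<^sub>R axis i 1))) (at t)" .
  moreover have "?D (h *\<^sub>R axis i 1) = partial_deriv i f (y + t *\<^sub>R axis i 1) * h" for h
    using linear_scale[OF has_derivative_linear[OF D]] unfolding partial_deriv_def by (simp add: mult.commute)
  ultimately show ?thesis unfolding has_field_derivative_def by simp
qed

text \<open>
  Difference quotients integrate to zero by translation invariance, and they converge boundedly to
  the partial derivative.
\<close>

lemma integral_partial_deriv_eq_0:
  fixes h :: "'d::finite space \<Rightarrow> real"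
  assumes h: "h differentiable_on UNIV" "continuous_on UNIV (partial_deriv i h)"
    and supp: "compact (closure {x. h x \<noteq> 0})"
  shows "(\<integral>x. partial_deriv i h x \<partial>lborel) = 0"
proof -
  let ?e = "axis i 1 :: 'd space"
  define \<epsilon> where "\<epsilon> n = inverse (real (Suc n))" for n
  have \<epsilon>: "0 < \<epsilon> n" "\<epsilon> n \<le> 1" for n unfolding \<epsilon>_def by (auto simp: inverse_le_1_iff)
  have hc: "continuous_on UNIV h" using h(1) by (rule differentiable_imp_continuous_on)
  then have hm[measurable]: "h \<in> borel_measurable borel" by (rule borel_measurable_continuous_onI)
  have pm[measurable]: "partial_deriv i h \<in> borel_measurable borel" using h(2) by (rule borel_measurable_continuous_onI)
  obtain R where R: "\<And>x. h x \<noteq> 0 \<Longrightarrow> norm x \<le> R"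
    using compact_imp_bounded[OF supp] closure_subset[of "{x. h x \<noteq> 0}"] unfolding bounded_iff by blast
  have shift0: "h (x + t *\<^sub>R ?e) = 0" if "R + 1 < norm x" "\<bar>t\<bar> \<le> 1" for x t
  proof (rule ccontr)
    assume "h (x + t *\<^sub>R ?e) \<noteq> 0"
    then have "norm (x + t *\<^sub>R ?e) \<le> R" by (rule R)
    moreover have "norm x \<le> norm (x + t *\<^sub>R ?e) + norm (t *\<^sub>R ?e)"
      using norm_triangle_ineq4[of "x + t *\<^sub>R ?e" "t *\<^sub>R ?e"] by simp
    ultimately show False using that by (simp add: norm_axis_1)
  qed
  \<comment> \<open>The radius allows for the mean value below: it is taken at distance less than 1
    from a point of the ball of radius R + 1.\<close>
  have "bounded (partial_deriv i h ` cball 0 (R + 2))"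
    by (intro compact_imp_bounded compact_continuous_image) (auto intro: continuous_on_subset[OF h(2)])
  then obtain K0 where "\<forall>x\<in>cball 0 (R + 2). \<bar>partial_deriv i h x\<bar> \<le> K0" unfolding bounded_iff by auto
  then have K0: "\<bar>partial_deriv i h x\<bar> \<le> K0" if "norm x \<le> R + 2" for x using that by simp
  \<comment> \<open>The bound must be nonnegative where the quotients vanish; \<open>K0\<close> may
    be negative if the ball is empty.\<close>
  define K where "K = max K0 0"
  let ?D = "\<lambda>n x. (h (x + \<epsilon> n *\<^sub>R ?e) - h x) / \<epsilon> n"
  have D0: "?D n x = 0" if "x \<notin> cball 0 (R + 1)" for n x
    using shift0[of x "\<epsilon> n"] shift0[of x 0] \<epsilon>[of n] that by simp
  have Dbound: "\<bar>?D n x\<bar> \<le> K" for n x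
  proof (cases "norm x \<le> R + 1")
    case True
    have "\<exists>z>0. z < \<epsilon> n \<and>
        h (x + \<epsilon> n *\<^sub>R ?e) - h (x + 0 *\<^sub>R ?e) = (\<epsilon> n - 0) * partial_deriv i h (x + z *\<^sub>R ?e)"
      using \<epsilon>(1)[of n] line_has_real_derivative[OF h(1)] by (rule MVT2)
    then obtain z where z: "0 < z" "z < \<epsilon> n"
      "h (x + \<epsilon> n *\<^sub>R ?e) - h (x + 0 *\<^sub>R ?e) = (\<epsilon> n - 0) * partial_deriv i h (x + z *\<^sub>R ?e)"
      by blast
    have "norm (x + z *\<^sub>R ?e) \<le> norm x + norm (z *\<^sub>R ?e)" by (rule norm_triangle_ineq)
    also have "\<dots> \<le> R + 2" using True z \<epsilon>[of n] by (simp add: norm_axis_1)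
    finally have "\<bar>partial_deriv i h (x + z *\<^sub>R ?e)\<bar> \<le> K0" by (rule K0)
    moreover have "?D n x = partial_deriv i h (x + z *\<^sub>R ?e)" using z(3) \<epsilon>(1)[of n] by simp
    ultimately show ?thesis unfolding K_def by simp
  next
    case False
    then have "?D n x = 0" by (intro D0) simp
    then have "\<bar>?D n x\<bar> = 0" by (simp only: abs_zero)
    then show ?thesis unfolding K_def by linarith
  qed
  have Dlim: "(\<lambda>n. ?D n x) \<longlonglongrightarrow> partial_deriv i h x" for x
  proof -
    have "((\<lambda>t. (h (x + (0 + t) *\<^sub>R ?e) - h (x + 0 *\<^sub>R ?e)) / t) \<longlongrightarrow> partial_deriv i h (x + 0 *\<^sub>R ?e)) (at 0)"
      using line_has_real_derivative[OF h(1), of x i 0] unfolding DERIV_def .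
    moreover have "filterlim \<epsilon> (at 0) sequentially"
    proof -
      have "\<epsilon> \<longlonglongrightarrow> 0" unfolding \<epsilon>_def[abs_def] by (rule LIMSEQ_inverse_real_of_nat)
      moreover have "\<epsilon> n \<noteq> 0" for n using \<epsilon>(1)[of n] by simp
      ultimately show ?thesis unfolding filterlim_at by simp
    qed
    ultimately have "(\<lambda>n. (h (x + (0 + \<epsilon> n) *\<^sub>R ?e) - h (x + 0 *\<^sub>R ?e)) / \<epsilon> n)
        \<longlonglongrightarrow> partial_deriv i h (x + 0 *\<^sub>R ?e)"
      by (rule filterlim_compose)
    then show ?thesis by simp
  qed
  have "(\<lambda>n. \<integral>x. ?D n x \<partial>lborel) \<longlonglongrightarrow> (\<integral>x. partial_deriv i h x \<partial>lborel)"
  proof (rule integral_dominated_convergence[where w = "\<lambda>x. K * indicator (cball 0 (R + 1)) x"])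
    show "integrable lborel (\<lambda>x :: 'd space. K * indicator (cball 0 (R + 1)) x)"
      by (intro integrable_mult_right integrable_real_indicator) (use emeasure_bounded_finite[OF bounded_cball, of "0 :: 'd space" "R + 1"] in auto)
    show "AE x in lborel. norm (?D n x) \<le> K * indicator (cball 0 (R + 1)) x" for n
      using Dbound[of _ n] D0[of _ n] by (intro AE_I2) (simp split: split_indicator)
  qed (use Dlim in auto)
  moreover have "(\<integral>x. ?D n x \<partial>lborel) = 0" for n
  proof -
    obtain C where "\<And>x. \<bar>h x\<bar> \<le> C" using compact_support_bounded[OF hc supp] by metis
    then have hi: "integrable lborel h"
      by (intro bounded_support_integrable[OF hm compact_imp_bounded[OF supp]])
         (use closure_subset[of "{x. h x \<noteq> 0}"] in auto)
    have eq: "lborel = distr lborel borel ((+) (\<epsilon> n *\<^sub>R ?e))" by (rule lborel_distr_plus[symmetric])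
    have "(\<integral>x. h x \<partial>lborel) = (\<integral>x. h (x + \<epsilon> n *\<^sub>R ?e) \<partial>lborel)"
      by (subst eq, subst integral_distr) (auto simp: add.commute)
    moreover have "integrable lborel (\<lambda>x. h (x + \<epsilon> n *\<^sub>R ?e))"
      using hi by (subst (asm) eq, subst (asm) integrable_distr_eq) (auto simp: add.commute)
    ultimately show ?thesis using hi by simp
  qed
  ultimately have "(\<lambda>n::nat. 0 :: real) \<longlonglongrightarrow> (\<integral>x. partial_deriv i h x \<partial>lborel)" by (simp only:)
  then show ?thesis by (simp add: LIMSEQ_const_iff)
qed

lemma test_function_zero: "\<phi> \<in> test_functions \<Omega> \<Longrightarrow> x \<notin> \<Omega> \<Longrightarrow> \<phi> x = 0"
  unfolding test_functions_def using closure_subset[of "{x. \<phi> x \<noteq> 0}"] by auto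

text \<open>The support of \<phi> lies in \<Omega>, so the integral over \<Omega> is one over the
  whole space, where translation invariance is available.\<close>

lemma set_integral_mult_test_function:
  fixes f \<phi> :: "'d::finite space \<Rightarrow> real"
  assumes "\<phi> \<in> test_functions \<Omega>" "continuous_on UNIV f"
  shows "(LINT x:\<Omega>|lebesgue. f x * \<phi> x) = (\<integral>x. f x * \<phi> x \<partial>lborel)"
    and "integrable lborel (\<lambda>x. f x * \<phi> x)"
proof -
  have \<phi>: "continuous_on UNIV \<phi>" "compact (closure {x. \<phi> x \<noteq> 0})"
    using assms smooth_continuous_on unfolding test_functions_def by auto
  have c: "continuous_on UNIV (\<lambda>x. f x * \<phi> x)" using assms(2) \<phi>(1) by (intro continuous_intros)
  then have m: "(\<lambda>x. f x * \<phi> x) \<in> borel_measurable borel" by (rule borel_measurable_continuous_onI)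
  have "bounded {x. f x * \<phi> x \<noteq> 0}"
    using compact_imp_bounded[OF \<phi>(2)] closure_subset[of "{x. \<phi> x \<noteq> 0}"] by (auto intro: bounded_subset)
  then have b: "compact (closure {x. f x * \<phi> x \<noteq> 0})" by (simp only: compact_closure)
  obtain K where K: "\<And>x. \<bar>f x * \<phi> x\<bar> \<le> K" using compact_support_bounded[OF c b] by metis
  show "integrable lborel (\<lambda>x. f x * \<phi> x)"
    by (rule bounded_support_integrable[OF m compact_imp_bounded[OF b] _ K])
       (use closure_subset[of "{x. f x * \<phi> x \<noteq> 0}"] in blast)
  have "(LINT x:\<Omega>|lebesgue. f x * \<phi> x) = (\<integral>x. f x * \<phi> x \<partial>lebesgue)"
    unfolding set_lebesgue_integral_def
    by (rule Bochner_Integration.integral_cong)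
       (use test_function_zero[OF assms(1)] in \<open>auto split: split_indicator\<close>)
  also have "\<dots> = (\<integral>x. f x * \<phi> x \<partial>lborel)" by (rule integral_completion) (use m in simp)
  finally show "(LINT x:\<Omega>|lebesgue. f x * \<phi> x) = (\<integral>x. f x * \<phi> x \<partial>lborel)" .
qed

text \<open>The derivative of \<open>f * \<phi>\<close> integrates to zero over the whole space, and
  the product rule splits it. The compact support of \<phi> takes care of the boundary term.\<close>

lemma integration_by_parts_test_function:
  fixes f \<phi> :: "'d::finite space \<Rightarrow> real"
  assumes f: "smooth f" and \<phi>: "\<phi> \<in> test_functions \<Omega>"
  shows "(LINT x:\<Omega>|lebesgue. f x * partial_deriv i \<phi> x) = - (LINT x:\<Omega>|lebesgue. partial_deriv i f x * \<phi> x)"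
proof -
  have s: "smooth \<phi>" "compact (closure {x. \<phi> x \<noteq> 0})" using \<phi> unfolding test_functions_def by auto
  have p: "partial_deriv i (\<lambda>x. f x * \<phi> x) = (\<lambda>x. f x * partial_deriv i \<phi> x + partial_deriv i f x * \<phi> x)"
    by (intro partial_deriv_mult smooth_differentiable_on f s)
  have sm: "smooth (\<lambda>x. f x * \<phi> x)" using f s by (intro smooth_mult)
  have "(\<integral>x. partial_deriv i (\<lambda>x. f x * \<phi> x) x \<partial>lborel) = 0"
  proof (rule integral_partial_deriv_eq_0)
    show "(\<lambda>x. f x * \<phi> x) differentiable_on UNIV" by (rule smooth_differentiable_on[OF sm])
    show "continuous_on UNIV (partial_deriv i (\<lambda>x. f x * \<phi> x))"
      by (rule smooth_continuous_on[OF smooth_partial_deriv[OF sm]])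
    have "bounded {x. f x * \<phi> x \<noteq> 0}"
      using compact_imp_bounded[OF s(2)] closure_subset[of "{x. \<phi> x \<noteq> 0}"] by (auto intro: bounded_subset)
    then show "compact (closure {x. f x * \<phi> x \<noteq> 0})" by (simp only: compact_closure)
  qed
  then show ?thesis
    using set_integral_mult_test_function[OF test_function_partial_deriv[OF \<phi>] smooth_continuous_on[OF f], of i]
      set_integral_mult_test_function[OF \<phi> smooth_continuous_on[OF smooth_partial_deriv[OF f]], of i]
    unfolding p by simp
qed

text \<open>The mean value theorem is applied in direction i to the increment of f in direction j,
  and then in direction j to the resulting derivative. The second difference on the left is
  symmetric in i and j, so exchanging them reaches both orders of differentiation.\<close>

lemma mixed_difference_mean_value:
  assumes f: "smooth f" and h: "0 < h"
  obtains s t where "0 < s" "s < h" "0 < t" "t < h"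
    "f (x + h *\<^sub>R axis i 1 + h *\<^sub>R axis j 1) - f (x + h *\<^sub>R axis i 1) - f (x + h *\<^sub>R axis j 1) + f x =
      h * h * partial_deriv j (partial_deriv i f) (x + s *\<^sub>R axis i 1 + t *\<^sub>R axis j 1)"
proof -
  note d = smooth_differentiable_on[OF f] and d' = smooth_differentiable_on[OF smooth_partial_deriv[OF f]]
  let ?g = "\<lambda>s. f (x + h *\<^sub>R axis j 1 + s *\<^sub>R axis i 1) - f (x + s *\<^sub>R axis i 1)"
  let ?g' = "\<lambda>s. partial_deriv i f (x + h *\<^sub>R axis j 1 + s *\<^sub>R axis i 1) - partial_deriv i f (x + s *\<^sub>R axis i 1)"
  have "(?g has_real_derivative ?g' s) (at s)" for s
    by (intro DERIV_diff line_has_real_derivative d)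
  then obtain s where s: "0 < s" "s < h" "?g h - ?g 0 = (h - 0) * ?g' s"
    using MVT2[OF h, of ?g ?g'] by metis
  let ?k = "\<lambda>t. partial_deriv i f (x + s *\<^sub>R axis i 1 + t *\<^sub>R axis j 1)"
  let ?k' = "\<lambda>t. partial_deriv j (partial_deriv i f) (x + s *\<^sub>R axis i 1 + t *\<^sub>R axis j 1)"
  have "(?k has_real_derivative ?k' t) (at t)" for t by (intro line_has_real_derivative d')
  then obtain t where t: "0 < t" "t < h" "?k h - ?k 0 = (h - 0) * ?k' t"
    using MVT2[OF h, of ?k ?k'] by metis
  have "?g' s = ?k h - ?k 0" by (simp add: add.commute add.left_commute)
  then show ?thesis using that[OF s(1,2) t(1,2)] s(3) t(3) by (simp add: add.commute add.left_commute)
qed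

text \<open>The two mixed derivatives, each at some point within 2h of x, equal the same second
  difference divided by \<open>h * h\<close>. As h tends to 0, continuity carries the equality to
  x.\<close>

lemma partial_deriv_commute:
  assumes f: "smooth f"
  shows "partial_deriv i (partial_deriv j f) x = partial_deriv j (partial_deriv i f) x"
proof -
  let ?A = "partial_deriv i (partial_deriv j f)" and ?B = "partial_deriv j (partial_deriv i f)"
  define \<epsilon> where "\<epsilon> n = inverse (real (Suc n))" for n
  have \<epsilon>: "0 < \<epsilon> n" for n unfolding \<epsilon>_def by simp
  have "\<exists>p q. norm (p - x) \<le> 2 * \<epsilon> n \<and> norm (q - x) \<le> 2 * \<epsilon> n \<and> ?A p = ?B q" for n
  proof -
    obtain s t where st: "0 < s" "s < \<epsilon> n" "0 < t" "t < \<epsilon> n"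
      "f (x + \<epsilon> n *\<^sub>R axis i 1 + \<epsilon> n *\<^sub>R axis j 1) - f (x + \<epsilon> n *\<^sub>R axis i 1) - f (x + \<epsilon> n *\<^sub>R axis j 1) + f x =
        \<epsilon> n * \<epsilon> n * ?B (x + s *\<^sub>R axis i 1 + t *\<^sub>R axis j 1)"
      using mixed_difference_mean_value[OF f \<epsilon>, of n x i j] by metis
    obtain s' t' where st': "0 < s'" "s' < \<epsilon> n" "0 < t'" "t' < \<epsilon> n"
      "f (x + \<epsilon> n *\<^sub>R axis j 1 + \<epsilon> n *\<^sub>R axis i 1) - f (x + \<epsilon> n *\<^sub>R axis j 1) - f (x + \<epsilon> n *\<^sub>R axis i 1) + f x =
        \<epsilon> n * \<epsilon> n * ?A (x + s' *\<^sub>R axis j 1 + t' *\<^sub>R axis i 1)"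
      using mixed_difference_mean_value[OF f \<epsilon>, of n x j i] by metis
    have eq: "?A (x + s' *\<^sub>R axis j 1 + t' *\<^sub>R axis i 1) = ?B (x + s *\<^sub>R axis i 1 + t *\<^sub>R axis j 1)"
    proof -
      have "\<epsilon> n * \<epsilon> n * ?A (x + s' *\<^sub>R axis j 1 + t' *\<^sub>R axis i 1) =
          \<epsilon> n * \<epsilon> n * ?B (x + s *\<^sub>R axis i 1 + t *\<^sub>R axis j 1)"
        unfolding st(5)[symmetric] st'(5)[symmetric] by (simp add: algebra_simps)
      then show ?thesis using \<epsilon>[of n] by simp
    qed
    have "norm (x + u *\<^sub>R axis k 1 + v *\<^sub>R axis l 1 - x) \<le> 2 * \<epsilon> n"
      if "0 < u" "u < \<epsilon> n" "0 < v" "v < \<epsilon> n" for u v and k l :: 'a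
      using norm_triangle_ineq[of "u *\<^sub>R axis k (1::real)" "v *\<^sub>R axis l 1"] that
      by (simp add: norm_axis_1 add.assoc)
    then show ?thesis using eq st st' by meson
  qed
  then obtain p q where pq: "\<And>n. norm (p n - x) \<le> 2 * \<epsilon> n" "\<And>n. norm (q n - x) \<le> 2 * \<epsilon> n"
    "\<And>n. ?A (p n) = ?B (q n)" by metis
  have e0: "(\<lambda>n. 2 * \<epsilon> n) \<longlonglongrightarrow> 0"
    using tendsto_mult_right_zero[OF LIMSEQ_inverse_real_of_nat] unfolding \<epsilon>_def by simp
  have lim: "r \<longlonglongrightarrow> x" if "\<And>n. norm (r n - x) \<le> 2 * \<epsilon> n" for r
  proof -
    have "(\<lambda>n. r n - x) \<longlonglongrightarrow> 0" by (rule Lim_null_comparison[OF _ e0]) (use that in auto)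
    then show ?thesis by (simp add: Lim_null[symmetric])
  qed
  have c: "isCont ?A x" "isCont ?B x"
    using smooth_continuous_on[OF smooth_partial_deriv[OF smooth_partial_deriv[OF f]]]
    by (simp_all add: continuous_on_eq_continuous_at)
  have "(\<lambda>n. ?A (p n)) \<longlonglongrightarrow> ?A x" using isCont_tendsto_compose[OF c(1) lim[OF pq(1)]] .
  moreover have "(\<lambda>n. ?A (p n)) \<longlonglongrightarrow> ?B x" using isCont_tendsto_compose[OF c(2) lim[OF pq(2)]] unfolding pq(3) .
  ultimately show ?thesis by (rule LIMSEQ_unique)
qed


section \<open>Weak derivatives, Sobolev norms and the weak curl\<close>

lemma L2_eqI_pairing:
  assumes "open \<Omega>" "u \<in> L2 \<Omega>" "v \<in> L2 \<Omega>"
    and "\<And>\<phi>. \<phi> \<in> test_functions \<Omega> \<Longrightarrow> L2_pairing \<Omega> u \<phi> = L2_pairing \<Omega> v \<phi>"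
  shows "u = v"
proof -
  have L: "\<Omega> \<in> sets lebesgue" using assms(1) by auto
  have m: "(-1) *\<^sub>R v \<in> L2 \<Omega>" using assms(3) subspace_scale[OF subspace_L2] by blast
  have "u + (-1) *\<^sub>R v = 0"
  proof (rule L2_eq_0_if_pairing_test_functions_0[OF assms(1)])
    show "u + (-1) *\<^sub>R v \<in> L2 \<Omega>" using assms(2) m subspace_add[OF subspace_L2] by blast
    fix \<phi> assume p: "\<phi> \<in> test_functions \<Omega>"
    note s = test_function_square_integrable[OF p]
    show "L2_pairing \<Omega> (u + (-1) *\<^sub>R v) \<phi> = 0"
      using L2_pairing_add[OF L assms(2) m s] L2_pairing_scale[OF L assms(3) s, of "-1"] assms(4)[OF p] by simp
  qed
  then show ?thesis by simp
qed

section \<open>Linearity of weak derivatives\<close>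

lemma has_weak_deriv_iff:
  "has_weak_deriv \<Omega> i u g \<longleftrightarrow>
     (\<forall>\<phi>\<in>test_functions \<Omega>. L2_pairing \<Omega> u (partial_deriv i \<phi>) = - L2_pairing \<Omega> g \<phi>)"
  unfolding has_weak_deriv_def L2_pairing_def ..

lemma weak_deriv_eqI:
  assumes "open \<Omega>" "g \<in> L2 \<Omega>" "has_weak_deriv \<Omega> i u g"
  shows "weak_deriv \<Omega> i u = g"
  unfolding weak_deriv_def
proof (rule the_equality)
  fix h assume h: "h \<in> L2 \<Omega> \<and> has_weak_deriv \<Omega> i u h"
  show "h = g"
    by (rule L2_eqI_pairing[OF assms(1)]) (use h assms in \<open>auto simp: has_weak_deriv_iff\<close>)
qed (use assms in auto)

lemma has_weak_deriv_add:
  assumes "open \<Omega>" "u \<in> L2 \<Omega>" "v \<in> L2 \<Omega>" "g \<in> L2 \<Omega>" "h \<in> L2 \<Omega>"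
    and "has_weak_deriv \<Omega> i u g" "has_weak_deriv \<Omega> i v h"
  shows "has_weak_deriv \<Omega> i (u + v) (g + h)"
proof -
  have L: "\<Omega> \<in> sets lebesgue" using assms(1) by auto
  show ?thesis
    unfolding has_weak_deriv_iff
  proof
    fix \<phi> assume p: "\<phi> \<in> test_functions \<Omega>"
    note sq = test_function_square_integrable[OF p] test_function_square_integrable[OF test_function_partial_deriv[OF p]]
    show "L2_pairing \<Omega> (u + v) (partial_deriv i \<phi>) = - L2_pairing \<Omega> (g + h) \<phi>"
      using assms(6,7) p unfolding has_weak_deriv_iff by (simp add: L2_pairing_add[OF L] assms sq)
  qed
qed

lemma has_weak_deriv_scale:
  assumes "open \<Omega>" "u \<in> L2 \<Omega>" "g \<in> L2 \<Omega>" "has_weak_deriv \<Omega> i u g"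
  shows "has_weak_deriv \<Omega> i (c *\<^sub>R u) (c *\<^sub>R g)"
proof -
  have L: "\<Omega> \<in> sets lebesgue" using assms(1) by auto
  show ?thesis
    unfolding has_weak_deriv_iff
  proof
    fix \<phi> assume p: "\<phi> \<in> test_functions \<Omega>"
    note sq = test_function_square_integrable[OF p] test_function_square_integrable[OF test_function_partial_deriv[OF p]]
    show "L2_pairing \<Omega> (c *\<^sub>R u) (partial_deriv i \<phi>) = - L2_pairing \<Omega> (c *\<^sub>R g) \<phi>"
      using assms(4) p unfolding has_weak_deriv_iff by (simp add: L2_pairing_scale[OF L] assms sq)
  qed
qed

lemma L2_pairing_zero: "L2_pairing \<Omega> 0 f = 0"
proof -
  have "AE x in lebesgue. indicator \<Omega> x *\<^sub>R (rep_ae_fun 0 x * f x) = 0"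
    using rep_zero_ae_fun by eventually_elim simp
  then show ?thesis unfolding L2_pairing_def set_lebesgue_integral_def by (rule integral_eq_zero_AE)
qed

lemma sobolev_subset_L2: "sobolev k \<Omega> \<subseteq> L2 \<Omega>"
  by (cases k) auto

lemma subspace_sobolev:
  assumes "open \<Omega>"
  shows "subspace (sobolev k \<Omega>)"
proof (induction k)
  case 0
  then show ?case using subspace_L2 by simp
next
  case (Suc k)
  note L2 = subsetD[OF sobolev_subset_L2[of k \<Omega>]]
  show ?case
  proof (rule subspaceI)
    have "has_weak_deriv \<Omega> i 0 0" for i unfolding has_weak_deriv_iff by (simp add: L2_pairing_zero)
    then show "0 \<in> sobolev (Suc k) \<Omega>" using subspace_0[OF Suc] subspace_0[OF subspace_L2] by auto
  next
    fix u v assume u: "u \<in> sobolev (Suc k) \<Omega>" and v: "v \<in> sobolev (Suc k) \<Omega>"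
    have "\<exists>g\<in>sobolev k \<Omega>. has_weak_deriv \<Omega> i (u + v) g" for i
    proof -
      obtain g h where "g \<in> sobolev k \<Omega>" "h \<in> sobolev k \<Omega>" "has_weak_deriv \<Omega> i u g" "has_weak_deriv \<Omega> i v h"
        using u v by auto metis
      moreover from this have "has_weak_deriv \<Omega> i (u + v) (g + h)"
        using u v L2 by (intro has_weak_deriv_add[OF assms]) auto
      ultimately show ?thesis using subspace_add[OF Suc] by blast
    qed
    then show "u + v \<in> sobolev (Suc k) \<Omega>" using u v subspace_add[OF subspace_L2] by auto
  next
    fix c u assume u: "u \<in> sobolev (Suc k) \<Omega>"
    have "\<exists>g\<in>sobolev k \<Omega>. has_weak_deriv \<Omega> i (c *\<^sub>R u) g" for i
    proof -
      obtain g where "g \<in> sobolev k \<Omega>" "has_weak_deriv \<Omega> i u g" using u by auto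
      moreover from this have "has_weak_deriv \<Omega> i (c *\<^sub>R u) (c *\<^sub>R g)"
        using u L2 by (intro has_weak_deriv_scale[OF assms]) auto
      ultimately show ?thesis using subspace_scale[OF Suc] by blast
    qed
    then show "c *\<^sub>R u \<in> sobolev (Suc k) \<Omega>" using u subspace_scale[OF subspace_L2] by auto
  qed
qed

text \<open>Uniqueness in \<open>L2 \<Omega>\<close> makes the description in
  \<open>weak_deriv\<close> select the very witness that membership provides, and this one lies in
  \<open>sobolev k \<Omega>\<close>.\<close>

lemma weak_deriv_sobolev:
  assumes "open \<Omega>" "u \<in> sobolev (Suc k) \<Omega>"
  shows "weak_deriv \<Omega> i u \<in> sobolev k \<Omega>" "has_weak_deriv \<Omega> i u (weak_deriv \<Omega> i u)"
proof -
  obtain g where g: "g \<in> sobolev k \<Omega>" "has_weak_deriv \<Omega> i u g" using assms(2) by auto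
  then have "weak_deriv \<Omega> i u = g" using weak_deriv_eqI[OF assms(1)] sobolev_subset_L2 by blast
  then show "weak_deriv \<Omega> i u \<in> sobolev k \<Omega>" "has_weak_deriv \<Omega> i u (weak_deriv \<Omega> i u)" using g by auto
qed

lemma weak_deriv_add:
  assumes "open \<Omega>" "u \<in> sobolev (Suc k) \<Omega>" "v \<in> sobolev (Suc k) \<Omega>"
  shows "weak_deriv \<Omega> i (u + v) = weak_deriv \<Omega> i u + weak_deriv \<Omega> i v"
proof -
  note u = weak_deriv_sobolev[OF assms(1,2), of i] and v = weak_deriv_sobolev[OF assms(1,3), of i]
  have "weak_deriv \<Omega> i u \<in> L2 \<Omega>" "weak_deriv \<Omega> i v \<in> L2 \<Omega>" using u v sobolev_subset_L2 by blast+
  then show ?thesis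
    using assms u v subspace_add[OF subspace_L2] by (intro weak_deriv_eqI has_weak_deriv_add) auto
qed

lemma weak_deriv_scale:
  assumes "open \<Omega>" "u \<in> sobolev (Suc k) \<Omega>"
  shows "weak_deriv \<Omega> i (c *\<^sub>R u) = c *\<^sub>R weak_deriv \<Omega> i u"
proof -
  note u = weak_deriv_sobolev[OF assms, of i]
  have "weak_deriv \<Omega> i u \<in> L2 \<Omega>" using u sobolev_subset_L2 by blast
  then show ?thesis
    using assms u subspace_scale[OF subspace_L2] by (intro weak_deriv_eqI has_weak_deriv_scale) auto
qed

section \<open>Sobolev norms\<close>

lemma sobolev_norm_sq_nonneg: "sobolev_norm_sq k \<Omega> u \<ge> 0"
  by (induction k arbitrary: u) (auto intro!: add_nonneg_nonneg sum_nonneg L2_inner_nonneg)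

lemma sobolev_norm_nonneg: "sobolev_norm k \<Omega> u \<ge> 0"
  unfolding sobolev_norm_def using sobolev_norm_sq_nonneg by simp

lemma L2_inner_le_sobolev_norm_sq: "L2_inner \<Omega> u u \<le> sobolev_norm_sq k \<Omega> u"
  by (cases k) (auto intro!: sum_nonneg sobolev_norm_sq_nonneg)

lemma sobolev_norm_pos:
  assumes "open \<Omega>" "u \<in> sobolev k \<Omega>" "u \<noteq> 0"
  shows "sobolev_norm k \<Omega> u > 0"
proof -
  have "L2_inner \<Omega> u u \<noteq> 0" using L2_inner_self_eq_0[of \<Omega> u] assms sobolev_subset_L2 by auto
  then have "L2_inner \<Omega> u u > 0" using L2_inner_nonneg[of \<Omega> u] by simp
  then show ?thesis unfolding sobolev_norm_def using L2_inner_le_sobolev_norm_sq[of \<Omega> u k] by simp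
qed

lemma sobolev_norm_scale:
  assumes "open \<Omega>" "u \<in> sobolev k \<Omega>"
  shows "sobolev_norm k \<Omega> (c *\<^sub>R u) = \<bar>c\<bar> * sobolev_norm k \<Omega> u"
proof -
  have L: "\<Omega> \<in> sets lebesgue" using assms(1) by auto
  have L2: "L2_inner \<Omega> (c *\<^sub>R u) (c *\<^sub>R u) = c\<^sup>2 * L2_inner \<Omega> u u" if "u \<in> L2 \<Omega>" for u
    using L2_inner_scale[OF L that] that subspace_scale[OF subspace_L2 that]
    by (simp add: power2_eq_square)
  have "sobolev_norm_sq k \<Omega> (c *\<^sub>R u) = c\<^sup>2 * sobolev_norm_sq k \<Omega> u"
    using assms(2)
  proof (induction k arbitrary: u)
    case (Suc k)
    have "u \<in> L2 \<Omega>" using Suc.prems sobolev_subset_L2 by blast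
    then show ?case
      using Suc weak_deriv_sobolev(1)[OF assms(1) Suc.prems] weak_deriv_scale[OF assms(1) Suc.prems] L2
      by (simp add: sum_distrib_left distrib_left)
  qed (use L2 in simp)
  then show ?thesis unfolding sobolev_norm_def by (simp add: real_sqrt_mult)
qed

text \<open>Exhibits the norm as the Euclidean norm of a pair whose second entry is again a
  Euclidean norm. The triangle inequality then follows by induction from the one in L2 and from
  Minkowski's inequality for finite tuples.\<close>

lemma sobolev_norm_Suc:
  "sobolev_norm (Suc k) \<Omega> u =
     sqrt ((sqrt (L2_inner \<Omega> u u))\<^sup>2 + (L2_set (\<lambda>i. sobolev_norm k \<Omega> (weak_deriv \<Omega> i u)) UNIV)\<^sup>2)"
  unfolding sobolev_norm_def L2_set_def
  by (simp add: L2_inner_nonneg sobolev_norm_sq_nonneg sum_nonneg)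

lemma sobolev_norm_triangle:
  assumes "open \<Omega>" "u \<in> sobolev k \<Omega>" "v \<in> sobolev k \<Omega>"
  shows "sobolev_norm k \<Omega> (u + v) \<le> sobolev_norm k \<Omega> u + sobolev_norm k \<Omega> v"
  using assms(2,3)
proof (induction k arbitrary: u v)
  case 0
  then show ?case using L2_norm_triangle[of \<Omega> u v] assms(1) by (simp add: sobolev_norm_def)
next
  case (Suc k)
  let ?s = "\<lambda>u i. sobolev_norm k \<Omega> (weak_deriv \<Omega> i u)"
  have uv: "u \<in> L2 \<Omega>" "v \<in> L2 \<Omega>" using Suc.prems sobolev_subset_L2 by blast+
  have "L2_set (?s (u + v)) UNIV \<le> L2_set (\<lambda>i. ?s u i + ?s v i) UNIV"
    using Suc.IH weak_deriv_sobolev(1)[OF assms(1)] Suc.prems weak_deriv_add[OF assms(1) Suc.prems]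
    by (intro L2_set_mono) (auto simp: sobolev_norm_nonneg)
  also have "\<dots> \<le> L2_set (?s u) UNIV + L2_set (?s v) UNIV" by (rule L2_set_triangle_ineq)
  finally have d: "L2_set (?s (u + v)) UNIV \<le> L2_set (?s u) UNIV + L2_set (?s v) UNIV" .
  have l: "sqrt (L2_inner \<Omega> (u + v) (u + v)) \<le> sqrt (L2_inner \<Omega> u u) + sqrt (L2_inner \<Omega> v v)"
    using L2_norm_triangle[of \<Omega> u v] assms(1) uv by auto
  have "sobolev_norm (Suc k) \<Omega> (u + v) \<le>
      sqrt ((sqrt (L2_inner \<Omega> u u) + sqrt (L2_inner \<Omega> v v))\<^sup>2 + (L2_set (?s u) UNIV + L2_set (?s v) UNIV)\<^sup>2)"
    unfolding sobolev_norm_Suc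
    by (intro real_sqrt_le_mono add_mono power_mono d l) (auto simp: L2_inner_nonneg)
  also have "\<dots> \<le> sobolev_norm (Suc k) \<Omega> u + sobolev_norm (Suc k) \<Omega> v"
    unfolding sobolev_norm_Suc by (rule real_sqrt_sum_squares_triangle_ineq)
  finally show ?case .
qed

lemma grad_add:
  assumes "open \<Omega>" "u \<in> sobolev 1 \<Omega>" "v \<in> sobolev 1 \<Omega>"
  shows "grad \<Omega> (u + v) = grad \<Omega> u + grad \<Omega> v"
  using weak_deriv_add[OF assms(1), of u 0 v] assms(2,3) by (simp add: grad_def vec_eq_iff)

lemma grad_scale:
  assumes "open \<Omega>" "u \<in> sobolev 1 \<Omega>"
  shows "grad \<Omega> (c *\<^sub>R u) = c *\<^sub>R grad \<Omega> u"
  using weak_deriv_scale[OF assms(1), of u 0] assms(2) by (simp add: grad_def vec_eq_iff)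

text \<open>This places \<open>W\<^sub>\<Gamma>\<close> in the space on which B and the H^2 norm
  live: its elements have gradients in \<open>G\<^sub>\<Gamma>\<close>, hence in H^1.\<close>

lemma sobolev_2_if_grad:
  assumes "open \<Omega>" "u \<in> sobolev 1 \<Omega>" "grad \<Omega> u \<in> sobolev_vec 1 \<Omega>"
  shows "u \<in> sobolev 2 \<Omega>"
proof -
  have u: "u \<in> sobolev (Suc 0) \<Omega>" using assms(2) by simp
  have "u \<in> L2 \<Omega>" using assms(2) sobolev_subset_L2 by blast
  moreover have "\<exists>g\<in>sobolev (Suc 0) \<Omega>. has_weak_deriv \<Omega> i u g" for i
    using assms(3) weak_deriv_sobolev(2)[OF assms(1) u, of i] unfolding sobolev_vec_def grad_def by auto
  ultimately show ?thesis by (simp add: numeral_2_eq_2)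
qed

lemma subspace_sobolev_vec:
  assumes "open \<Omega>"
  shows "subspace (sobolev_vec k \<Omega>)"
  using subspace_sobolev[OF assms, of k] unfolding sobolev_vec_def subspace_def by auto

text \<open>The space H(curl), with all index pairs at once so that it serves both branches of
  \<open>curl\<close>. It contains the H^1 fields as well as the gradients of H^1 functions, which
  need not be H^1 fields, and so is a common domain for the linearity of \<open>rot\<close>.\<close>

definition weak_rot_fields :: "'d::finite space set \<Rightarrow> 'd vfield set" where
  "weak_rot_fields \<Omega> = {\<theta>. (\<forall>i. \<theta> $ i \<in> L2 \<Omega>) \<and> (\<forall>i j. \<exists>g\<in>L2 \<Omega>. has_weak_rot \<Omega> i j \<theta> g)}"

lemma has_weak_rot_iff:
  assumes "open \<Omega>" "\<And>i. \<theta> $ i \<in> L2 \<Omega>"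
  shows "has_weak_rot \<Omega> i j \<theta> g \<longleftrightarrow>
     (\<forall>\<phi>\<in>test_functions \<Omega>. L2_pairing \<Omega> (\<theta> $ j) (partial_deriv i \<phi>) - L2_pairing \<Omega> (\<theta> $ i) (partial_deriv j \<phi>) =
        - L2_pairing \<Omega> g \<phi>)"
proof -
  have L: "\<Omega> \<in> sets lebesgue" using assms(1) by auto
  have "(LINT x:\<Omega>|lebesgue. rep_ae_fun (\<theta> $ j) x * partial_deriv i \<phi> x - rep_ae_fun (\<theta> $ i) x * partial_deriv j \<phi> x) =
      L2_pairing \<Omega> (\<theta> $ j) (partial_deriv i \<phi>) - L2_pairing \<Omega> (\<theta> $ i) (partial_deriv j \<phi>)"
    if p: "\<phi> \<in> test_functions \<Omega>" for \<phi>
    unfolding L2_pairing_def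
    by (intro set_integral_diff L2_pairing_integrable L assms(2)
        test_function_square_integrable[OF test_function_partial_deriv[OF p]])
  then show ?thesis unfolding has_weak_rot_def L2_pairing_def[of \<Omega> g] by simp
qed

lemma rot_eqI:
  assumes "open \<Omega>" "\<theta> \<in> weak_rot_fields \<Omega>" "g \<in> L2 \<Omega>" "has_weak_rot \<Omega> i j \<theta> g"
  shows "rot \<Omega> i j \<theta> = g"
  unfolding rot_def
proof (rule the_equality)
  have \<theta>: "\<And>i. \<theta> $ i \<in> L2 \<Omega>" using assms(2) unfolding weak_rot_fields_def by auto
  fix h assume h: "h \<in> L2 \<Omega> \<and> has_weak_rot \<Omega> i j \<theta> h"
  show "h = g"
    by (rule L2_eqI_pairing[OF assms(1)]) (use h assms(3,4) in \<open>auto simp: has_weak_rot_iff[OF assms(1) \<theta>]\<close>)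
qed (use assms in auto)

lemma weak_rot_fields_rot:
  assumes "open \<Omega>" "\<theta> \<in> weak_rot_fields \<Omega>"
  shows "rot \<Omega> i j \<theta> \<in> L2 \<Omega>" "has_weak_rot \<Omega> i j \<theta> (rot \<Omega> i j \<theta>)"
proof -
  obtain g where g: "g \<in> L2 \<Omega>" "has_weak_rot \<Omega> i j \<theta> g" using assms(2) unfolding weak_rot_fields_def by blast
  then show "rot \<Omega> i j \<theta> \<in> L2 \<Omega>" "has_weak_rot \<Omega> i j \<theta> (rot \<Omega> i j \<theta>)" using rot_eqI[OF assms g] by auto
qed

lemma has_weak_rot_add:
  assumes "open \<Omega>" "\<And>i. \<theta> $ i \<in> L2 \<Omega>" "\<And>i. \<eta> $ i \<in> L2 \<Omega>" "g \<in> L2 \<Omega>" "h \<in> L2 \<Omega>"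
    and "has_weak_rot \<Omega> i j \<theta> g" "has_weak_rot \<Omega> i j \<eta> h"
  shows "has_weak_rot \<Omega> i j (\<theta> + \<eta>) (g + h)"
proof -
  have L: "\<Omega> \<in> sets lebesgue" using assms(1) by auto
  have s: "(\<theta> + \<eta>) $ i \<in> L2 \<Omega>" for i using assms(2,3) by (simp add: subspace_add[OF subspace_L2])
  show ?thesis
    unfolding has_weak_rot_iff[OF assms(1) s]
  proof
    fix \<phi> assume p: "\<phi> \<in> test_functions \<Omega>"
    note sq = test_function_square_integrable[OF p] test_function_square_integrable[OF test_function_partial_deriv[OF p]]
    show "L2_pairing \<Omega> ((\<theta> + \<eta>) $ j) (partial_deriv i \<phi>) - L2_pairing \<Omega> ((\<theta> + \<eta>) $ i) (partial_deriv j \<phi>) =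
        - L2_pairing \<Omega> (g + h) \<phi>"
      using bspec[OF assms(6)[unfolded has_weak_rot_iff[OF assms(1,2)]] p]
        bspec[OF assms(7)[unfolded has_weak_rot_iff[OF assms(1,3)]] p]
      by (simp add: L2_pairing_add[OF L] assms(2-5) sq)
  qed
qed

lemma has_weak_rot_scale:
  assumes "open \<Omega>" "\<And>i. \<theta> $ i \<in> L2 \<Omega>" "g \<in> L2 \<Omega>" "has_weak_rot \<Omega> i j \<theta> g"
  shows "has_weak_rot \<Omega> i j (c *\<^sub>R \<theta>) (c *\<^sub>R g)"
proof -
  have L: "\<Omega> \<in> sets lebesgue" using assms(1) by auto
  have s: "(c *\<^sub>R \<theta>) $ i \<in> L2 \<Omega>" for i using assms(2) by (simp add: subspace_scale[OF subspace_L2])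
  show ?thesis
    unfolding has_weak_rot_iff[OF assms(1) s]
  proof
    fix \<phi> assume p: "\<phi> \<in> test_functions \<Omega>"
    note sq = test_function_square_integrable[OF p] test_function_square_integrable[OF test_function_partial_deriv[OF p]]
    show "L2_pairing \<Omega> ((c *\<^sub>R \<theta>) $ j) (partial_deriv i \<phi>) - L2_pairing \<Omega> ((c *\<^sub>R \<theta>) $ i) (partial_deriv j \<phi>) =
        - L2_pairing \<Omega> (c *\<^sub>R g) \<phi>"
      using bspec[OF assms(4)[unfolded has_weak_rot_iff[OF assms(1,2)]] p]
      by (simp add: L2_pairing_scale[OF L] assms(2,3) sq flip: right_diff_distrib)
  qed
qed

lemma subspace_weak_rot_fields:
  assumes "open \<Omega>"
  shows "subspace (weak_rot_fields \<Omega>)"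
proof (rule subspaceI)
  have "has_weak_rot \<Omega> i j 0 0" for i j
    using has_weak_rot_iff[OF assms, of 0 i j 0] subspace_0[OF subspace_L2[of \<Omega>]] by (simp add: L2_pairing_zero)
  then show "0 \<in> weak_rot_fields \<Omega>" unfolding weak_rot_fields_def using subspace_0[OF subspace_L2] by auto
next
  fix \<theta> \<eta> assume t: "\<theta> \<in> weak_rot_fields \<Omega>" "\<eta> \<in> weak_rot_fields \<Omega>"
  then have l: "\<And>i. \<theta> $ i \<in> L2 \<Omega>" "\<And>i. \<eta> $ i \<in> L2 \<Omega>" unfolding weak_rot_fields_def by auto
  have "\<exists>g\<in>L2 \<Omega>. has_weak_rot \<Omega> i j (\<theta> + \<eta>) g" for i j
    using has_weak_rot_add[OF assms l weak_rot_fields_rot(1)[OF assms t(1)] weak_rot_fields_rot(1)[OF assms t(2)]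
        weak_rot_fields_rot(2)[OF assms t(1)] weak_rot_fields_rot(2)[OF assms t(2)]]
      subspace_add[OF subspace_L2 weak_rot_fields_rot(1)[OF assms t(1)] weak_rot_fields_rot(1)[OF assms t(2)]]
    by blast
  then show "\<theta> + \<eta> \<in> weak_rot_fields \<Omega>"
    unfolding weak_rot_fields_def using l by (simp add: subspace_add[OF subspace_L2])
next
  fix c \<theta> assume t: "\<theta> \<in> weak_rot_fields \<Omega>"
  then have l: "\<And>i. \<theta> $ i \<in> L2 \<Omega>" unfolding weak_rot_fields_def by auto
  have "\<exists>g\<in>L2 \<Omega>. has_weak_rot \<Omega> i j (c *\<^sub>R \<theta>) g" for i j
    using has_weak_rot_scale[OF assms l weak_rot_fields_rot[OF assms t]]
      subspace_scale[OF subspace_L2 weak_rot_fields_rot(1)[OF assms t]]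
    by blast
  then show "c *\<^sub>R \<theta> \<in> weak_rot_fields \<Omega>"
    unfolding weak_rot_fields_def using l by (simp add: subspace_scale[OF subspace_L2])
qed

lemma rot_add:
  assumes "open \<Omega>" "\<theta> \<in> weak_rot_fields \<Omega>" "\<eta> \<in> weak_rot_fields \<Omega>"
  shows "rot \<Omega> i j (\<theta> + \<eta>) = rot \<Omega> i j \<theta> + rot \<Omega> i j \<eta>"
proof (rule rot_eqI[OF assms(1)])
  have l: "\<And>i. \<theta> $ i \<in> L2 \<Omega>" "\<And>i. \<eta> $ i \<in> L2 \<Omega>" using assms(2,3) unfolding weak_rot_fields_def by auto
  note r = weak_rot_fields_rot[OF assms(1,2), of i j] weak_rot_fields_rot[OF assms(1,3), of i j]
  show "\<theta> + \<eta> \<in> weak_rot_fields \<Omega>" using assms subspace_add[OF subspace_weak_rot_fields] by blast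
  show "rot \<Omega> i j \<theta> + rot \<Omega> i j \<eta> \<in> L2 \<Omega>" using r subspace_add[OF subspace_L2] by blast
  show "has_weak_rot \<Omega> i j (\<theta> + \<eta>) (rot \<Omega> i j \<theta> + rot \<Omega> i j \<eta>)"
    by (rule has_weak_rot_add[OF assms(1) l r(1,3,2,4)])
qed

lemma rot_scale:
  assumes "open \<Omega>" "\<theta> \<in> weak_rot_fields \<Omega>"
  shows "rot \<Omega> i j (c *\<^sub>R \<theta>) = c *\<^sub>R rot \<Omega> i j \<theta>"
proof (rule rot_eqI[OF assms(1)])
  have l: "\<And>i. \<theta> $ i \<in> L2 \<Omega>" using assms(2) unfolding weak_rot_fields_def by auto
  note r = weak_rot_fields_rot[OF assms, of i j]
  show "c *\<^sub>R \<theta> \<in> weak_rot_fields \<Omega>" using assms subspace_scale[OF subspace_weak_rot_fields] by blast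
  show "c *\<^sub>R rot \<Omega> i j \<theta> \<in> L2 \<Omega>" using r subspace_scale[OF subspace_L2] by blast
  show "has_weak_rot \<Omega> i j (c *\<^sub>R \<theta>) (c *\<^sub>R rot \<Omega> i j \<theta>)"
    by (rule has_weak_rot_scale[OF assms(1) l r])
qed

lemma sobolev_vec_weak_rot_fields:
  assumes "open \<Omega>"
  shows "sobolev_vec 1 \<Omega> \<subseteq> weak_rot_fields \<Omega>"
proof
  fix \<theta> assume \<theta>: "\<theta> \<in> sobolev_vec 1 \<Omega>"
  have L: "\<Omega> \<in> sets lebesgue" using assms by auto
  have s: "\<theta> $ i \<in> sobolev (Suc 0) \<Omega>" for i using \<theta> unfolding sobolev_vec_def by simp
  have l: "\<And>i. \<theta> $ i \<in> L2 \<Omega>" using s sobolev_subset_L2 by blast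
  note w = weak_deriv_sobolev[OF assms s]
  have "\<exists>g\<in>L2 \<Omega>. has_weak_rot \<Omega> i j \<theta> g" for i j
  proof
    let ?g = "weak_deriv \<Omega> i (\<theta> $ j) + (-1) *\<^sub>R weak_deriv \<Omega> j (\<theta> $ i)"
    have wl: "weak_deriv \<Omega> i (\<theta> $ j) \<in> L2 \<Omega>" "weak_deriv \<Omega> j (\<theta> $ i) \<in> L2 \<Omega>" using w(1) by auto
    have ml: "(-1) *\<^sub>R weak_deriv \<Omega> j (\<theta> $ i) \<in> L2 \<Omega>" using wl subspace_scale[OF subspace_L2] by blast
    show "?g \<in> L2 \<Omega>" using wl ml subspace_add[OF subspace_L2] by blast
    show "has_weak_rot \<Omega> i j \<theta> ?g"
      unfolding has_weak_rot_iff[OF assms l]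
    proof
      fix \<phi> assume p: "\<phi> \<in> test_functions \<Omega>"
      note sq = test_function_square_integrable[OF p]
      have "L2_pairing \<Omega> ?g \<phi> = L2_pairing \<Omega> (weak_deriv \<Omega> i (\<theta> $ j)) \<phi> - L2_pairing \<Omega> (weak_deriv \<Omega> j (\<theta> $ i)) \<phi>"
        using L2_pairing_add[OF L wl(1) ml sq] L2_pairing_scale[OF L wl(2) sq, of "-1"] by simp
      then show "L2_pairing \<Omega> (\<theta> $ j) (partial_deriv i \<phi>) - L2_pairing \<Omega> (\<theta> $ i) (partial_deriv j \<phi>) = - L2_pairing \<Omega> ?g \<phi>"
        using w(2)[of i j] w(2)[of j i] p unfolding has_weak_deriv_iff by simp
    qed
  qed
  then show "\<theta> \<in> weak_rot_fields \<Omega>" unfolding weak_rot_fields_def using l by auto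
qed

text \<open>Partial derivatives of test functions are test functions, so the weak derivatives of v
  can be tested with them. Both terms become pairings of v with second derivatives of \<phi>, which
  cancel because these commute.\<close>

lemma grad_weak_rot_fields:
  assumes "open \<Omega>" "v \<in> sobolev 1 \<Omega>"
  shows "grad \<Omega> v \<in> weak_rot_fields \<Omega>"
proof -
  have v: "v \<in> sobolev (Suc 0) \<Omega>" using assms(2) by simp
  note w = weak_deriv_sobolev[OF assms(1) v]
  have l: "grad \<Omega> v $ i \<in> L2 \<Omega>" for i using w unfolding grad_def by simp
  have "has_weak_rot \<Omega> i j (grad \<Omega> v) 0" for i j
    unfolding has_weak_rot_iff[OF assms(1) l]
  proof
    fix \<phi> assume p: "\<phi> \<in> test_functions \<Omega>"
    have "partial_deriv i (partial_deriv j \<phi>) = partial_deriv j (partial_deriv i \<phi>)"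
      using p partial_deriv_commute unfolding test_functions_def by blast
    then show "L2_pairing \<Omega> (grad \<Omega> v $ j) (partial_deriv i \<phi>) - L2_pairing \<Omega> (grad \<Omega> v $ i) (partial_deriv j \<phi>) =
        - L2_pairing \<Omega> 0 \<phi>"
      using w(2)[of i] w(2)[of j] test_function_partial_deriv[OF p] unfolding has_weak_deriv_iff grad_def
      by (simp add: L2_pairing_zero) (metis minus_minus)
  qed
  then show ?thesis unfolding weak_rot_fields_def using l subspace_0[OF subspace_L2] by blast
qed

section \<open>The curl inner product\<close>

lemma curl_inner_commute: "curl_inner \<Omega> \<theta> \<eta> = curl_inner \<Omega> \<eta> \<theta>"
  unfolding curl_inner_def curl_def by (simp add: L2_inner_commute[of \<Omega> "\<eta> $ _"] L2_inner_commute[of \<Omega> "rot \<Omega> _ _ \<eta>"])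

lemma curl_inner_add:
  assumes "open \<Omega>" "\<theta> \<in> weak_rot_fields \<Omega>" "\<theta>' \<in> weak_rot_fields \<Omega>" "\<eta> \<in> weak_rot_fields \<Omega>"
  shows "curl_inner \<Omega> (\<theta> + \<theta>') \<eta> = curl_inner \<Omega> \<theta> \<eta> + curl_inner \<Omega> \<theta>' \<eta>"
proof -
  have L: "\<Omega> \<in> sets lebesgue" using assms(1) by auto
  have l: "\<theta> $ i \<in> L2 \<Omega>" "\<theta>' $ i \<in> L2 \<Omega>" "\<eta> $ i \<in> L2 \<Omega>" for i using assms unfolding weak_rot_fields_def by auto
  show ?thesis unfolding curl_inner_def curl_def rot_add[OF assms(1-3)]
    by (simp add: L2_inner_add[OF L] l weak_rot_fields_rot(1)[OF assms(1)] assms sum.distrib)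
qed

lemma curl_inner_scale:
  assumes "open \<Omega>" "\<theta> \<in> weak_rot_fields \<Omega>" "\<eta> \<in> weak_rot_fields \<Omega>"
  shows "curl_inner \<Omega> (c *\<^sub>R \<theta>) \<eta> = c * curl_inner \<Omega> \<theta> \<eta>"
proof -
  have L: "\<Omega> \<in> sets lebesgue" using assms(1) by auto
  have l: "\<theta> $ i \<in> L2 \<Omega>" "\<eta> $ i \<in> L2 \<Omega>" for i using assms unfolding weak_rot_fields_def by auto
  show ?thesis unfolding curl_inner_def curl_def rot_scale[OF assms(1-2)]
    by (simp add: L2_inner_scale[OF L] l weak_rot_fields_rot(1)[OF assms(1)] assms sum_distrib_left distrib_left)
qed

lemma bilinear_form_on_curl_inner:
  assumes "open \<Omega>"
  shows "bilinear_form_on (weak_rot_fields \<Omega>) (curl_inner \<Omega>)"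
  unfolding bilinear_form_on_def linear_form_on_def
  using curl_inner_add[OF assms] curl_inner_scale[OF assms] curl_inner_commute[of \<Omega>] by metis

text \<open>The curl terms are nonnegative, so the L2 terms must vanish, and those are definite by
  themselves.\<close>

lemma curl_inner_self_eq_0:
  assumes "open \<Omega>" "\<theta> \<in> weak_rot_fields \<Omega>" "curl_inner \<Omega> \<theta> \<theta> = 0"
  shows "\<theta> = 0"
proof -
  have nn: "(\<Sum>i\<in>UNIV. L2_inner \<Omega> (\<theta> $ i) (\<theta> $ i)) \<ge> 0" by (intro sum_nonneg L2_inner_nonneg)
  have "sum_list (map2 (L2_inner \<Omega>) (curl \<Omega> \<theta>) (curl \<Omega> \<theta>)) \<ge> 0"
    unfolding curl_def by (auto intro!: add_nonneg_nonneg L2_inner_nonneg)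
  then have "(\<Sum>i\<in>UNIV. L2_inner \<Omega> (\<theta> $ i) (\<theta> $ i)) = 0"
    using nn assms(3) unfolding curl_inner_def by simp
  then have "L2_inner \<Omega> (\<theta> $ i) (\<theta> $ i) = 0" for i
    by (subst (asm) sum_nonneg_eq_0_iff) (auto intro: L2_inner_nonneg)
  then have "\<theta> $ i = 0" for i
    using L2_inner_self_eq_0[of \<Omega> "\<theta> $ i"] assms(1,2) unfolding weak_rot_fields_def by auto
  then show ?thesis by (simp add: vec_eq_iff)
qed


section \<open>Traces\<close>

lemma restriction_L2:
  assumes "open \<Omega>" "bounded \<Omega>" "continuous_on UNIV f"
  shows "restriction \<Omega> f \<in> L2 \<Omega>"
proof (rule L2I[OF rep_restriction])
  have "bounded (f ` closure \<Omega>)"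
    using assms by (intro compact_imp_bounded compact_continuous_image) (auto intro: continuous_on_subset)
  then obtain K where K: "\<And>x. x \<in> closure \<Omega> \<Longrightarrow> \<bar>f x\<bar> \<le> K" unfolding bounded_iff by auto
  have fm: "f \<in> borel_measurable lebesgue" by (rule continuous_lebesgue_measurable[OF assms(3)])
  show "square_integrable (\<lambda>x. indicator \<Omega> x * f x)"
  proof (rule bounded_support_square_integrable[OF _ assms(2), of _ "max K 0"])
    show "(\<lambda>x. indicator \<Omega> x * f x) \<in> borel_measurable lebesgue"
      by (intro borel_measurable_times borel_measurable_indicator fm) (use assms(1) in auto)
    show "\<bar>indicator \<Omega> x * f x\<bar> \<le> max K 0" for x
      using K[of x] closure_subset[of \<Omega>] by (auto split: split_indicator)
  qed auto
qed auto

lemma L2_pairing_restriction: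
  assumes "open \<Omega>" "continuous_on UNIV f" "continuous_on UNIV g"
  shows "L2_pairing \<Omega> (restriction \<Omega> f) g = (LINT x:\<Omega>|lebesgue. f x * g x)"
  unfolding L2_pairing_def
proof (rule set_lebesgue_integral_cong_AE)
  have L: "\<Omega> \<in> sets lebesgue" using assms(1) by auto
  then show "\<Omega> \<in> sets lebesgue" .
  have m: "f \<in> borel_measurable lebesgue" "g \<in> borel_measurable lebesgue"
    using assms continuous_lebesgue_measurable by auto
  have "(\<lambda>x. indicator \<Omega> x * f x) \<in> borel_measurable lebesgue"
    by (intro borel_measurable_times borel_measurable_indicator m L)
  then have r: "rep_ae_fun (restriction \<Omega> f) \<in> borel_measurable lebesgue"
    by (rule borel_measurable_AE) (use rep_restriction[of \<Omega> f] in auto)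
  show "(\<lambda>x. rep_ae_fun (restriction \<Omega> f) x * g x) \<in> borel_measurable lebesgue"
    "(\<lambda>x. f x * g x) \<in> borel_measurable lebesgue"
    using r m by (intro borel_measurable_times; simp)+
  show "AE x\<in>\<Omega> in lebesgue. rep_ae_fun (restriction \<Omega> f) x * g x = f x * g x"
    using rep_restriction[of \<Omega> f] by eventually_elim auto
qed

text \<open>The norm inequalities are available inside the Sobolev space; this membership allows
  them to be applied to the errors \<open>restriction \<Omega> (f k) - v\<close> in
  \<open>has_trace\<close>. The weak derivatives are the restrictions of the classical ones.\<close>

lemma restriction_smooth_sobolev:
  assumes "open \<Omega>" "bounded \<Omega>" "smooth f"
  shows "restriction \<Omega> f \<in> sobolev 1 \<Omega>"
proof -
  note l = restriction_L2[OF assms(1,2) smooth_continuous_on]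
  have "has_weak_deriv \<Omega> i (restriction \<Omega> f) (restriction \<Omega> (partial_deriv i f))" for i
    unfolding has_weak_deriv_iff
  proof
    fix \<phi> assume p: "\<phi> \<in> test_functions \<Omega>"
    have s: "smooth \<phi>" using p unfolding test_functions_def by simp
    show "L2_pairing \<Omega> (restriction \<Omega> f) (partial_deriv i \<phi>) = - L2_pairing \<Omega> (restriction \<Omega> (partial_deriv i f)) \<phi>"
      using integration_by_parts_test_function[OF assms(3) p, of i]
        L2_pairing_restriction[OF assms(1) smooth_continuous_on[OF assms(3)] smooth_continuous_on[OF smooth_partial_deriv[OF s]]]
        L2_pairing_restriction[OF assms(1) smooth_continuous_on[OF smooth_partial_deriv[OF assms(3)]] smooth_continuous_on[OF s]]
      by simp
  qed
  then show ?thesis using l[OF assms(3)] l[OF smooth_partial_deriv[OF assms(3)]] by auto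
qed

lemma sets_surface_measure: "sets surface_measure = sets borel"
  unfolding hausdorff_measure_def using sets.sigma_sets_eq[of borel] by simp

lemma measurable_surface_measure: "borel_measurable surface_measure = borel_measurable borel"
  by (rule measurable_cong_sets[OF sets_surface_measure refl])

text \<open>Approximating sequences for u and v add up to one for u + v; the interior and the
  boundary error are both squeezed by the errors of the summands.\<close>

lemma has_trace_add:
  assumes \<Omega>: "open \<Omega>" "bounded \<Omega>" and u: "has_trace \<Omega> u g" and v: "has_trace \<Omega> v h"
  shows "has_trace \<Omega> (u + v) (\<lambda>x. g x + h x)"
proof -
  obtain p where p: "\<And>k. smooth (p k)" "(\<lambda>k. sobolev_norm 1 \<Omega> (restriction \<Omega> (p k) - u)) \<longlonglongrightarrow> 0"
    "(\<lambda>k. \<integral>\<^sup>+x\<in>frontier \<Omega>. ennreal ((p k x - g x)\<^sup>2) \<partial>surface_measure) \<longlonglongrightarrow> 0"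
    using u unfolding has_trace_def by blast
  obtain q where q: "\<And>k. smooth (q k)" "(\<lambda>k. sobolev_norm 1 \<Omega> (restriction \<Omega> (q k) - v)) \<longlonglongrightarrow> 0"
    "(\<lambda>k. \<integral>\<^sup>+x\<in>frontier \<Omega>. ennreal ((q k x - h x)\<^sup>2) \<partial>surface_measure) \<longlonglongrightarrow> 0"
    using v unfolding has_trace_def by blast
  have uv: "u \<in> sobolev 1 \<Omega>" "v \<in> sobolev 1 \<Omega>" and gh: "g \<in> borel_measurable borel" "h \<in> borel_measurable borel"
    using u v unfolding has_trace_def by auto
  note S = subspace_sobolev[OF \<Omega>(1), of 1]
  have pm: "p k \<in> borel_measurable borel" "q k \<in> borel_measurable borel" for k
    using p(1) q(1) smooth_continuous_on borel_measurable_continuous_onI by blast+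
  have "(\<lambda>k. sobolev_norm 1 \<Omega> (restriction \<Omega> (\<lambda>x. p k x + q k x) - (u + v))) \<longlonglongrightarrow> 0"
  proof (rule tendsto_sandwich[OF _ _ tendsto_const])
    have "sobolev_norm 1 \<Omega> (restriction \<Omega> (\<lambda>x. p k x + q k x) - (u + v)) \<le>
        sobolev_norm 1 \<Omega> (restriction \<Omega> (p k) - u) + sobolev_norm 1 \<Omega> (restriction \<Omega> (q k) - v)" for k
    proof -
      have eq: "restriction \<Omega> (\<lambda>x. p k x + q k x) - (u + v) = (restriction \<Omega> (p k) - u) + (restriction \<Omega> (q k) - v)"
        by (simp add: restriction_add algebra_simps)
      show ?thesis unfolding eq
        by (rule sobolev_norm_triangle[OF \<Omega>(1) subspace_diff[OF S restriction_smooth_sobolev[OF \<Omega> p(1)] uv(1)]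
            subspace_diff[OF S restriction_smooth_sobolev[OF \<Omega> q(1)] uv(2)]])
    qed
    then show "\<forall>\<^sub>F k in sequentially. sobolev_norm 1 \<Omega> (restriction \<Omega> (\<lambda>x. p k x + q k x) - (u + v)) \<le>
        sobolev_norm 1 \<Omega> (restriction \<Omega> (p k) - u) + sobolev_norm 1 \<Omega> (restriction \<Omega> (q k) - v)" by simp
    show "(\<lambda>k. sobolev_norm 1 \<Omega> (restriction \<Omega> (p k) - u) + sobolev_norm 1 \<Omega> (restriction \<Omega> (q k) - v)) \<longlonglongrightarrow> 0"
      using tendsto_add[OF p(2) q(2)] by simp
  qed (simp add: sobolev_norm_nonneg)
  moreover have "(\<lambda>k. \<integral>\<^sup>+x\<in>frontier \<Omega>. ennreal ((p k x + q k x - (g x + h x))\<^sup>2) \<partial>surface_measure) \<longlonglongrightarrow> 0"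
  proof (rule tendsto_sandwich[OF _ _ tendsto_const])
    let ?P = "\<lambda>k. \<integral>\<^sup>+x\<in>frontier \<Omega>. ennreal ((p k x - g x)\<^sup>2) \<partial>surface_measure"
    let ?Q = "\<lambda>k. \<integral>\<^sup>+x\<in>frontier \<Omega>. ennreal ((q k x - h x)\<^sup>2) \<partial>surface_measure"
    have "(\<integral>\<^sup>+x\<in>frontier \<Omega>. ennreal ((p k x + q k x - (g x + h x))\<^sup>2) \<partial>surface_measure) \<le> 2 * ?P k + 2 * ?Q k" for k
    proof -
      have fr: "frontier \<Omega> \<in> sets borel" by (simp add: borel_closed)
      have m: "(\<lambda>x. ennreal ((p k x - g x)\<^sup>2) * indicator (frontier \<Omega>) x) \<in> borel_measurable surface_measure"
        "(\<lambda>x. ennreal ((q k x - h x)\<^sup>2) * indicator (frontier \<Omega>) x) \<in> borel_measurable surface_measure"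
        unfolding measurable_surface_measure using pm gh fr by measurable
      \<comment> \<open>This pointwise bound stands in for Minkowski's inequality, as the boundary
        integrals are extended numbers and possibly infinite. The factor 2 is harmless in the
        limit.\<close>
      have le: "ennreal ((a + b)\<^sup>2) \<le> 2 * ennreal (a\<^sup>2) + 2 * ennreal (b\<^sup>2)" for a b :: real
      proof -
        have "(a + b)\<^sup>2 \<le> 2 * a\<^sup>2 + 2 * b\<^sup>2"
          using sum_squares_bound[of a b] by (simp add: power2_sum)
        then have "ennreal ((a + b)\<^sup>2) \<le> ennreal (2 * a\<^sup>2 + 2 * b\<^sup>2)" by (rule ennreal_leI)
        also have "\<dots> = 2 * ennreal (a\<^sup>2) + 2 * ennreal (b\<^sup>2)"
          by (simp add: ennreal_plus ennreal_mult)
        finally show ?thesis .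
      qed
      have "(\<integral>\<^sup>+x\<in>frontier \<Omega>. ennreal ((p k x + q k x - (g x + h x))\<^sup>2) \<partial>surface_measure) \<le>
          (\<integral>\<^sup>+x. 2 * (ennreal ((p k x - g x)\<^sup>2) * indicator (frontier \<Omega>) x) +
                 2 * (ennreal ((q k x - h x)\<^sup>2) * indicator (frontier \<Omega>) x) \<partial>surface_measure)"
      proof (rule nn_integral_mono)
        fix x
        show "ennreal ((p k x + q k x - (g x + h x))\<^sup>2) * indicator (frontier \<Omega>) x \<le>
            2 * (ennreal ((p k x - g x)\<^sup>2) * indicator (frontier \<Omega>) x) +
            2 * (ennreal ((q k x - h x)\<^sup>2) * indicator (frontier \<Omega>) x)"
          using le[of "p k x - g x" "q k x - h x"] by (auto split: split_indicator simp: algebra_simps)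
      qed
      also have "\<dots> = 2 * ?P k + 2 * ?Q k"
        using m by (simp add: nn_integral_add nn_integral_cmult)
      finally show ?thesis .
    qed
    then show "\<forall>\<^sub>F k in sequentially. (\<integral>\<^sup>+x\<in>frontier \<Omega>. ennreal ((p k x + q k x - (g x + h x))\<^sup>2) \<partial>surface_measure)
        \<le> 2 * ?P k + 2 * ?Q k" by simp
    have "(\<lambda>k. 2 * ?P k + 2 * ?Q k) \<longlonglongrightarrow> 2 * 0 + 2 * 0"
      by (intro tendsto_add ennreal_tendsto_cmult p(3) q(3)) auto
    then show "(\<lambda>k. 2 * ?P k + 2 * ?Q k) \<longlonglongrightarrow> 0" by simp
  qed simp
  ultimately show ?thesis
    unfolding has_trace_def using subspace_add[OF S uv] gh smooth_add[OF p(1) q(1)]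
    by (intro conjI exI[of _ "\<lambda>k x. p k x + q k x"]) auto
qed

lemma has_trace_scale:
  assumes \<Omega>: "open \<Omega>" "bounded \<Omega>" and u: "has_trace \<Omega> u g"
  shows "has_trace \<Omega> (c *\<^sub>R u) (\<lambda>x. c * g x)"
proof -
  obtain p where p: "\<And>k. smooth (p k)" "(\<lambda>k. sobolev_norm 1 \<Omega> (restriction \<Omega> (p k) - u)) \<longlonglongrightarrow> 0"
    "(\<lambda>k. \<integral>\<^sup>+x\<in>frontier \<Omega>. ennreal ((p k x - g x)\<^sup>2) \<partial>surface_measure) \<longlonglongrightarrow> 0"
    using u unfolding has_trace_def by blast
  have uu: "u \<in> sobolev 1 \<Omega>" and g: "g \<in> borel_measurable borel"
    using u unfolding has_trace_def by auto
  note S = subspace_sobolev[OF \<Omega>(1), of 1]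
  have pm: "p k \<in> borel_measurable borel" for k
    using p(1) smooth_continuous_on borel_measurable_continuous_onI by blast
  have "sobolev_norm 1 \<Omega> (restriction \<Omega> (\<lambda>x. c * p k x) - c *\<^sub>R u) = \<bar>c\<bar> * sobolev_norm 1 \<Omega> (restriction \<Omega> (p k) - u)" for k
    using sobolev_norm_scale[OF \<Omega>(1) subspace_diff[OF S restriction_smooth_sobolev[OF \<Omega> p(1)] uu]]
    by (simp add: restriction_scale scaleR_diff_right)
  then have "(\<lambda>k. sobolev_norm 1 \<Omega> (restriction \<Omega> (\<lambda>x. c * p k x) - c *\<^sub>R u)) \<longlonglongrightarrow> 0"
    using tendsto_mult_right_zero[OF p(2)] by simp
  moreover have "(\<lambda>k. \<integral>\<^sup>+x\<in>frontier \<Omega>. ennreal ((c * p k x - c * g x)\<^sup>2) \<partial>surface_measure) \<longlonglongrightarrow> 0"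
  proof -
    have "(\<integral>\<^sup>+x\<in>frontier \<Omega>. ennreal ((c * p k x - c * g x)\<^sup>2) \<partial>surface_measure) =
        ennreal (c\<^sup>2) * (\<integral>\<^sup>+x\<in>frontier \<Omega>. ennreal ((p k x - g x)\<^sup>2) \<partial>surface_measure)" for k
    proof -
      have fr: "frontier \<Omega> \<in> sets borel" by (simp add: borel_closed)
      have m: "(\<lambda>x. ennreal ((p k x - g x)\<^sup>2) * indicator (frontier \<Omega>) x) \<in> borel_measurable surface_measure"
        unfolding measurable_surface_measure using pm g fr by measurable
      have "ennreal ((c * p k x - c * g x)\<^sup>2) = ennreal (c\<^sup>2) * ennreal ((p k x - g x)\<^sup>2)" for x
        by (simp add: ennreal_mult[symmetric] power_mult_distrib flip: right_diff_distrib)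
      then show ?thesis using nn_integral_cmult[OF m] by (simp add: mult.assoc)
    qed
    moreover have "(\<lambda>k. ennreal (c\<^sup>2) * (\<integral>\<^sup>+x\<in>frontier \<Omega>. ennreal ((p k x - g x)\<^sup>2) \<partial>surface_measure)) \<longlonglongrightarrow> ennreal (c\<^sup>2) * 0"
      by (intro ennreal_tendsto_cmult p(3)) simp
    ultimately show ?thesis by simp
  qed
  ultimately show ?thesis
    unfolding has_trace_def using subspace_scale[OF S uu] g smooth_mult[OF smooth_const p(1)]
    by (intro conjI exI[of _ "\<lambda>k x. c * p k x"]) auto
qed

lemma has_trace_zero:
  assumes "open \<Omega>"
  shows "has_trace \<Omega> 0 (\<lambda>_. 0)"
proof -
  note S = subspace_0[OF subspace_sobolev[OF assms, of 1]]
  have "sobolev_norm 1 \<Omega> (0 :: 'a field) = 0" using sobolev_norm_scale[OF assms S, of 0] by simp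
  then show ?thesis
    unfolding has_trace_def using S smooth_const
    by (intro conjI exI[of _ "\<lambda>_ _. 0"]) (auto simp: restriction_zero)
qed

section \<open>Linearity of the boundary conditions\<close>

lemma subspace_H1_bc:
  assumes "open \<Omega>" "bounded \<Omega>"
  shows "subspace (H1_bc \<Omega> \<Gamma>)"
proof (rule subspaceI)
  note S = subspace_sobolev[OF assms(1), of 1]
  show "0 \<in> H1_bc \<Omega> \<Gamma>"
    unfolding H1_bc_def using subspace_0[OF S] has_trace_zero[OF assms(1)] by auto
  show "u + v \<in> H1_bc \<Omega> \<Gamma>" if uv: "u \<in> H1_bc \<Omega> \<Gamma>" "v \<in> H1_bc \<Omega> \<Gamma>" for u v
  proof -
    obtain g where g: "has_trace \<Omega> u g" "AE x in surface_measure. x \<in> \<Gamma> \<longrightarrow> g x = 0"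
      using uv(1) unfolding H1_bc_def by auto
    obtain h where h: "has_trace \<Omega> v h" "AE x in surface_measure. x \<in> \<Gamma> \<longrightarrow> h x = 0"
      using uv(2) unfolding H1_bc_def by auto
    have "AE x in surface_measure. x \<in> \<Gamma> \<longrightarrow> g x + h x = 0" using g(2) h(2) by eventually_elim auto
    moreover have "u + v \<in> sobolev 1 \<Omega>" using uv subspace_add[OF S] unfolding H1_bc_def by blast
    ultimately show ?thesis
      unfolding H1_bc_def using has_trace_add[OF assms g(1) h(1)] by blast
  qed
  show "c *\<^sub>R u \<in> H1_bc \<Omega> \<Gamma>" if u: "u \<in> H1_bc \<Omega> \<Gamma>" for c u
  proof -
    obtain g where g: "has_trace \<Omega> u g" "AE x in surface_measure. x \<in> \<Gamma> \<longrightarrow> g x = 0"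
      using u unfolding H1_bc_def by auto
    have "AE x in surface_measure. x \<in> \<Gamma> \<longrightarrow> c * g x = 0" using g(2) by eventually_elim auto
    moreover have "c *\<^sub>R u \<in> sobolev 1 \<Omega>" using u subspace_scale[OF S] unfolding H1_bc_def by blast
    ultimately show ?thesis
      unfolding H1_bc_def using has_trace_scale[OF assms g(1)] by blast
  qed
qed

lemma subspace_G_bc:
  assumes "open \<Omega>" "bounded \<Omega>"
  shows "subspace (G_bc \<Omega> \<Gamma>c \<Gamma>s)"
proof (rule subspaceI)
  note S = subspace_sobolev_vec[OF assms(1), of 1]
  show "0 \<in> G_bc \<Omega> \<Gamma>c \<Gamma>s"
    unfolding G_bc_def has_trace_vec_def using subspace_0[OF S] has_trace_zero[OF assms(1)]
    by (auto intro!: exI[of _ "\<lambda>_. 0"] simp: tangential_def)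
  show "\<psi> + \<xi> \<in> G_bc \<Omega> \<Gamma>c \<Gamma>s" if pc: "\<psi> \<in> G_bc \<Omega> \<Gamma>c \<Gamma>s" "\<xi> \<in> G_bc \<Omega> \<Gamma>c \<Gamma>s" for \<psi> \<xi>
  proof -
    obtain g where g: "has_trace_vec \<Omega> \<psi> g" "AE x in surface_measure. x \<in> \<Gamma>c \<longrightarrow> g x = 0"
      "AE x in surface_measure. x \<in> \<Gamma>s \<longrightarrow> tangential (outward_normal \<Omega> x) (g x) = 0"
      using pc(1) unfolding G_bc_def by auto
    obtain h where h: "has_trace_vec \<Omega> \<xi> h" "AE x in surface_measure. x \<in> \<Gamma>c \<longrightarrow> h x = 0"
      "AE x in surface_measure. x \<in> \<Gamma>s \<longrightarrow> tangential (outward_normal \<Omega> x) (h x) = 0"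
      using pc(2) unfolding G_bc_def by auto
    have "AE x in surface_measure. x \<in> \<Gamma>c \<longrightarrow> g x + h x = 0" using g(2) h(2) by eventually_elim auto
    moreover have "AE x in surface_measure. x \<in> \<Gamma>s \<longrightarrow> tangential (outward_normal \<Omega> x) (g x + h x) = 0"
      using g(3) h(3)
    proof eventually_elim
      case (elim x)
      have "tangential n (a + b) = tangential n a + tangential n b" for n a b :: "'a space"
        unfolding tangential_def by (simp add: inner_add_left scaleR_add_left)
      then show ?case using elim by simp
    qed
    moreover have "\<psi> + \<xi> \<in> sobolev_vec 1 \<Omega>" using pc subspace_add[OF S] unfolding G_bc_def by blast
    moreover have "has_trace_vec \<Omega> (\<psi> + \<xi>) (\<lambda>x. g x + h x)"
      using g(1) h(1) has_trace_add[OF assms] unfolding has_trace_vec_def by simp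
    ultimately show ?thesis unfolding G_bc_def by blast
  qed
  show "c *\<^sub>R \<psi> \<in> G_bc \<Omega> \<Gamma>c \<Gamma>s" if p: "\<psi> \<in> G_bc \<Omega> \<Gamma>c \<Gamma>s" for c \<psi>
  proof -
    obtain g where g: "has_trace_vec \<Omega> \<psi> g" "AE x in surface_measure. x \<in> \<Gamma>c \<longrightarrow> g x = 0"
      "AE x in surface_measure. x \<in> \<Gamma>s \<longrightarrow> tangential (outward_normal \<Omega> x) (g x) = 0"
      using p unfolding G_bc_def by auto
    have "AE x in surface_measure. x \<in> \<Gamma>c \<longrightarrow> c *\<^sub>R g x = 0" using g(2) by eventually_elim auto
    moreover have "AE x in surface_measure. x \<in> \<Gamma>s \<longrightarrow> tangential (outward_normal \<Omega> x) (c *\<^sub>R g x) = 0"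
      using g(3)
    proof eventually_elim
      case (elim x)
      have "tangential n (c *\<^sub>R a) = c *\<^sub>R tangential n a" for n a :: "'a space"
        unfolding tangential_def by (simp add: scaleR_diff_right)
      then show ?case using elim by simp
    qed
    moreover have "c *\<^sub>R \<psi> \<in> sobolev_vec 1 \<Omega>" using p subspace_scale[OF S] unfolding G_bc_def by blast
    moreover have "has_trace_vec \<Omega> (c *\<^sub>R \<psi>) (\<lambda>x. c *\<^sub>R g x)"
      using g(1) has_trace_scale[OF assms] unfolding has_trace_vec_def by simp
    ultimately show ?thesis unfolding G_bc_def by blast
  qed
qed

section \<open>Forms on smaller spaces and on products\<close>

lemma linear_form_on_subset: "linear_form_on V F \<Longrightarrow> U \<subseteq> V \<Longrightarrow> linear_form_on U F"
  unfolding linear_form_on_def by blast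

lemma bilinear_form_on_subset: "bilinear_form_on V b \<Longrightarrow> U \<subseteq> V \<Longrightarrow> bilinear_form_on U b"
  unfolding bilinear_form_on_def using linear_form_on_subset by (metis subsetD)

text \<open>The summand of the second factor comes first to match
  \<open>a \<gamma> \<psi> + c w v\<close> and \<open>F1 \<psi> + F2 v\<close> on pairs
  \<open>(v, \<psi>)\<close>.\<close>

lemma linear_form_on_product:
  assumes "linear_form_on U f" "linear_form_on V g"
  shows "linear_form_on (U \<times> V) (\<lambda>(u, v). g v + f u)"
  using assms unfolding linear_form_on_def by (auto simp: algebra_simps)


section \<open>The mixed problem\<close>

text \<open>The abstract problem treats \<open>(w, \<gamma>)\<close> as one unknown, whereas the
  mixed problem asks for a flat triple.\<close>

lemma ex1_triple_assoc: "(\<exists>!((x, y), z). P x y z) \<longleftrightarrow> (\<exists>!(x, y, z). P x y z)"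
  unfolding Ex1_def by (simp add: split_paired_All split_paired_Ex)

theorem lemma4p2:
  fixes \<Omega> \<Gamma>c \<Gamma>s \<Gamma>f :: "'d::{finite, comm_ring_1} space set"
    and B c :: "'d field \<Rightarrow> 'd field \<Rightarrow> real"
    and a :: "'d vfield \<Rightarrow> 'd vfield \<Rightarrow> real"
    and M_B \<alpha> M :: real
    and Wt Wt\<^sub>\<Gamma> W\<^sub>\<Gamma> :: "'d field set"
    and G G\<^sub>\<Gamma> Q\<^sub>\<Gamma> :: "'d vfield set"
  assumes d: "CARD('d) = 2 \<or> CARD('d) = 3"
    and \<Omega>: "connected \<Omega>" "lipschitz_domain \<Omega>" "polyhedral \<Omega>"
    and \<Gamma>: "\<Gamma>c \<union> \<Gamma>s \<union> \<Gamma>f = frontier \<Omega>" "\<Gamma>c \<inter> \<Gamma>s = {}" "\<Gamma>c \<inter> \<Gamma>f = {}" "\<Gamma>s \<inter> \<Gamma>f = {}"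
    and d2: "CARD('d) = 2 \<longrightarrow> polygonal_with_holes \<Omega>"
    and d3: "CARD('d) = 3 \<longrightarrow> extendable_across \<Omega> (\<Gamma>c \<union> \<Gamma>s)"
    and B_bilinear: "bilinear_form_on (sobolev 2 \<Omega>) B"
    and B_bounded: "M_B > 0"
      "\<forall>u\<in>sobolev 2 \<Omega>. \<forall>v\<in>sobolev 2 \<Omega>. \<bar>B u v\<bar> \<le> M_B * sobolev_norm 2 \<Omega> u * sobolev_norm 2 \<Omega> v"
    and B_inf_sup: "\<alpha> > 0" "inf_sup (H2_bc \<Omega> \<Gamma>c \<Gamma>s) (sobolev_norm 2 \<Omega>) B \<ge> ereal \<alpha>"
    and B_nondegenerate:
      "\<forall>v\<in>H2_bc \<Omega> \<Gamma>c \<Gamma>s. v \<noteq> 0 \<longrightarrow> (SUP u\<in>H2_bc \<Omega> \<Gamma>c \<Gamma>s. ereal (B u v)) > 0"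
    and a_bilinear: "bilinear_form_on (sobolev_vec 1 \<Omega>) a"
    and c_bilinear: "bilinear_form_on (sobolev 1 \<Omega>) c"
    and M: "M > 0"
    and a_bounded: "\<forall>\<theta>\<in>sobolev_vec 1 \<Omega>. \<forall>\<psi>\<in>sobolev_vec 1 \<Omega>.
      \<bar>a \<theta> \<psi>\<bar> \<le> M * sobolev_vec_norm 1 \<Omega> \<theta> * sobolev_vec_norm 1 \<Omega> \<psi>"
    and c_bounded: "\<forall>w\<in>sobolev 1 \<Omega>. \<forall>v\<in>sobolev 1 \<Omega>.
      \<bar>c w v\<bar> \<le> M * sobolev_norm 1 \<Omega> w * sobolev_norm 1 \<Omega> v"
    and B_decomp: "\<forall>w\<in>sobolev 2 \<Omega>. \<forall>v\<in>sobolev 2 \<Omega>. B w v = a (grad \<Omega> w) (grad \<Omega> v) + c w v"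
    and Wt: "finite_dim_subspace Wt" "Wt \<subseteq> sobolev 1 \<Omega>"
    and G: "finite_dim_subspace G" "G \<subseteq> sobolev_vec 1 \<Omega>"
    and Wt\<^sub>\<Gamma>: "Wt\<^sub>\<Gamma> = Wt \<inter> H1_bc \<Omega> (\<Gamma>c \<union> \<Gamma>s)"
    and G\<^sub>\<Gamma>: "G\<^sub>\<Gamma> = G \<inter> G_bc \<Omega> \<Gamma>c \<Gamma>s"
    and Q\<^sub>\<Gamma>: "Q\<^sub>\<Gamma> = Xi \<Omega> ` (Wt\<^sub>\<Gamma> \<times> G\<^sub>\<Gamma>)"
    and W\<^sub>\<Gamma>: "W\<^sub>\<Gamma> = {v \<in> Wt\<^sub>\<Gamma>. grad \<Omega> v \<in> G\<^sub>\<Gamma>}"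
  shows "(\<forall>F1 \<in> dual_space G\<^sub>\<Gamma> (sobolev_vec_norm 1 \<Omega>). \<forall>F2 \<in> dual_space Wt\<^sub>\<Gamma> (sobolev_norm 1 \<Omega>).
            \<exists>!s. case s of (w, \<gamma>, q) \<Rightarrow>
              w \<in> Wt\<^sub>\<Gamma> \<and> \<gamma> \<in> G\<^sub>\<Gamma> \<and> q \<in> Q\<^sub>\<Gamma> \<and>
              (\<forall>v\<in>Wt\<^sub>\<Gamma>. \<forall>\<psi>\<in>G\<^sub>\<Gamma>.
                 a \<gamma> \<psi> + c w v + curl_inner \<Omega> (Xi \<Omega> (v, \<psi>)) q = F1 \<psi> + F2 v) \<and>
              (\<forall>\<eta>\<in>Q\<^sub>\<Gamma>. curl_inner \<Omega> (Xi \<Omega> (w, \<gamma>)) \<eta> = 0))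
         \<longleftrightarrow> inf_sup W\<^sub>\<Gamma> (sobolev_norm 2 \<Omega>) B > 0"
proof -
  have op: "open \<Omega>" and bd: "bounded \<Omega>" using \<Omega>(2) unfolding lipschitz_domain_def by auto
  have subWt: "subspace Wt" and subG: "subspace G"
    using finite_dim_subspace_basis[OF Wt(1)] finite_dim_subspace_basis[OF G(1)] by metis+
  have subW\<Gamma>: "subspace Wt\<^sub>\<Gamma>" unfolding Wt\<^sub>\<Gamma> by (intro subspace_inter subWt subspace_H1_bc op bd)
  have subG\<Gamma>: "subspace G\<^sub>\<Gamma>" unfolding G\<^sub>\<Gamma> by (intro subspace_inter subG subspace_G_bc op bd)
  have WtS: "Wt\<^sub>\<Gamma> \<subseteq> sobolev 1 \<Omega>" and GS: "G\<^sub>\<Gamma> \<subseteq> sobolev_vec 1 \<Omega>" using Wt(2) G(2) unfolding Wt\<^sub>\<Gamma> G\<^sub>\<Gamma> by auto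
  have finW: "finite_dim_subspace Wt\<^sub>\<Gamma>"
    by (rule finite_dim_subspace_mono[OF Wt(1) subW\<Gamma>]) (auto simp: Wt\<^sub>\<Gamma>)
  have finG: "finite_dim_subspace G\<^sub>\<Gamma>"
    by (rule finite_dim_subspace_mono[OF G(1) subG\<Gamma>]) (auto simp: G\<^sub>\<Gamma>)
  let ?V = "Wt\<^sub>\<Gamma> \<times> G\<^sub>\<Gamma>"
  have V: "finite_dim_subspace ?V" by (rule finite_dim_subspace_Times[OF finW finG])
  have Xadd: "Xi \<Omega> (s + t) = Xi \<Omega> s + Xi \<Omega> t" if "s \<in> ?V" "t \<in> ?V" for s t
  proof -
    have "grad \<Omega> (fst s + fst t) = grad \<Omega> (fst s) + grad \<Omega> (fst t)"
      using that WtS by (intro grad_add[OF op]) (auto simp del: One_nat_def)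
    then show ?thesis unfolding Xi_def by (simp add: split_beta)
  qed
  have Xscale: "Xi \<Omega> (r *\<^sub>R s) = r *\<^sub>R Xi \<Omega> s" if "s \<in> ?V" for r s
  proof -
    have "grad \<Omega> (r *\<^sub>R fst s) = r *\<^sub>R grad \<Omega> (fst s)"
      using that WtS by (intro grad_scale[OF op]) (auto simp del: One_nat_def)
    then show ?thesis unfolding Xi_def by (simp add: split_beta scaleR_diff_right)
  qed
  \<comment> \<open>\<open>curl_inner\<close> has been shown bilinear and definite on fields with
    weak rotations, so this inclusion makes it an inner product on the multiplier space.\<close>
  have Qrot: "Xi \<Omega> ` ?V \<subseteq> weak_rot_fields \<Omega>"
  proof
    fix q assume "q \<in> Xi \<Omega> ` ?V"
    then obtain v \<psi> where "v \<in> Wt\<^sub>\<Gamma>" "\<psi> \<in> G\<^sub>\<Gamma>" and q: "q = grad \<Omega> v - \<psi>" unfolding Xi_def by auto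
    then have "grad \<Omega> v \<in> weak_rot_fields \<Omega>" "\<psi> \<in> weak_rot_fields \<Omega>"
      using grad_weak_rot_fields[OF op] sobolev_vec_weak_rot_fields[OF op] WtS GS by auto
    then show "q \<in> weak_rot_fields \<Omega>"
      unfolding q by (rule subspace_diff[OF subspace_weak_rot_fields[OF op]])
  qed
  have ip: "bilinear_form_on (Xi \<Omega> ` ?V) (curl_inner \<Omega>)"
    by (rule bilinear_form_on_subset[OF bilinear_form_on_curl_inner[OF op] Qrot])
  have ip_pos: "q = 0" if "q \<in> Xi \<Omega> ` ?V" "curl_inner \<Omega> q q = 0" for q
    using curl_inner_self_eq_0[OF op _ that(2)] that(1) Qrot by blast
  define A where "A = (\<lambda>(w, \<gamma>) (v, \<psi>). a \<gamma> \<psi> + c w v)"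
  have A: "bilinear_form_on ?V A"
  proof -
    have c': "bilinear_form_on Wt\<^sub>\<Gamma> c" by (rule bilinear_form_on_subset[OF c_bilinear WtS])
    have a': "bilinear_form_on G\<^sub>\<Gamma> a" by (rule bilinear_form_on_subset[OF a_bilinear GS])
    show ?thesis
      unfolding bilinear_form_on_def
    proof (intro conjI ballI)
      fix s assume "s \<in> ?V"
      then have "linear_form_on ?V (\<lambda>(v, \<psi>). a (snd s) \<psi> + c (fst s) v)"
        "linear_form_on ?V (\<lambda>(v, \<psi>). a \<psi> (snd s) + c v (fst s))"
        using a' c' unfolding bilinear_form_on_def by (auto intro!: linear_form_on_product)
      moreover have "A s = (\<lambda>(v, \<psi>). a (snd s) \<psi> + c (fst s) v)"
        "(\<lambda>t. A t s) = (\<lambda>(v, \<psi>). a \<psi> (snd s) + c v (fst s))"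
        unfolding A_def by (auto simp: split_beta)
      ultimately show "linear_form_on ?V (A s)" "linear_form_on ?V (\<lambda>t. A t s)" by simp_all
    qed
  qed
  let ?D1 = "dual_space G\<^sub>\<Gamma> (sobolev_vec_norm 1 \<Omega>)" and ?D2 = "dual_space Wt\<^sub>\<Gamma> (sobolev_norm 1 \<Omega>)"
  \<comment> \<open>Each pair of functionals, read as one functional on the product, is a datum of
    the abstract problem.\<close>
  define FF where "FF = (\<lambda>(F1, F2) (v, \<psi>). F1 \<psi> + F2 v :: real) ` (?D1 \<times> ?D2)"
  have FF: "linear_form_on ?V F" if "F \<in> FF" for F
    using that unfolding FF_def dual_space_def by (auto intro!: linear_form_on_product)
  have FF0: "(\<lambda>_. 0) \<in> FF"
  proof -
    have "(\<lambda>_. 0) \<in> ?D1" "(\<lambda>_. 0) \<in> ?D2"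
      unfolding dual_space_def linear_form_on_def by (auto intro!: exI[of _ 0])
    then show ?thesis
      unfolding FF_def by (intro image_eqI[of _ _ "(\<lambda>_. 0, \<lambda>_. 0)"]) (auto simp: fun_eq_iff)
  qed
  \<comment> \<open>Obtained by scaling with 0, since \<open>weak_deriv\<close> is only a
    description. It ensures that \<open>(u, grad \<Omega> u)\<close> is zero exactly if u
    is.\<close>
  have grad0: "grad \<Omega> 0 = 0"
    using grad_scale[OF op, of 0 0] subspace_0[OF subspace_sobolev[OF op, of 1]] by simp
  have subW: "subspace W\<^sub>\<Gamma>"
  proof (rule subspaceI)
    show "0 \<in> W\<^sub>\<Gamma>" using subspace_0[OF subW\<Gamma>] subspace_0[OF subG\<Gamma>] grad0 unfolding W\<^sub>\<Gamma> by simp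
    show "u + v \<in> W\<^sub>\<Gamma>" if "u \<in> W\<^sub>\<Gamma>" "v \<in> W\<^sub>\<Gamma>" for u v
    proof -
      have uv: "u \<in> Wt\<^sub>\<Gamma>" "v \<in> Wt\<^sub>\<Gamma>" "grad \<Omega> u \<in> G\<^sub>\<Gamma>" "grad \<Omega> v \<in> G\<^sub>\<Gamma>" using that unfolding W\<^sub>\<Gamma> by blast+
      then have "grad \<Omega> (u + v) = grad \<Omega> u + grad \<Omega> v" using WtS by (intro grad_add[OF op]) blast+
      then show ?thesis using subspace_add[OF subW\<Gamma> uv(1,2)] subspace_add[OF subG\<Gamma> uv(3,4)] unfolding W\<^sub>\<Gamma> by simp
    qed
    show "r *\<^sub>R u \<in> W\<^sub>\<Gamma>" if "u \<in> W\<^sub>\<Gamma>" for r u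
    proof -
      have u: "u \<in> Wt\<^sub>\<Gamma>" "grad \<Omega> u \<in> G\<^sub>\<Gamma>" using that unfolding W\<^sub>\<Gamma> by blast+
      then have "grad \<Omega> (r *\<^sub>R u) = r *\<^sub>R grad \<Omega> u" using WtS by (intro grad_scale[OF op]) blast
      then show ?thesis using subspace_scale[OF subW\<Gamma> u(1)] subspace_scale[OF subG\<Gamma> u(2)] unfolding W\<^sub>\<Gamma> by simp
    qed
  qed
  have fin: "finite_dim_subspace W\<^sub>\<Gamma>"
    by (rule finite_dim_subspace_mono[OF finW subW]) (auto simp: W\<^sub>\<Gamma>)
  have W2: "W\<^sub>\<Gamma> \<subseteq> sobolev 2 \<Omega>"
    using sobolev_2_if_grad[OF op] WtS GS unfolding W\<^sub>\<Gamma> by blast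
  have "inf_sup W\<^sub>\<Gamma> (sobolev_norm 2 \<Omega>) B > 0 \<longleftrightarrow> (\<forall>u\<in>W\<^sub>\<Gamma>. (\<forall>v\<in>W\<^sub>\<Gamma>. B u v = 0) \<longrightarrow> u = 0)"
    by (rule inf_sup_pos_iff_nondegenerate[OF fin bilinear_form_on_subset[OF B_bilinear W2]])
       (use W2 sobolev_norm_pos[OF op] sobolev_norm_triangle[OF op] sobolev_norm_scale[OF op] in blast)+
  also have "\<dots> \<longleftrightarrow> (\<forall>s\<in>{s\<in>?V. Xi \<Omega> s = 0}. (\<forall>t\<in>{s\<in>?V. Xi \<Omega> s = 0}. A s t = 0) \<longrightarrow> s = 0)"
  proof -
    have "{s\<in>?V. Xi \<Omega> s = 0} = (\<lambda>v. (v, grad \<Omega> v)) ` W\<^sub>\<Gamma>"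
      unfolding Xi_def W\<^sub>\<Gamma> by auto
    moreover have "A (u, grad \<Omega> u) (v, grad \<Omega> v) = B u v" if "u \<in> W\<^sub>\<Gamma>" "v \<in> W\<^sub>\<Gamma>" for u v
      using B_decomp subsetD[OF W2 that(1)] subsetD[OF W2 that(2)] unfolding A_def by simp
    moreover have "(u, grad \<Omega> u) = 0 \<longleftrightarrow> u = 0" for u
      using grad0 by (auto simp: zero_prod_def)
    ultimately show ?thesis by simp
  qed
  also have "\<dots> \<longleftrightarrow> (\<forall>F\<in>FF. \<exists>!(s, q). s \<in> ?V \<and> q \<in> Xi \<Omega> ` ?V \<and>
      (\<forall>t\<in>?V. A s t + curl_inner \<Omega> (Xi \<Omega> t) q = F t) \<and> (\<forall>\<eta>\<in>Xi \<Omega> ` ?V. curl_inner \<Omega> (Xi \<Omega> s) \<eta> = 0))"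
    by (rule saddle_point_unique_solution_iff[OF V Xadd Xscale ip ip_pos A FF FF0, symmetric])
  also have "\<dots> \<longleftrightarrow> (\<forall>F1\<in>?D1. \<forall>F2\<in>?D2. \<exists>!(s, q). s \<in> ?V \<and> q \<in> Q\<^sub>\<Gamma> \<and>
      (\<forall>t\<in>?V. A s t + curl_inner \<Omega> (Xi \<Omega> t) q = F1 (snd t) + F2 (fst t)) \<and>
      (\<forall>\<eta>\<in>Q\<^sub>\<Gamma>. curl_inner \<Omega> (Xi \<Omega> s) \<eta> = 0))"
    unfolding FF_def Q\<^sub>\<Gamma> by (simp add: split_beta)
  also have "\<dots> \<longleftrightarrow> (\<forall>F1\<in>?D1. \<forall>F2\<in>?D2.
            \<exists>!s. case s of (w, \<gamma>, q) \<Rightarrow>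
              w \<in> Wt\<^sub>\<Gamma> \<and> \<gamma> \<in> G\<^sub>\<Gamma> \<and> q \<in> Q\<^sub>\<Gamma> \<and>
              (\<forall>v\<in>Wt\<^sub>\<Gamma>. \<forall>\<psi>\<in>G\<^sub>\<Gamma>.
                 a \<gamma> \<psi> + c w v + curl_inner \<Omega> (Xi \<Omega> (v, \<psi>)) q = F1 \<psi> + F2 v) \<and>
              (\<forall>\<eta>\<in>Q\<^sub>\<Gamma>. curl_inner \<Omega> (Xi \<Omega> (w, \<gamma>)) \<eta> = 0))"
  proof (intro ball_cong refl)
    fix F1 F2
    let ?P = "\<lambda>w \<gamma> q. w \<in> Wt\<^sub>\<Gamma> \<and> \<gamma> \<in> G\<^sub>\<Gamma> \<and> q \<in> Q\<^sub>\<Gamma> \<and>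
              (\<forall>v\<in>Wt\<^sub>\<Gamma>. \<forall>\<psi>\<in>G\<^sub>\<Gamma>.
                 a \<gamma> \<psi> + c w v + curl_inner \<Omega> (Xi \<Omega> (v, \<psi>)) q = F1 \<psi> + F2 v) \<and>
              (\<forall>\<eta>\<in>Q\<^sub>\<Gamma>. curl_inner \<Omega> (Xi \<Omega> (w, \<gamma>)) \<eta> = 0)"
    have "(\<lambda>(s, q). s \<in> ?V \<and> q \<in> Q\<^sub>\<Gamma> \<and>
        (\<forall>t\<in>?V. A s t + curl_inner \<Omega> (Xi \<Omega> t) q = F1 (snd t) + F2 (fst t)) \<and>
        (\<forall>\<eta>\<in>Q\<^sub>\<Gamma>. curl_inner \<Omega> (Xi \<Omega> s) \<eta> = 0)) = (\<lambda>((w, \<gamma>), q). ?P w \<gamma> q)"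
      unfolding A_def by (auto simp: fun_eq_iff)
    then show "(\<exists>!(s, q). s \<in> ?V \<and> q \<in> Q\<^sub>\<Gamma> \<and>
        (\<forall>t\<in>?V. A s t + curl_inner \<Omega> (Xi \<Omega> t) q = F1 (snd t) + F2 (fst t)) \<and>
        (\<forall>\<eta>\<in>Q\<^sub>\<Gamma>. curl_inner \<Omega> (Xi \<Omega> s) \<eta> = 0)) \<longleftrightarrow> (\<exists>!s. case s of (w, \<gamma>, q) \<Rightarrow> ?P w \<gamma> q)"
      using ex1_triple_assoc[of ?P] by simp
  qed
  finally show ?thesis by (rule sym)
qed

end
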